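(* Let $\mathcal{C}$ be a finitely complete $(\infty,1)$-category and $\Phi$ a product closed filter on $\mathrm{Sub}_{\mathcal C}(1)$. Then for two morphisms $f,g:X\to Y$ in $\mathcal{C}_\Phi$, $$f\simeq g \text{ in } \mathcal{C}_\Phi \iff \exists\, U\in\Phi\ \big(f\times\mathrm{id}_U\simeq g\times\mathrm{id}_U \text{ in } \mathcal{C}\big).$$
   Context: An $(\infty,1)$-category means a quasi-category, Kan enriched category or complete Segal space (CSS). $\mathrm{Sub}(1)$ is the poset of subobjects of the final object $1$, with meets given by products; a product closed filter is a subset $\Phi$ containing $1$, closed under finite products and upward closed. Filter quotient $\mathcal{C}_\Phi$: for a finitely complete CSS $\mathcal{W}$, $\mathcal{W}_\Phi=\mathrm{colim}_{V\in\Phi^{op}}\mathcal{W}_{/V}$, the level-wise colimit of bisimplicial sets with transition maps $-\times U:\mathcal{W}_{/V}\to\mathcal{W}_{/U}$ for $U\leq V$; for quasi-categories analogously; for a Kan enriched category $\mathcal{K}$, $\mathcal{K}_\Phi$ has the objects of $\mathcal{K}$ and $\mathrm{Map}_{\mathcal{K}_\Phi}(X,Y)=\mathrm{colim}_{V\in\Phi^{op}}\mathrm{Map}_{\mathcal{K}}(X\times V,Y)$, with composition $[g]\circ[f]=[g(f\times\mathrm{id}_V)]$. There is a canonical functor $P_\Phi:\mathcal{C}\to\mathcal{C}_\Phi$ (inclusion of $\mathcal{C}=\mathcal{C}_{/1}$ into the colimit), and objects $X$ of $\mathcal{C}$ are regarded as objects of $\mathcal{C}_\Phi$ via $P_\Phi$.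 Mapping spaces are $$\mathrm{Map}_{\mathcal{C}_\Phi}(X,Y)=\mathrm{colim}_{V\in\Phi^{op}}\mathrm{Map}_{\mathcal{C}}(X\times V,Y\times V).$$ Thus morphisms $f,g:X\to Y$ in $\mathcal{C}_\Phi$ are represented by morphisms $X\times V\to Y\times V$ in $\mathcal{C}$ for some common $V\in\Phi$ (with $V=1$ for morphisms coming from $\mathcal{C}$), and $f\times\mathrm{id}_U$, $g\times\mathrm{id}_U$ denote the products of such representatives with $\mathrm{id}_U$. The symbol $\simeq$ between parallel morphisms means that they lie in the same path component of the mapping space. *)

theory Defs
  imports "HOL-Library.FuncSet"
begin

section \<open>Simplicial sets\<close>

text \<open>
  A monotone map from [m] = {0,...,m} to [n] is encoded as the sorted list of its m + 1 values.
\<close>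

definition ops :: "nat \<Rightarrow> nat \<Rightarrow> nat list set" where
  "ops m n = {\<theta>. length \<theta> = Suc m \<and> sorted \<theta> \<and> set \<theta> \<subseteq> {..n}}"

definition ocomp :: "nat list \<Rightarrow> nat list \<Rightarrow> nat list" where
  "ocomp \<theta> \<phi> = map ((!) \<theta>) \<phi>"

text \<open>
  In \<open>act X n \<theta> x\<close> the simplex \<open>x\<close> has dimension \<open>n\<close>, and the result (the
  restriction of \<open>x\<close> along \<open>\<theta>\<close>) has dimension \<open>length \<theta> - 1\<close>.  The
  dimension is an argument because the sets of simplices need not be disjoint.
\<close>

record 'a sset =
  cells :: "nat \<Rightarrow> 'a set"
  act :: "nat \<Rightarrow> nat list \<Rightarrow> 'a \<Rightarrow> 'a"

definition simplicial_set :: "'a sset \<Rightarrow> bool" where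
  "simplicial_set X \<longleftrightarrow>
     (\<forall>m n. \<forall>\<theta>\<in>ops m n. \<forall>x\<in>cells X n. act X n \<theta> x \<in> cells X m) \<and>
     (\<forall>n. \<forall>x\<in>cells X n. act X n [0..<Suc n] x = x) \<and>
     (\<forall>k m n. \<forall>\<theta>\<in>ops m n. \<forall>\<phi>\<in>ops k m. \<forall>x\<in>cells X n.
        act X m \<phi> (act X n \<theta> x) = act X n (ocomp \<theta> \<phi>) x)"

definition simp_map :: "'a sset \<Rightarrow> 'b sset \<Rightarrow> (nat \<Rightarrow> 'a \<Rightarrow> 'b) \<Rightarrow> bool" where
  "simp_map X Y f \<longleftrightarrow>
     (\<forall>n. \<forall>x\<in>cells X n. f n x \<in> cells Y n) \<and>
     (\<forall>m n. \<forall>\<theta>\<in>ops m n. \<forall>x\<in>cells X n. f m (act X n \<theta> x) = act Y n \<theta> (f n x))"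

definition std_simplex :: "nat \<Rightarrow> nat list sset" where
  "std_simplex k = \<lparr>cells = (\<lambda>n. ops n k), act = (\<lambda>n \<theta> \<omega>. ocomp \<omega> \<theta>)\<rparr>"

definition sset_prod :: "'a sset \<Rightarrow> 'b sset \<Rightarrow> ('a \<times> 'b) sset" where
  "sset_prod X Y =
     \<lparr>cells = (\<lambda>n. cells X n \<times> cells Y n),
      act = (\<lambda>n \<theta> (x, y). (act X n \<theta> x, act Y n \<theta> y))\<rparr>"

definition face :: "'a sset \<Rightarrow> nat \<Rightarrow> nat \<Rightarrow> 'a \<Rightarrow> 'a" where
  "face X n i x = act X n ([0..<i] @ [Suc i..<Suc n]) x"

text \<open>The totally degenerate \<open>n\<close>-simplex on a vertex.\<close>

definition cst :: "'a sset \<Rightarrow> nat \<Rightarrow> 'a \<Rightarrow> 'a" where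
  "cst X n x = act X 0 (replicate (Suc n) 0) x"

text \<open>
  Simplicial maps from the horn (omitting the \<open>k\<close>-th face) and from the boundary of the
  \<open>n\<close>-simplex, as matching families of faces.
\<close>

definition horn :: "'a sset \<Rightarrow> nat \<Rightarrow> nat \<Rightarrow> (nat \<Rightarrow> 'a) \<Rightarrow> bool" where
  "horn X n k h \<longleftrightarrow> 1 \<le> n \<and> k \<le> n \<and>
     (\<forall>i\<le>n. i \<noteq> k \<longrightarrow> h i \<in> cells X (n - 1)) \<and>
     (\<forall>i j. i < j \<and> j \<le> n \<and> i \<noteq> k \<and> j \<noteq> k \<longrightarrow>
        face X (n - 1) i (h j) = face X (n - 1) (j - 1) (h i))"

definition fills_horn :: "'a sset \<Rightarrow> nat \<Rightarrow> nat \<Rightarrow> (nat \<Rightarrow> 'a) \<Rightarrow> 'a \<Rightarrow> bool" where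
  "fills_horn X n k h x \<longleftrightarrow> x \<in> cells X n \<and> (\<forall>i\<le>n. i \<noteq> k \<longrightarrow> face X n i x = h i)"

text \<open>For \<open>n = 0\<close> the boundary is empty; for \<open>n = 1\<close> it is a pair of vertices with no
  compatibility condition.\<close>

definition bdry :: "'a sset \<Rightarrow> nat \<Rightarrow> (nat \<Rightarrow> 'a) \<Rightarrow> bool" where
  "bdry X n b \<longleftrightarrow>
     (1 \<le> n \<longrightarrow> (\<forall>i\<le>n. b i \<in> cells X (n - 1))) \<and>
     (2 \<le> n \<longrightarrow> (\<forall>i j. i < j \<and> j \<le> n \<longrightarrow>
        face X (n - 1) i (b j) = face X (n - 1) (j - 1) (b i)))"

definition fills_bdry :: "'a sset \<Rightarrow> nat \<Rightarrow> (nat \<Rightarrow> 'a) \<Rightarrow> 'a \<Rightarrow> bool" where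
  "fills_bdry X n b x \<longleftrightarrow> x \<in> cells X n \<and> (1 \<le> n \<longrightarrow> (\<forall>i\<le>n. face X n i x = b i))"

definition kan_complex :: "'a sset \<Rightarrow> bool" where
  "kan_complex X \<longleftrightarrow> simplicial_set X \<and> (\<forall>n k h. horn X n k h \<longrightarrow> (\<exists>x. fills_horn X n k h x))"

definition quasi_category :: "'a sset \<Rightarrow> bool" where
  "quasi_category X \<longleftrightarrow> simplicial_set X \<and>
     (\<forall>n k h. 0 < k \<and> k < n \<and> horn X n k h \<longrightarrow> (\<exists>x. fills_horn X n k h x))"

definition contractible :: "'a sset \<Rightarrow> bool" where
  "contractible X \<longleftrightarrow> simplicial_set X \<and> (\<forall>n b. bdry X n b \<longrightarrow> (\<exists>x. fills_bdry X n b x))"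

definition kan_fibration :: "'a sset \<Rightarrow> 'b sset \<Rightarrow> (nat \<Rightarrow> 'a \<Rightarrow> 'b) \<Rightarrow> bool" where
  "kan_fibration X Y f \<longleftrightarrow> simp_map X Y f \<and>
     (\<forall>n k h. \<forall>y\<in>cells Y n.
        horn X n k h \<and> (\<forall>i\<le>n. i \<noteq> k \<longrightarrow> f (n - 1) (h i) = face Y n i y) \<longrightarrow>
        (\<exists>x. fills_horn X n k h x \<and> f n x = y))"

text \<open>The relation written \<open>\<simeq>\<close>: two vertices lie in the same path component.\<close>

definition same_component :: "'a sset \<Rightarrow> 'a \<Rightarrow> 'a \<Rightarrow> bool" where
  "same_component X = equivclp (\<lambda>x y. \<exists>e\<in>cells X 1. act X 1 [0] e = x \<and> act X 1 [1] e = y)"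

text \<open>The standard combinatorial homotopy relation relative to the boundary between
  \<open>n\<close>-simplices with equal boundary in a Kan complex.\<close>

definition homotopic_rel :: "'a sset \<Rightarrow> nat \<Rightarrow> 'a \<Rightarrow> 'a \<Rightarrow> bool" where
  "homotopic_rel X n x y \<longleftrightarrow>
     (\<exists>w\<in>cells X (Suc n). face X (Suc n) n w = x \<and> face X (Suc n) (Suc n) w = y \<and>
        (\<forall>i<n. face X (Suc n) i w = act X (n - 1) ([0..<n] @ [n - 1]) (face X n i x)))"

text \<open>
  Weak homotopy equivalences between Kan complexes: every sphere in \<open>X\<close> which \<open>f\<close> sends to
  the boundary of a simplex \<open>y\<close> is filled by a simplex whose image is homotopic to \<open>y\<close>
  relative to the boundary.  (For Kan complexes this says that \<open>f\<close> is bijective on path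
  components and on all homotopy groups.)
\<close>

definition weak_equivalence :: "'a sset \<Rightarrow> 'b sset \<Rightarrow> (nat \<Rightarrow> 'a \<Rightarrow> 'b) \<Rightarrow> bool" where
  "weak_equivalence X Y f \<longleftrightarrow> kan_complex X \<and> kan_complex Y \<and> simp_map X Y f \<and>
     (\<forall>n b. \<forall>y\<in>cells Y n.
        bdry X n b \<and> (1 \<le> n \<longrightarrow> (\<forall>i\<le>n. f (n - 1) (b i) = face Y n i y)) \<longrightarrow>
        (\<exists>x. fills_bdry X n b x \<and> homotopic_rel Y n (f n x) y))"

text \<open>The simplicial set of maps from the interval to \<open>Y\<close>, and its two evaluations.\<close>

definition path_space :: "'a sset \<Rightarrow> (nat \<Rightarrow> nat list \<times> nat list \<Rightarrow> 'a) sset" where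
  "path_space Y =
     \<lparr>cells = (\<lambda>n. {h. simp_map (sset_prod (std_simplex n) (std_simplex 1)) Y h \<and>
                       (\<forall>m z. z \<notin> ops m n \<times> ops m 1 \<longrightarrow> h m z = undefined)}),
      act = (\<lambda>n \<theta> h m z. if z \<in> ops m (length \<theta> - 1) \<times> ops m 1
                           then h m (ocomp \<theta> (fst z), snd z) else undefined)\<rparr>"

definition path_end :: "nat \<Rightarrow> nat \<Rightarrow> (nat \<Rightarrow> nat list \<times> nat list \<Rightarrow> 'a) \<Rightarrow> 'a" where
  "path_end \<epsilon> n h = h n ([0..<Suc n], replicate (Suc n) \<epsilon>)"

definition homotopy_pullback ::
  "'a sset \<Rightarrow> 'b sset \<Rightarrow> 'c sset \<Rightarrow> (nat \<Rightarrow> 'a \<Rightarrow> 'c) \<Rightarrow> (nat \<Rightarrow> 'b \<Rightarrow> 'c) \<Rightarrow>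
     ('a \<times> (nat \<Rightarrow> nat list \<times> nat list \<Rightarrow> 'c) \<times> 'b) sset" where
  "homotopy_pullback X Y Z f g =
     \<lparr>cells = (\<lambda>n. {(x, h, y). x \<in> cells X n \<and> h \<in> cells (path_space Z) n \<and> y \<in> cells Y n \<and>
                               path_end 0 n h = f n x \<and> path_end 1 n h = g n y}),
      act = (\<lambda>n \<theta> (x, h, y). (act X n \<theta> x, act (path_space Z) n \<theta> h, act Y n \<theta> y))\<rparr>"


section \<open>Final objects, subobjects of the final object, filters\<close>

text \<open>
  Objects and mapping spaces; each of the three models of \<open>(\<infinity>,1)\<close>-categories below provides
  such data.
\<close>

record ('o, 'm) homs =
  obj :: "'o set"
  maps :: "'o \<Rightarrow> 'o \<Rightarrow> 'm sset"

definition final_object :: "('o, 'm, 'z) homs_scheme \<Rightarrow> 'o \<Rightarrow> bool" where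
  "final_object H t \<longleftrightarrow> t \<in> obj H \<and> (\<forall>x\<in>obj H. contractible (maps H x t))"

text \<open>
  \<open>u\<close> is a subobject of the final object, i.e. the essentially unique map from \<open>u\<close> to the
  final object is a monomorphism ((-1)-truncated).
\<close>

definition subfinal :: "('o, 'm, 'z) homs_scheme \<Rightarrow> 'o \<Rightarrow> bool" where
  "subfinal H u \<longleftrightarrow> u \<in> obj H \<and>
     (\<forall>x\<in>obj H. cells (maps H x u) 0 = {} \<or> contractible (maps H x u))"

text \<open>The poset Sub(1): equivalence classes of subobjects of the final object, ordered by
  existence of a map.\<close>

definition Sub1 :: "('o, 'm, 'z) homs_scheme \<Rightarrow> 'o set set" where
  "Sub1 H = {u. subfinal H u} //
     {(u, v). subfinal H u \<and> subfinal H v \<and>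
              cells (maps H u v) 0 \<noteq> {} \<and> cells (maps H v u) 0 \<noteq> {}}"

definition sub_le :: "('o, 'm, 'z) homs_scheme \<Rightarrow> 'o set \<Rightarrow> 'o set \<Rightarrow> bool" where
  "sub_le H p q \<longleftrightarrow> (\<exists>u\<in>p. \<exists>v\<in>q. cells (maps H u v) 0 \<noteq> {})"

definition sub_top :: "('o, 'm, 'z) homs_scheme \<Rightarrow> 'o set" where
  "sub_top H = {t. final_object H t}"

text \<open>\<open>prd a b r\<close> is the relation "\<open>r\<close> is a product of \<open>a\<close> and \<open>b\<close>" of the respective model.\<close>

definition sub_meet :: "('o \<Rightarrow> 'o \<Rightarrow> 'o \<Rightarrow> bool) \<Rightarrow> 'o set \<Rightarrow> 'o set \<Rightarrow> 'o set" where
  "sub_meet prd p q = {r. \<exists>u\<in>p. \<exists>v\<in>q. prd u v r}"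

definition product_closed_filter ::
  "('o, 'm, 'z) homs_scheme \<Rightarrow> ('o \<Rightarrow> 'o \<Rightarrow> 'o \<Rightarrow> bool) \<Rightarrow> 'o set set \<Rightarrow> bool" where
  "product_closed_filter H prd \<Phi> \<longleftrightarrow> \<Phi> \<subseteq> Sub1 H \<and> sub_top H \<in> \<Phi> \<and>
     (\<forall>p\<in>\<Phi>. \<forall>q\<in>\<Phi>. sub_meet prd p q \<in> \<Phi>) \<and>
     (\<forall>p\<in>\<Phi>. \<forall>q\<in>Sub1 H. sub_le H p q \<longrightarrow> q \<in> \<Phi>)"


section \<open>Colimits over the opposite of a preordered set\<close>

text \<open>
  \<open>S\<close> is a diagram of sets on the opposite of \<open>(I, le)\<close>: for \<open>le q p\<close> the transition map goes
  from \<open>S p\<close> to \<open>S q\<close>.  An element of the colimit is a class of pairs (index, element) under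
  the generated equivalence relation.
\<close>

definition colim_class ::
  "'i set \<Rightarrow> ('i \<Rightarrow> 'i \<Rightarrow> bool) \<Rightarrow> ('i \<Rightarrow> 'a set) \<Rightarrow> ('i \<Rightarrow> 'i \<Rightarrow> 'a \<Rightarrow> 'a) \<Rightarrow>
     'i \<Rightarrow> 'a \<Rightarrow> ('i \<times> 'a) set" where
  "colim_class I le S t p x =
     {z. equivclp (\<lambda>(p, x) z. p \<in> I \<and> x \<in> S p \<and> (\<exists>q\<in>I. le q p \<and> z = (q, t p q x))) (p, x) z}"

definition colim_set ::
  "'i set \<Rightarrow> ('i \<Rightarrow> 'i \<Rightarrow> bool) \<Rightarrow> ('i \<Rightarrow> 'a set) \<Rightarrow> ('i \<Rightarrow> 'i \<Rightarrow> 'a \<Rightarrow> 'a) \<Rightarrow>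
     ('i \<times> 'a) set set" where
  "colim_set I le S t = {colim_class I le S t p x | p x. p \<in> I \<and> x \<in> S p}"

definition sset_colim_class ::
  "'i set \<Rightarrow> ('i \<Rightarrow> 'i \<Rightarrow> bool) \<Rightarrow> ('i \<Rightarrow> 'a sset) \<Rightarrow> ('i \<Rightarrow> 'i \<Rightarrow> nat \<Rightarrow> 'a \<Rightarrow> 'a) \<Rightarrow>
     nat \<Rightarrow> 'i \<Rightarrow> 'a \<Rightarrow> ('i \<times> 'a) set" where
  "sset_colim_class I le D t n = colim_class I le (\<lambda>p. cells (D p) n) (\<lambda>p q. t p q n)"

text \<open>In the action, the union is over the (equal) classes obtained from the representatives.\<close>

definition sset_colim ::
  "'i set \<Rightarrow> ('i \<Rightarrow> 'i \<Rightarrow> bool) \<Rightarrow> ('i \<Rightarrow> 'a sset) \<Rightarrow> ('i \<Rightarrow> 'i \<Rightarrow> nat \<Rightarrow> 'a \<Rightarrow> 'a) \<Rightarrow>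
     ('i \<times> 'a) set sset" where
  "sset_colim I le D t =
     \<lparr>cells = (\<lambda>n. colim_set I le (\<lambda>p. cells (D p) n) (\<lambda>p q. t p q n)),
      act = (\<lambda>n \<theta> c. \<Union>(p, x)\<in>c. sset_colim_class I le D t (length \<theta> - 1) p (act (D p) n \<theta> x))\<rparr>"


section \<open>Quasi-categories\<close>

text \<open>The right mapping space: its \<open>n\<close>-simplices are the \<open>(n + 1)\<close>-simplices with last vertex
  \<open>y\<close> whose last face is constant at \<open>x\<close>.\<close>

definition hom_right :: "'a sset \<Rightarrow> 'a \<Rightarrow> 'a \<Rightarrow> 'a sset" where
  "hom_right C x y =
     \<lparr>cells = (\<lambda>n. {\<sigma> \<in> cells C (Suc n). act C (Suc n) [Suc n] \<sigma> = y \<and>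
                                        act C (Suc n) [0..<Suc n] \<sigma> = cst C n x}),
      act = (\<lambda>n \<theta>. act C (Suc n) (\<theta> @ [Suc n]))\<rparr>"

definition qc_homs :: "'a sset \<Rightarrow> ('a, 'a) homs" where
  "qc_homs C = \<lparr>obj = cells C 0, maps = hom_right C\<rparr>"

text \<open>The slice over \<open>v\<close> and its projection to \<open>C\<close>.\<close>

definition over :: "'a sset \<Rightarrow> 'a \<Rightarrow> 'a sset" where
  "over C v =
     \<lparr>cells = (\<lambda>n. {\<sigma> \<in> cells C (Suc n). act C (Suc n) [Suc n] \<sigma> = v}),
      act = (\<lambda>n \<theta>. act C (Suc n) (\<theta> @ [Suc n]))\<rparr>"

definition forget :: "'a sset \<Rightarrow> nat \<Rightarrow> 'a \<Rightarrow> 'a" where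
  "forget C n \<sigma> = act C (Suc n) [0..<Suc n] \<sigma>"

text \<open>Cones over a pair of objects and over a cospan \<open>f\<close>, \<open>g\<close>: simplices of the slice over the
  diagram, i.e. pairs of simplices which agree on the cone point part (and, for a cospan, on the
  common target).\<close>

definition pair_cones :: "'a sset \<Rightarrow> 'a \<Rightarrow> 'a \<Rightarrow> ('a \<times> 'a) sset" where
  "pair_cones C a b =
     \<lparr>cells = (\<lambda>n. {(\<sigma>, \<tau>). \<sigma> \<in> cells C (Suc n) \<and> \<tau> \<in> cells C (Suc n) \<and>
                 act C (Suc n) [Suc n] \<sigma> = a \<and> act C (Suc n) [Suc n] \<tau> = b \<and>
                 act C (Suc n) [0..<Suc n] \<sigma> = act C (Suc n) [0..<Suc n] \<tau>}),
      act = (\<lambda>n \<theta> (\<sigma>, \<tau>). (act C (Suc n) (\<theta> @ [Suc n]) \<sigma>, act C (Suc n) (\<theta> @ [Suc n]) \<tau>))\<rparr>"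

definition cospan_cones :: "'a sset \<Rightarrow> 'a \<Rightarrow> 'a \<Rightarrow> ('a \<times> 'a) sset" where
  "cospan_cones C f g =
     \<lparr>cells = (\<lambda>n. {(\<sigma>, \<tau>). \<sigma> \<in> cells C (n + 2) \<and> \<tau> \<in> cells C (n + 2) \<and>
                 act C (n + 2) [n + 1, n + 2] \<sigma> = f \<and> act C (n + 2) [n + 1, n + 2] \<tau> = g \<and>
                 act C (n + 2) ([0..<Suc n] @ [n + 2]) \<sigma> =
                 act C (n + 2) ([0..<Suc n] @ [n + 2]) \<tau>}),
      act = (\<lambda>n \<theta> (\<sigma>, \<tau>). (act C (n + 2) (\<theta> @ [n + 1, n + 2]) \<sigma>,
                            act C (n + 2) (\<theta> @ [n + 1, n + 2]) \<tau>))\<rparr>"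

definition qc_product_cone :: "'a sset \<Rightarrow> 'a \<Rightarrow> 'a \<Rightarrow> 'a \<Rightarrow> 'a \<Rightarrow> bool" where
  "qc_product_cone C a b \<pi>\<^sub>1 \<pi>\<^sub>2 \<longleftrightarrow> final_object (qc_homs (pair_cones C a b)) (\<pi>\<^sub>1, \<pi>\<^sub>2)"

definition qc_product :: "'a sset \<Rightarrow> 'a \<Rightarrow> 'a \<Rightarrow> 'a \<Rightarrow> bool" where
  "qc_product C a b r \<longleftrightarrow> (\<exists>\<pi>\<^sub>1 \<pi>\<^sub>2. qc_product_cone C a b \<pi>\<^sub>1 \<pi>\<^sub>2 \<and> act C 1 [0] \<pi>\<^sub>1 = r)"

text \<open>Finite limits are encoded by a final object and pullbacks.\<close>

definition qc_finitely_complete :: "'a sset \<Rightarrow> bool" where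
  "qc_finitely_complete C \<longleftrightarrow> (\<exists>t. final_object (qc_homs C) t) \<and>
     (\<forall>f\<in>cells C 1. \<forall>g\<in>cells C 1. act C 1 [1] f = act C 1 [1] g \<longrightarrow>
        (\<exists>z. final_object (qc_homs (cospan_cones C f g)) z))"

text \<open>
  \<open>T\<close> is a functor \<open>- \<times> u\<close> from the slice over \<open>v\<close> to the slice over \<open>u\<close> (for
  \<open>u \<le> v\<close>): there is a natural transformation \<open>\<epsilon>\<close> from \<open>T\<close> to the identity (after
  forgetting to \<open>C\<close>) which at each object \<open>a\<close>, together with the structure map of \<open>T a\<close> to
  \<open>u\<close>, is a product cone.
\<close>

definition qc_times_functor :: "'a sset \<Rightarrow> 'a \<Rightarrow> 'a \<Rightarrow> (nat \<Rightarrow> 'a \<Rightarrow> 'a) \<Rightarrow> bool" where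
  "qc_times_functor C v u T \<longleftrightarrow> simp_map (over C v) (over C u) T \<and>
     (\<exists>\<epsilon>. simp_map (sset_prod (over C v) (std_simplex 1)) C \<epsilon> \<and>
        (\<forall>n. \<forall>x\<in>cells (over C v) n.
           \<epsilon> n (x, replicate (Suc n) 0) = forget C n (T n x) \<and>
           \<epsilon> n (x, replicate (Suc n) 1) = forget C n x) \<and>
        (\<forall>a\<in>cells (over C v) 0.
           qc_product_cone C (forget C 0 a) u (\<epsilon> 1 (cst (over C v) 1 a, [0, 1])) (T 0 a)))"

text \<open>
  The data needed to form the filter quotient: a representing object of each subobject in the
  filter, and functors \<open>- \<times> U\<close> forming a diagram on the opposite of \<open>\<Phi>\<close>.
\<close>

definition qc_filter_diagram ::
  "'a sset \<Rightarrow> 'a set set \<Rightarrow> ('a set \<Rightarrow> 'a) \<Rightarrow> ('a set \<Rightarrow> 'a set \<Rightarrow> nat \<Rightarrow> 'a \<Rightarrow> 'a) \<Rightarrow> bool"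
  where
  "qc_filter_diagram C \<Phi> rep T \<longleftrightarrow>
     (\<forall>p\<in>\<Phi>. rep p \<in> p) \<and>
     (\<forall>p\<in>\<Phi>. \<forall>q\<in>\<Phi>. sub_le (qc_homs C) q p \<longrightarrow> qc_times_functor C (rep p) (rep q) (T p q)) \<and>
     (\<forall>p\<in>\<Phi>. \<forall>n. \<forall>x\<in>cells (over C (rep p)) n. T p p n x = x) \<and>
     (\<forall>p\<in>\<Phi>. \<forall>q\<in>\<Phi>. \<forall>r\<in>\<Phi>. sub_le (qc_homs C) q p \<and> sub_le (qc_homs C) r q \<longrightarrow>
        (\<forall>n. \<forall>x\<in>cells (over C (rep p)) n. T q r n (T p q n x) = T p r n x))"

definition qc_filter_quotient ::
  "'a sset \<Rightarrow> 'a set set \<Rightarrow> ('a set \<Rightarrow> 'a) \<Rightarrow> ('a set \<Rightarrow> 'a set \<Rightarrow> nat \<Rightarrow> 'a \<Rightarrow> 'a) \<Rightarrow>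
     ('a set \<times> 'a) set sset" where
  "qc_filter_quotient C \<Phi> rep T = sset_colim \<Phi> (sub_le (qc_homs C)) (\<lambda>p. over C (rep p)) T"

text \<open>The class in the filter quotient of an \<open>n\<close>-simplex of the slice over \<open>p \<in> \<Phi>\<close>.\<close>

definition qc_class ::
  "'a sset \<Rightarrow> 'a set set \<Rightarrow> ('a set \<Rightarrow> 'a) \<Rightarrow> ('a set \<Rightarrow> 'a set \<Rightarrow> nat \<Rightarrow> 'a \<Rightarrow> 'a) \<Rightarrow>
     nat \<Rightarrow> 'a set \<Rightarrow> 'a \<Rightarrow> ('a set \<times> 'a) set" where
  "qc_class C \<Phi> rep T = sset_colim_class \<Phi> (sub_le (qc_homs C)) (\<lambda>p. over C (rep p)) T"

text \<open>
  The canonical functor to the filter quotient.  Here \<open>C\<close> is identified with its slice over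
  the chosen final object, so objects of \<open>C\<close> come with their essentially unique map to it.
\<close>

definition qc_P ::
  "'a sset \<Rightarrow> 'a set set \<Rightarrow> ('a set \<Rightarrow> 'a) \<Rightarrow> ('a set \<Rightarrow> 'a set \<Rightarrow> nat \<Rightarrow> 'a \<Rightarrow> 'a) \<Rightarrow>
     nat \<Rightarrow> 'a \<Rightarrow> ('a set \<times> 'a) set" where
  "qc_P C \<Phi> rep T n x = qc_class C \<Phi> rep T n (sub_top (qc_homs C)) x"

text \<open>The mapping space from \<open>X\<close> to \<open>Y\<close> in the filter quotient, for objects of \<open>C\<close>.\<close>

definition qc_filter_maps ::
  "'a sset \<Rightarrow> 'a set set \<Rightarrow> ('a set \<Rightarrow> 'a) \<Rightarrow> ('a set \<Rightarrow> 'a set \<Rightarrow> nat \<Rightarrow> 'a \<Rightarrow> 'a) \<Rightarrow>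
     'a \<Rightarrow> 'a \<Rightarrow> ('a set \<times> 'a) set sset" where
  "qc_filter_maps C \<Phi> rep T X Y =
     hom_right (qc_filter_quotient C \<Phi> rep T) (qc_P C \<Phi> rep T 0 X) (qc_P C \<Phi> rep T 0 Y)"

text \<open>The object \<open>X \<times> p\<close> in the slice over \<open>p \<in> \<Phi>\<close>.\<close>

definition qc_times ::
  "'a sset \<Rightarrow> ('a set \<Rightarrow> 'a set \<Rightarrow> nat \<Rightarrow> 'a \<Rightarrow> 'a) \<Rightarrow> 'a \<Rightarrow> 'a set \<Rightarrow> 'a" where
  "qc_times C T x p = T (sub_top (qc_homs C)) p 0 x"

text \<open>For a morphism \<open>F\<close> in the slice over \<open>p\<close>, the morphism \<open>F \<times> id\<^sub>q\<close> of \<open>C\<close>.\<close>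

definition qc_times_id ::
  "'a sset \<Rightarrow> ('a set \<Rightarrow> 'a set \<Rightarrow> nat \<Rightarrow> 'a \<Rightarrow> 'a) \<Rightarrow> 'a set \<Rightarrow> 'a set \<Rightarrow> 'a \<Rightarrow> 'a" where
  "qc_times_id C T p q F = forget C 1 (T p (sub_meet (qc_product C) p q) 1 F)"


section \<open>Kan enriched categories\<close>

text \<open>\<open>kcomp K X Y Z n g f\<close> is the composite of \<open>n\<close>-simplices \<open>f\<close> of \<open>maps K X Y\<close> and
  \<open>g\<close> of \<open>maps K Y Z\<close>.\<close>

record ('o, 'm) enriched = "('o, 'm) homs" +
  kcomp :: "'o \<Rightarrow> 'o \<Rightarrow> 'o \<Rightarrow> nat \<Rightarrow> 'm \<Rightarrow> 'm \<Rightarrow> 'm"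
  kid :: "'o \<Rightarrow> 'm"

definition kan_enriched_category :: "('o, 'm) enriched \<Rightarrow> bool" where
  "kan_enriched_category K \<longleftrightarrow>
     (\<forall>X\<in>obj K. \<forall>Y\<in>obj K. kan_complex (maps K X Y)) \<and>
     (\<forall>X\<in>obj K. \<forall>Y\<in>obj K. \<forall>Z\<in>obj K.
        simp_map (sset_prod (maps K Y Z) (maps K X Y)) (maps K X Z)
          (\<lambda>n (g, f). kcomp K X Y Z n g f)) \<and>
     (\<forall>X\<in>obj K. kid K X \<in> cells (maps K X X) 0) \<and>
     (\<forall>X\<in>obj K. \<forall>Y\<in>obj K. \<forall>n. \<forall>f\<in>cells (maps K X Y) n.
        kcomp K X Y Y n (cst (maps K Y Y) n (kid K Y)) f = f \<and>
        kcomp K X X Y n f (cst (maps K X X) n (kid K X)) = f) \<and>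
     (\<forall>A\<in>obj K. \<forall>X\<in>obj K. \<forall>Y\<in>obj K. \<forall>Z\<in>obj K. \<forall>n.
        \<forall>f\<in>cells (maps K A X) n. \<forall>g\<in>cells (maps K X Y) n. \<forall>h\<in>cells (maps K Y Z) n.
          kcomp K A Y Z n h (kcomp K A X Y n g f) = kcomp K A X Z n (kcomp K X Y Z n h g) f)"

text \<open>Composition with a vertex (a morphism) on the left and on the right, in all dimensions.\<close>

definition postc :: "('o, 'm) enriched \<Rightarrow> 'o \<Rightarrow> 'o \<Rightarrow> 'o \<Rightarrow> 'm \<Rightarrow> nat \<Rightarrow> 'm \<Rightarrow> 'm" where
  "postc K X Y Z g n f = kcomp K X Y Z n (cst (maps K Y Z) n g) f"

definition prec :: "('o, 'm) enriched \<Rightarrow> 'o \<Rightarrow> 'o \<Rightarrow> 'o \<Rightarrow> 'm \<Rightarrow> nat \<Rightarrow> 'm \<Rightarrow> 'm" where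
  "prec K X Y Z f n g = kcomp K X Y Z n g (cst (maps K X Y) n f)"

text \<open>Finite limits in a Kan enriched category are homotopy limits: the mapping spaces into
  them are homotopy limits of Kan complexes.\<close>

definition kan_product :: "('o, 'm) enriched \<Rightarrow> 'o \<Rightarrow> 'o \<Rightarrow> 'o \<Rightarrow> bool" where
  "kan_product K a b r \<longleftrightarrow> a \<in> obj K \<and> b \<in> obj K \<and> r \<in> obj K \<and>
     (\<exists>\<pi>\<^sub>1\<in>cells (maps K r a) 0. \<exists>\<pi>\<^sub>2\<in>cells (maps K r b) 0. \<forall>Z\<in>obj K.
        weak_equivalence (maps K Z r) (sset_prod (maps K Z a) (maps K Z b))
          (\<lambda>n h. (postc K Z r a \<pi>\<^sub>1 n h, postc K Z r b \<pi>\<^sub>2 n h)))"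

text \<open>
  A homotopy commutative square with corner \<open>P\<close>, projections \<open>\<pi>\<^sub>1\<close>, \<open>\<pi>\<^sub>2\<close> and homotopy
  \<open>\<eta>\<close> from \<open>f \<circ> \<pi>\<^sub>1\<close> to \<open>g \<circ> \<pi>\<^sub>2\<close> is a pullback if the induced maps into the homotopy
  pullbacks of mapping spaces are weak equivalences.
\<close>

definition kan_pullback ::
  "('o, 'm) enriched \<Rightarrow> 'o \<Rightarrow> 'o \<Rightarrow> 'o \<Rightarrow> 'm \<Rightarrow> 'm \<Rightarrow> 'o \<Rightarrow> bool" where
  "kan_pullback K A B D f g P \<longleftrightarrow> P \<in> obj K \<and>
     (\<exists>\<pi>\<^sub>1\<in>cells (maps K P A) 0. \<exists>\<pi>\<^sub>2\<in>cells (maps K P B) 0.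
        \<exists>\<eta>\<in>cells (path_space (maps K P D)) 0.
          path_end 0 0 \<eta> = kcomp K P A D 0 f \<pi>\<^sub>1 \<and> path_end 1 0 \<eta> = kcomp K P B D 0 g \<pi>\<^sub>2 \<and>
          (\<forall>Z\<in>obj K.
             weak_equivalence (maps K Z P)
               (homotopy_pullback (maps K Z A) (maps K Z B) (maps K Z D)
                  (postc K Z A D f) (postc K Z B D g))
               (\<lambda>n k. (postc K Z P A \<pi>\<^sub>1 n k,
                       (\<lambda>m z. if z \<in> ops m n \<times> ops m 1
                               then kcomp K Z P D m (\<eta> m (replicate (Suc m) 0, snd z))
                                      (act (maps K Z P) n (fst z) k)
                               else undefined),
                       postc K Z P B \<pi>\<^sub>2 n k))))"

definition kan_finitely_complete :: "('o, 'm) enriched \<Rightarrow> bool" where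
  "kan_finitely_complete K \<longleftrightarrow> (\<exists>t. final_object K t) \<and>
     (\<forall>A\<in>obj K. \<forall>B\<in>obj K. \<forall>D\<in>obj K.
        \<forall>f\<in>cells (maps K A D) 0. \<forall>g\<in>cells (maps K B D) 0. \<exists>P. kan_pullback K A B D f g P)"

text \<open>
  The data needed to form the filter quotient: representing objects of the subobjects in the
  filter, inclusions between them, and products \<open>X \<times> p\<close> with their projections.
\<close>

record ('o, 'm) filter_products =
  repr :: "'o set \<Rightarrow> 'o"
  incl :: "'o set \<Rightarrow> 'o set \<Rightarrow> 'm"
  ftimes :: "'o \<Rightarrow> 'o set \<Rightarrow> 'o"
  proj1 :: "'o \<Rightarrow> 'o set \<Rightarrow> 'm"
  proj2 :: "'o \<Rightarrow> 'o set \<Rightarrow> 'm"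

text \<open>
  The composition law \<open>[g] \<circ> [f] = [g (f \<times> id)]\<close> requires the products with elements of the
  filter to be enriched products, i.e. the comparison maps of mapping spaces are isomorphisms
  of simplicial sets.
\<close>

definition kan_filter_products ::
  "('o, 'm) enriched \<Rightarrow> 'o set set \<Rightarrow> ('o, 'm) filter_products \<Rightarrow> bool" where
  "kan_filter_products K \<Phi> R \<longleftrightarrow>
     (\<forall>p\<in>\<Phi>. repr R p \<in> p) \<and>
     (\<forall>p\<in>\<Phi>. \<forall>q\<in>\<Phi>. sub_le K q p \<longrightarrow> incl R q p \<in> cells (maps K (repr R q) (repr R p)) 0) \<and>
     (\<forall>p\<in>\<Phi>. incl R p p = kid K (repr R p)) \<and>
     (\<forall>p\<in>\<Phi>. \<forall>q\<in>\<Phi>. \<forall>r\<in>\<Phi>. sub_le K q p \<and> sub_le K r q \<longrightarrow>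
        kcomp K (repr R r) (repr R q) (repr R p) 0 (incl R q p) (incl R r q) = incl R r p) \<and>
     (\<forall>X\<in>obj K. \<forall>p\<in>\<Phi>. ftimes R X p \<in> obj K \<and>
        proj1 R X p \<in> cells (maps K (ftimes R X p) X) 0 \<and>
        proj2 R X p \<in> cells (maps K (ftimes R X p) (repr R p)) 0 \<and>
        (\<forall>Z\<in>obj K. \<forall>n.
           bij_betw (\<lambda>h. (postc K Z (ftimes R X p) X (proj1 R X p) n h,
                          postc K Z (ftimes R X p) (repr R p) (proj2 R X p) n h))
             (cells (maps K Z (ftimes R X p)) n)
             (cells (maps K Z X) n \<times> cells (maps K Z (repr R p)) n)))"

text \<open>The map from \<open>Z\<close> to \<open>X \<times> p\<close> with components \<open>a\<close> and \<open>b\<close>.\<close>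

definition pairing ::
  "('o, 'm) enriched \<Rightarrow> ('o, 'm) filter_products \<Rightarrow> 'o \<Rightarrow> 'o \<Rightarrow> 'o set \<Rightarrow> nat \<Rightarrow> 'm \<Rightarrow> 'm \<Rightarrow> 'm"
  where
  "pairing K R Z X p n a b =
     (THE h. h \<in> cells (maps K Z (ftimes R X p)) n \<and>
             postc K Z (ftimes R X p) X (proj1 R X p) n h = a \<and>
             postc K Z (ftimes R X p) (repr R p) (proj2 R X p) n h = b)"

text \<open>The map from \<open>X \<times> q\<close> to \<open>X \<times> p\<close> for \<open>q \<le> p\<close>.\<close>

definition times_incl ::
  "('o, 'm) enriched \<Rightarrow> ('o, 'm) filter_products \<Rightarrow> 'o \<Rightarrow> 'o set \<Rightarrow> 'o set \<Rightarrow> 'm" where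
  "times_incl K R X q p =
     pairing K R (ftimes R X q) X p 0 (proj1 R X q)
       (kcomp K (ftimes R X q) (repr R q) (repr R p) 0 (incl R q p) (proj2 R X q))"

text \<open>For \<open>f\<close> from \<open>X\<close> to \<open>Y\<close>, the map \<open>f \<times> id\<^sub>p\<close> from \<open>X \<times> p\<close> to \<open>Y \<times> p\<close>.\<close>

definition kan_times_id ::
  "('o, 'm) enriched \<Rightarrow> ('o, 'm) filter_products \<Rightarrow> 'o \<Rightarrow> 'o \<Rightarrow> 'o set \<Rightarrow> 'm \<Rightarrow> 'm" where
  "kan_times_id K R X Y p f =
     pairing K R (ftimes R X p) Y p 0
       (kcomp K (ftimes R X p) X Y 0 f (proj1 R X p)) (proj2 R X p)"

text \<open>The class in the filter quotient of an \<open>n\<close>-simplex \<open>f\<close> of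
  \<open>maps K (ftimes R X p) Y\<close>.\<close>

definition kan_class ::
  "('o, 'm) enriched \<Rightarrow> 'o set set \<Rightarrow> ('o, 'm) filter_products \<Rightarrow> 'o \<Rightarrow> 'o \<Rightarrow>
     nat \<Rightarrow> 'o set \<Rightarrow> 'm \<Rightarrow> ('o set \<times> 'm) set" where
  "kan_class K \<Phi> R X Y =
     sset_colim_class \<Phi> (sub_le K) (\<lambda>p. maps K (ftimes R X p) Y)
       (\<lambda>p q. prec K (ftimes R X q) (ftimes R X p) Y (times_incl K R X q p))"

text \<open>
  Composition: \<open>[g] \<circ> [f] = [g (f \<times> id)]\<close>, where \<open>f \<times> id\<close> is to be read as the map from
  \<open>X \<times> p\<close> to \<open>Y \<times> p\<close> with components \<open>f\<close> and the projection.
\<close>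

definition kan_filter_quotient ::
  "('o, 'm) enriched \<Rightarrow> 'o set set \<Rightarrow> ('o, 'm) filter_products \<Rightarrow>
     ('o, ('o set \<times> 'm) set) enriched" where
  "kan_filter_quotient K \<Phi> R =
     \<lparr>obj = obj K,
      maps = (\<lambda>X Y. sset_colim \<Phi> (sub_le K) (\<lambda>p. maps K (ftimes R X p) Y)
                (\<lambda>p q. prec K (ftimes R X q) (ftimes R X p) Y (times_incl K R X q p))),
      kcomp = (\<lambda>X Y Z n c d. \<Union> {kan_class K \<Phi> R X Z n p
                  (kcomp K (ftimes R X p) (ftimes R Y p) Z n g
                     (pairing K R (ftimes R X p) Y p n f
                        (cst (maps K (ftimes R X p) (repr R p)) n (proj2 R X p))))
                | p f g. (p, g) \<in> c \<and> (p, f) \<in> d}),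
      kid = (\<lambda>X. kan_class K \<Phi> R X X 0 (sub_top K) (proj1 R X (sub_top K)))\<rparr>"

text \<open>
  The morphism of the filter quotient represented by a morphism \<open>f\<close> from \<open>X \<times> p\<close> to
  \<open>Y \<times> p\<close> in \<open>K\<close>.
\<close>

definition kan_mor ::
  "('o, 'm) enriched \<Rightarrow> 'o set set \<Rightarrow> ('o, 'm) filter_products \<Rightarrow> 'o \<Rightarrow> 'o \<Rightarrow>
     'o set \<Rightarrow> 'm \<Rightarrow> ('o set \<times> 'm) set" where
  "kan_mor K \<Phi> R X Y p f =
     kan_class K \<Phi> R X Y 0 p (kcomp K (ftimes R X p) (ftimes R Y p) Y 0 (proj1 R Y p) f)"


section \<open>Complete Segal spaces\<close>

text \<open>
  A bisimplicial set \<open>W\<close> is a simplicial object \<open>n \<mapsto> col W n\<close> in simplicial sets (spaces);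
  \<open>hact\<close> acts in the first (categorical) and \<open>vact\<close> in the second (spatial) direction.
\<close>

record 'a bisset =
  bcells :: "nat \<Rightarrow> nat \<Rightarrow> 'a set"
  hact :: "nat \<Rightarrow> nat \<Rightarrow> nat list \<Rightarrow> 'a \<Rightarrow> 'a"
  vact :: "nat \<Rightarrow> nat \<Rightarrow> nat list \<Rightarrow> 'a \<Rightarrow> 'a"

definition col :: "'a bisset \<Rightarrow> nat \<Rightarrow> 'a sset" where
  "col W n = \<lparr>cells = bcells W n, act = vact W n\<rparr>"

definition row :: "'a bisset \<Rightarrow> nat \<Rightarrow> 'a sset" where
  "row W l = \<lparr>cells = (\<lambda>n. bcells W n l), act = (\<lambda>n. hact W n l)\<rparr>"

definition bisimplicial_set :: "'a bisset \<Rightarrow> bool" where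
  "bisimplicial_set W \<longleftrightarrow>
     (\<forall>n. simplicial_set (col W n)) \<and> (\<forall>l. simplicial_set (row W l)) \<and>
     (\<forall>m n k l. \<forall>\<theta>\<in>ops m n. \<forall>\<phi>\<in>ops k l. \<forall>w\<in>bcells W n l.
        vact W m l \<phi> (hact W n l \<theta> w) = hact W n k \<theta> (vact W n l \<phi> w))"

definition bisimp_map :: "'a bisset \<Rightarrow> 'b bisset \<Rightarrow> (nat \<Rightarrow> nat \<Rightarrow> 'a \<Rightarrow> 'b) \<Rightarrow> bool" where
  "bisimp_map V W f \<longleftrightarrow>
     (\<forall>n. simp_map (col V n) (col W n) (f n)) \<and>
     (\<forall>l. simp_map (row V l) (row W l) (\<lambda>n. f n l))"

text \<open>The \<open>n\<close>-th matching space, for \<open>n \<ge> 1\<close>.\<close>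

definition matching :: "'a bisset \<Rightarrow> nat \<Rightarrow> (nat \<Rightarrow> 'a) sset" where
  "matching W n =
     \<lparr>cells = (\<lambda>l. {b \<in> {..n} \<rightarrow>\<^sub>E bcells W (n - 1) l. bdry (row W l) n b}),
      act = (\<lambda>l \<phi> b. \<lambda>i\<in>{..n}. vact W (n - 1) l \<phi> (b i))\<rparr>"

definition reedy_fibrant :: "'a bisset \<Rightarrow> bool" where
  "reedy_fibrant W \<longleftrightarrow> kan_complex (col W 0) \<and>
     (\<forall>n\<ge>1. kan_fibration (col W n) (matching W n) (\<lambda>l w. \<lambda>i\<in>{..n}. face (row W l) n i w))"

text \<open>The iterated fibre product of \<open>n\<close> copies of the first space over the zeroth one.\<close>

definition spine :: "'a bisset \<Rightarrow> nat \<Rightarrow> (nat \<Rightarrow> 'a) sset" where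
  "spine W n =
     \<lparr>cells = (\<lambda>l. {e \<in> {..<n} \<rightarrow>\<^sub>E bcells W 1 l.
                     \<forall>i. Suc i < n \<longrightarrow> hact W 1 l [1] (e i) = hact W 1 l [0] (e (Suc i))}),
      act = (\<lambda>l \<phi> e. \<lambda>i\<in>{..<n}. vact W 1 l \<phi> (e i))\<rparr>"

definition segal_space :: "'a bisset \<Rightarrow> bool" where
  "segal_space W \<longleftrightarrow> bisimplicial_set W \<and> reedy_fibrant W \<and>
     (\<forall>n\<ge>2. weak_equivalence (col W n) (spine W n)
              (\<lambda>l w. \<lambda>i\<in>{..<n}. hact W n l [i, Suc i] w))"

definition map_space :: "'a bisset \<Rightarrow> 'a \<Rightarrow> 'a \<Rightarrow> 'a sset" where
  "map_space W x y =
     \<lparr>cells = (\<lambda>l. {w \<in> bcells W 1 l. hact W 1 l [0] w = cst (col W 0) l x \<and>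
                                      hact W 1 l [1] w = cst (col W 0) l y}),
      act = vact W 1\<rparr>"

definition css_homs :: "'a bisset \<Rightarrow> ('a, 'a) homs" where
  "css_homs W = \<lparr>obj = bcells W 0 0, maps = map_space W\<rparr>"

text \<open>A vertex of the first space with a left and a right homotopy inverse.\<close>

definition hoequiv :: "'a bisset \<Rightarrow> 'a \<Rightarrow> bool" where
  "hoequiv W f \<longleftrightarrow> f \<in> bcells W 1 0 \<and>
     (let x = hact W 1 0 [0] f; y = hact W 1 0 [1] f in
        (\<exists>\<sigma>\<in>bcells W 2 0. hact W 2 0 [0, 1] \<sigma> = f \<and> hact W 2 0 [1, 2] \<sigma> \<in> cells (map_space W y x) 0 \<and>
           same_component (map_space W x x) (hact W 2 0 [0, 2] \<sigma>) (hact W 0 0 [0, 0] x)) \<and>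
        (\<exists>\<tau>\<in>bcells W 2 0. hact W 2 0 [1, 2] \<tau> = f \<and> hact W 2 0 [0, 1] \<tau> \<in> cells (map_space W y x) 0 \<and>
           same_component (map_space W y y) (hact W 2 0 [0, 2] \<tau>) (hact W 0 0 [0, 0] y)))"

definition hoequiv_space :: "'a bisset \<Rightarrow> 'a sset" where
  "hoequiv_space W =
     \<lparr>cells = (\<lambda>l. {w \<in> bcells W 1 l. \<forall>i\<le>l. hoequiv W (vact W 1 l [i] w)}), act = vact W 1\<rparr>"

definition complete_segal_space :: "'a bisset \<Rightarrow> bool" where
  "complete_segal_space W \<longleftrightarrow> segal_space W \<and>
     weak_equivalence (col W 0) (hoequiv_space W) (\<lambda>l. hact W 0 l [0, 0])"

text \<open>Slices and cones are formed as for quasi-categories, in each spatial degree; objects and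
  morphisms over which they are formed are made constant in the spatial direction.\<close>

definition css_over :: "'a bisset \<Rightarrow> 'a \<Rightarrow> 'a bisset" where
  "css_over W v =
     \<lparr>bcells = (\<lambda>n l. {w \<in> bcells W (Suc n) l. hact W (Suc n) l [Suc n] w = cst (col W 0) l v}),
      hact = (\<lambda>n l \<theta>. hact W (Suc n) l (\<theta> @ [Suc n])),
      vact = (\<lambda>n. vact W (Suc n))\<rparr>"

definition css_forget :: "'a bisset \<Rightarrow> nat \<Rightarrow> nat \<Rightarrow> 'a \<Rightarrow> 'a" where
  "css_forget W n l w = hact W (Suc n) l [0..<Suc n] w"

definition css_pair_cones :: "'a bisset \<Rightarrow> 'a \<Rightarrow> 'a \<Rightarrow> ('a \<times> 'a) bisset" where
  "css_pair_cones W a b =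
     \<lparr>bcells = (\<lambda>n l. cells (pair_cones (row W l) (cst (col W 0) l a) (cst (col W 0) l b)) n),
      hact = (\<lambda>n l. act (pair_cones (row W l) (cst (col W 0) l a) (cst (col W 0) l b)) n),
      vact = (\<lambda>n l \<phi> (\<sigma>, \<tau>). (vact W (Suc n) l \<phi> \<sigma>, vact W (Suc n) l \<phi> \<tau>))\<rparr>"

definition css_cospan_cones :: "'a bisset \<Rightarrow> 'a \<Rightarrow> 'a \<Rightarrow> ('a \<times> 'a) bisset" where
  "css_cospan_cones W f g =
     \<lparr>bcells = (\<lambda>n l. cells (cospan_cones (row W l) (cst (col W 1) l f) (cst (col W 1) l g)) n),
      hact = (\<lambda>n l. act (cospan_cones (row W l) (cst (col W 1) l f) (cst (col W 1) l g)) n),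
      vact = (\<lambda>n l \<phi> (\<sigma>, \<tau>). (vact W (n + 2) l \<phi> \<sigma>, vact W (n + 2) l \<phi> \<tau>))\<rparr>"

definition css_product_cone :: "'a bisset \<Rightarrow> 'a \<Rightarrow> 'a \<Rightarrow> 'a \<Rightarrow> 'a \<Rightarrow> bool" where
  "css_product_cone W a b \<pi>\<^sub>1 \<pi>\<^sub>2 \<longleftrightarrow> final_object (css_homs (css_pair_cones W a b)) (\<pi>\<^sub>1, \<pi>\<^sub>2)"

definition css_product :: "'a bisset \<Rightarrow> 'a \<Rightarrow> 'a \<Rightarrow> 'a \<Rightarrow> bool" where
  "css_product W a b r \<longleftrightarrow> (\<exists>\<pi>\<^sub>1 \<pi>\<^sub>2. css_product_cone W a b \<pi>\<^sub>1 \<pi>\<^sub>2 \<and> hact W 1 0 [0] \<pi>\<^sub>1 = r)"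

definition css_finitely_complete :: "'a bisset \<Rightarrow> bool" where
  "css_finitely_complete W \<longleftrightarrow> (\<exists>t. final_object (css_homs W) t) \<and>
     (\<forall>f\<in>bcells W 1 0. \<forall>g\<in>bcells W 1 0. hact W 1 0 [1] f = hact W 1 0 [1] g \<longrightarrow>
        (\<exists>z. final_object (css_homs (css_cospan_cones W f g)) z))"

text \<open>The product with the bisimplicial set represented by the category with two objects and one
  non-identity morphism (which is constant in the spatial direction).\<close>

definition css_cylinder :: "'a bisset \<Rightarrow> ('a \<times> nat list) bisset" where
  "css_cylinder W =
     \<lparr>bcells = (\<lambda>n l. bcells W n l \<times> ops n 1),
      hact = (\<lambda>n l \<theta> (w, \<omega>). (hact W n l \<theta> w, ocomp \<omega> \<theta>)),
      vact = (\<lambda>n l \<phi> (w, \<omega>). (vact W n l \<phi> w, \<omega>))\<rparr>"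

definition css_times_functor ::
  "'a bisset \<Rightarrow> 'a \<Rightarrow> 'a \<Rightarrow> (nat \<Rightarrow> nat \<Rightarrow> 'a \<Rightarrow> 'a) \<Rightarrow> bool" where
  "css_times_functor W v u T \<longleftrightarrow> bisimp_map (css_over W v) (css_over W u) T \<and>
     (\<exists>\<epsilon>. bisimp_map (css_cylinder (css_over W v)) W \<epsilon> \<and>
        (\<forall>n l. \<forall>x\<in>bcells (css_over W v) n l.
           \<epsilon> n l (x, replicate (Suc n) 0) = css_forget W n l (T n l x) \<and>
           \<epsilon> n l (x, replicate (Suc n) 1) = css_forget W n l x) \<and>
        (\<forall>a\<in>bcells (css_over W v) 0 0.
           css_product_cone W (css_forget W 0 0 a) u
             (\<epsilon> 1 0 (hact (css_over W v) 0 0 [0, 0] a, [0, 1])) (T 0 0 a)))"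

definition css_filter_diagram ::
  "'a bisset \<Rightarrow> 'a set set \<Rightarrow> ('a set \<Rightarrow> 'a) \<Rightarrow>
     ('a set \<Rightarrow> 'a set \<Rightarrow> nat \<Rightarrow> nat \<Rightarrow> 'a \<Rightarrow> 'a) \<Rightarrow> bool" where
  "css_filter_diagram W \<Phi> rep T \<longleftrightarrow>
     (\<forall>p\<in>\<Phi>. rep p \<in> p) \<and>
     (\<forall>p\<in>\<Phi>. \<forall>q\<in>\<Phi>. sub_le (css_homs W) q p \<longrightarrow> css_times_functor W (rep p) (rep q) (T p q)) \<and>
     (\<forall>p\<in>\<Phi>. \<forall>n l. \<forall>x\<in>bcells (css_over W (rep p)) n l. T p p n l x = x) \<and>
     (\<forall>p\<in>\<Phi>. \<forall>q\<in>\<Phi>. \<forall>r\<in>\<Phi>. sub_le (css_homs W) q p \<and> sub_le (css_homs W) r q \<longrightarrow>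
        (\<forall>n l. \<forall>x\<in>bcells (css_over W (rep p)) n l. T q r n l (T p q n l x) = T p r n l x))"

definition css_class ::
  "'a bisset \<Rightarrow> 'a set set \<Rightarrow> ('a set \<Rightarrow> 'a) \<Rightarrow>
     ('a set \<Rightarrow> 'a set \<Rightarrow> nat \<Rightarrow> nat \<Rightarrow> 'a \<Rightarrow> 'a) \<Rightarrow>
     nat \<Rightarrow> nat \<Rightarrow> 'a set \<Rightarrow> 'a \<Rightarrow> ('a set \<times> 'a) set" where
  "css_class W \<Phi> rep T n l =
     colim_class \<Phi> (sub_le (css_homs W)) (\<lambda>p. bcells (css_over W (rep p)) n l) (\<lambda>p q. T p q n l)"

definition css_filter_quotient ::
  "'a bisset \<Rightarrow> 'a set set \<Rightarrow> ('a set \<Rightarrow> 'a) \<Rightarrow>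
     ('a set \<Rightarrow> 'a set \<Rightarrow> nat \<Rightarrow> nat \<Rightarrow> 'a \<Rightarrow> 'a) \<Rightarrow> ('a set \<times> 'a) set bisset" where
  "css_filter_quotient W \<Phi> rep T =
     \<lparr>bcells = (\<lambda>n l. colim_set \<Phi> (sub_le (css_homs W))
                  (\<lambda>p. bcells (css_over W (rep p)) n l) (\<lambda>p q. T p q n l)),
      hact = (\<lambda>n l \<theta> c. \<Union>(p, x)\<in>c.
                css_class W \<Phi> rep T (length \<theta> - 1) l p (hact (css_over W (rep p)) n l \<theta> x)),
      vact = (\<lambda>n l \<phi> c. \<Union>(p, x)\<in>c.
                css_class W \<Phi> rep T n (length \<phi> - 1) p (vact (css_over W (rep p)) n l \<phi> x))\<rparr>"

definition css_P ::
  "'a bisset \<Rightarrow> 'a set set \<Rightarrow> ('a set \<Rightarrow> 'a) \<Rightarrow>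
     ('a set \<Rightarrow> 'a set \<Rightarrow> nat \<Rightarrow> nat \<Rightarrow> 'a \<Rightarrow> 'a) \<Rightarrow> nat \<Rightarrow> nat \<Rightarrow> 'a \<Rightarrow> ('a set \<times> 'a) set"
  where
  "css_P W \<Phi> rep T n l x = css_class W \<Phi> rep T n l (sub_top (css_homs W)) x"

definition css_filter_maps ::
  "'a bisset \<Rightarrow> 'a set set \<Rightarrow> ('a set \<Rightarrow> 'a) \<Rightarrow>
     ('a set \<Rightarrow> 'a set \<Rightarrow> nat \<Rightarrow> nat \<Rightarrow> 'a \<Rightarrow> 'a) \<Rightarrow> 'a \<Rightarrow> 'a \<Rightarrow> ('a set \<times> 'a) set sset"
  where
  "css_filter_maps W \<Phi> rep T X Y =
     map_space (css_filter_quotient W \<Phi> rep T) (css_P W \<Phi> rep T 0 0 X) (css_P W \<Phi> rep T 0 0 Y)"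

definition css_times ::
  "'a bisset \<Rightarrow> ('a set \<Rightarrow> 'a set \<Rightarrow> nat \<Rightarrow> nat \<Rightarrow> 'a \<Rightarrow> 'a) \<Rightarrow> 'a \<Rightarrow> 'a set \<Rightarrow> 'a" where
  "css_times W T x p = T (sub_top (css_homs W)) p 0 0 x"

definition css_times_id ::
  "'a bisset \<Rightarrow> ('a set \<Rightarrow> 'a set \<Rightarrow> nat \<Rightarrow> nat \<Rightarrow> 'a \<Rightarrow> 'a) \<Rightarrow> 'a set \<Rightarrow> 'a set \<Rightarrow> 'a \<Rightarrow> 'a"
  where
  "css_times_id W T p q F = css_forget W 1 0 (T p (sub_meet (css_product W) p q) 1 0 F)"

end

theory Submission
  imports Defs
begin

text \<open>
  Path components commute with filtered colimits, so two morphisms of the filter quotient are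
  homotopic iff their representatives become homotopic at some stage \<open>r \<in> \<Phi>\<close>, as morphisms over
  \<open>r\<close> (or, for Kan enriched categories, as morphisms \<open>X \<times> r \<rightarrow> Y\<close>).  It remains to compare these
  homotopies with homotopies in the category itself.  Because \<open>r\<close> is a subobject of the final
  object, the spaces of maps to \<open>r\<close> are empty or contractible, and therefore homotopies lift
  through the forgetful functor from the slice over \<open>r\<close>.
\<close>

text \<open>The obstacle is strictness. A morphism over \<open>r\<close> is a triangle whose edges
  into \<open>r\<close> are prescribed structure maps, and a homotopy over \<open>r\<close> keeps
  these maps constant on the nose, whereas contractibility of the spaces of maps to \<open>r\<close>
  controls them only up to homotopy. A homotopy of underlying maps therefore lifts at first with one
  wrong face (quasi-categories) or with a wrong endpoint (Segal spaces), and the defect is a loop in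
  a space of maps to \<open>r\<close>, which must be contracted and then traded for the correct face
  or endpoint. Inner horns achieve this for quasi-categories; the Segal equivalence and Reedy
  fibrancy achieve it for Segal spaces. For Kan enriched categories the products are strict, and the
  difficulty moves elsewhere: the colimit speaks of maps out of \<open>X \<times> r\<close>, the
  claim of maps out of \<open>(X \<times> V) \<times> U\<close>, and the canonical comparison maps
  between these objects are compatible with the projections to \<open>X \<times> V\<close> only up
  to homotopy. Path components are a generated equivalence relation, so all arguments treat one edge
  of a zigzag at a time and involve only low-dimensional simplices.\<close>

section \<open>Zigzags and their transport along maps\<close>

lemma equivclp_map:
  assumes "equivclp R x y" and "\<And>x y. R x y \<Longrightarrow> equivclp S (f x) (f y)"
  shows "equivclp S (f x) (f y)"
  using assms(1)
proof (induction rule: equivclp_induct)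
  case base
  show ?case by simp
next
  case (step y z)
  then show ?case using assms(2) by (meson equivclp_sym equivclp_trans)
qed

text \<open>Induction along the zigzag, lifting each intermediate vertex by \<open>surj\<close>. The
  lift chosen there is arbitrary, so the induction runs over all lifts of the current vertex.
  Reflexive edges of \<open>R\<close> allow \<open>lift\<close> to be applied to two lifts of one
  vertex, which makes the fibres of \<open>\<phi>\<close> connected. Asking \<open>lift\<close> only
  for a zigzag, not for an edge, leaves room for lifts that need a correction at their end.\<close>

lemma equivclp_lift:
  assumes "equivclp R (\<phi> F) (\<phi> G)" and "F \<in> L" "G \<in> L"
    and dom: "\<And>x y. R x y \<Longrightarrow> x \<in> S \<and> y \<in> S"
    and refl: "\<And>x. x \<in> L \<Longrightarrow> R (\<phi> x) (\<phi> x)"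
    and surj: "\<And>x. x \<in> S \<Longrightarrow> \<exists>y\<in>L. \<phi> y = x"
    and lift: "\<And>x y. \<lbrakk>x \<in> L; y \<in> L; R (\<phi> x) (\<phi> y)\<rbrakk> \<Longrightarrow> equivclp Q x y"
  shows "equivclp Q F G"
proof -
  have "equivclp R (\<phi> F) z \<Longrightarrow> \<forall>G\<in>L. \<phi> G = z \<longrightarrow> equivclp Q F G" for z
  proof (induction rule: equivclp_induct)
    case base
    show ?case using lift refl \<open>F \<in> L\<close> by metis
  next
    case (step y z)
    show ?case
    proof (intro ballI impI)
      fix G assume G: "G \<in> L" "\<phi> G = z"
      from step(2) have "y \<in> S" using dom by blast
      then obtain H where H: "H \<in> L" "\<phi> H = y" using surj by blast
      then have "equivclp Q F H" using step.IH by blast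
      moreover have "equivclp Q H G"
        using step(2) lift H G by (metis equivclp_sym)
      ultimately show "equivclp Q F G" by (rule equivclp_trans)
    qed
  qed
  then show ?thesis using assms by blast
qed

definition edge :: "'a sset \<Rightarrow> 'a \<Rightarrow> 'a \<Rightarrow> bool" where
  "edge X x y \<longleftrightarrow> (\<exists>e\<in>cells X 1. act X 1 [0] e = x \<and> act X 1 [1] e = y)"

lemma same_component_eq: "same_component X = equivclp (edge X)"
  unfolding same_component_def edge_def ..


section \<open>Filtered colimits\<close>

text \<open>Transition maps go from larger to smaller indices, so \<open>lower_bound\<close> is the
  filteredness of the opposite order.\<close>

locale filtered_index =
  fixes I :: "'i set" and le :: "'i \<Rightarrow> 'i \<Rightarrow> bool"
  assumes le_refl: "p \<in> I \<Longrightarrow> le p p"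
    and le_trans: "\<lbrakk>p \<in> I; q \<in> I; r \<in> I; le q p; le r q\<rbrakk> \<Longrightarrow> le r p"
    and lower_bound: "\<lbrakk>p \<in> I; q \<in> I\<rbrakk> \<Longrightarrow> \<exists>r\<in>I. le r p \<and> le r q"
begin

definition diagram :: "('i \<Rightarrow> 'a set) \<Rightarrow> ('i \<Rightarrow> 'i \<Rightarrow> 'a \<Rightarrow> 'a) \<Rightarrow> bool" where
  "diagram S t \<longleftrightarrow>
     (\<forall>p\<in>I. \<forall>q\<in>I. le q p \<longrightarrow> (\<forall>x\<in>S p. t p q x \<in> S q)) \<and>
     (\<forall>p\<in>I. \<forall>q\<in>I. \<forall>r\<in>I. le q p \<and> le r q \<longrightarrow> (\<forall>x\<in>S p. t q r (t p q x) = t p r x))"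

lemma diagram_closed: "\<lbrakk>diagram S t; p \<in> I; q \<in> I; le q p; x \<in> S p\<rbrakk> \<Longrightarrow> t p q x \<in> S q"
  by (auto simp: diagram_def)

lemma diagram_comp:
  "\<lbrakk>diagram S t; p \<in> I; q \<in> I; r \<in> I; le q p; le r q; x \<in> S p\<rbrakk> \<Longrightarrow> t q r (t p q x) = t p r x"
  by (auto simp: diagram_def)

text \<open>Agreement at a common later stage contains the generating relation, and it survives each
  generating step: a forward step needs a new lower bound of the old stage and the new index, a
  backward step keeps the old stage.\<close>

lemma class_iff:
  assumes d: "diagram S t" and p: "p \<in> I" "x \<in> S p"
  shows "(q, y) \<in> colim_class I le S t p x \<longleftrightarrow>
    q \<in> I \<and> y \<in> S q \<and> (\<exists>r\<in>I. le r p \<and> le r q \<and> t p r x = t q r y)"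
proof -
  define R where "R = (\<lambda>(p, x) z. p \<in> I \<and> x \<in> S p \<and> (\<exists>q\<in>I. le q p \<and> z = (q, t p q x)))"
  define E where "E = (\<lambda>z. fst z \<in> I \<and> snd z \<in> S (fst z) \<and>
    (\<exists>r\<in>I. le r p \<and> le r (fst z) \<and> t p r x = t (fst z) r (snd z)))"
  have E_I: "E z" if "equivclp R (p, x) z" for z
    using that
  proof (induction rule: equivclp_induct)
    case base
    show ?case using p le_refl by (auto simp: E_def)
  next
    case (step w z)
    obtain q y where w: "w = (q, y)" by force
    obtain s v where z: "z = (s, v)" by force
    from step.IH w obtain r where r: "q \<in> I" "y \<in> S q" "r \<in> I" "le r p" "le r q" "t p r x = t q r y"
      by (auto simp: E_def)
    show ?case
      using step(2)
    proof
      assume "R w z"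
      then have s: "s \<in> I" "le s q" "v = t q s y" by (auto simp: R_def w z)
      obtain a where a: "a \<in> I" "le a r" "le a s" using lower_bound r s by blast
      have "t p a x = t s a v"
        using diagram_comp[OF d] a r s p by metis
      then show ?thesis
        using a r s p diagram_closed[OF d] le_trans unfolding E_def z
        by (metis fst_conv snd_conv)
    next
      assume "R z w"
      then have s: "s \<in> I" "v \<in> S s" "le q s" "y = t s q v" by (auto simp: R_def w z)
      have "t p r x = t s r v"
        using diagram_comp[OF d] r s p by metis
      then show ?thesis
        using r s p le_trans unfolding E_def z by (metis fst_conv snd_conv)
    qed
  qed
  have "equivclp R (p, x) (q, y)"
    if "q \<in> I" "y \<in> S q" "r \<in> I" "le r p" "le r q" "t p r x = t q r y" for r
  proof -
    have "R (p, x) (r, t p r x)" "R (q, y) (r, t p r x)"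
      using that p by (auto simp: R_def)
    then show ?thesis by (meson equivclp_sym equivclp_trans r_into_equivclp)
  qed
  then show ?thesis
    using E_I[of "(q, y)"] unfolding colim_class_def R_def[symmetric] by (auto simp: E_def)
qed

lemma class_eq_iff:
  assumes "diagram S t" "p \<in> I" "x \<in> S p" "q \<in> I" "y \<in> S q"
  shows "colim_class I le S t p x = colim_class I le S t q y \<longleftrightarrow>
    (\<exists>r\<in>I. le r p \<and> le r q \<and> t p r x = t q r y)"
proof -
  have "colim_class I le S t p x = colim_class I le S t q y \<longleftrightarrow> (q, y) \<in> colim_class I le S t p x"
    unfolding colim_class_def by (auto intro: equivclp_trans equivclp_sym)
  then show ?thesis using class_iff[OF assms(1-3)] assms by simp
qed

lemma class_push:
  assumes "diagram S t" "p \<in> I" "x \<in> S p" "q \<in> I" "le q p"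
  shows "colim_class I le S t q (t p q x) = colim_class I le S t p x"
  using assms class_eq_iff[of S t q "t p q x" p x] le_refl[of q]
    diagram_closed[OF assms(1)] diagram_comp[OF assms(1), of p q q x] by metis

text \<open>Operations on the colimit are defined as unions over all representatives. Naturality
  makes all classes in that union equal, so the union is computed by any single
  representative.\<close>

lemma UN_class:
  assumes d: "diagram S t" and d': "diagram S' t'" and p: "p \<in> I" "x \<in> S p"
    and a: "\<And>q y. \<lbrakk>q \<in> I; y \<in> S q\<rbrakk> \<Longrightarrow> a q y \<in> S' q"
    and nat: "\<And>q r y. \<lbrakk>q \<in> I; r \<in> I; le r q; y \<in> S q\<rbrakk> \<Longrightarrow> a r (t q r y) = t' q r (a q y)"
  shows "(\<Union>(q, y)\<in>colim_class I le S t p x. colim_class I le S' t' q (a q y))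
       = colim_class I le S' t' p (a p x)"
proof -
  have "colim_class I le S' t' q (a q y) = colim_class I le S' t' p (a p x)"
    if "(q, y) \<in> colim_class I le S t p x" for q y
  proof -
    from that class_iff[OF d p] obtain r where
      r: "q \<in> I" "y \<in> S q" "r \<in> I" "le r p" "le r q" "t p r x = t q r y" by blast
    then have "t' q r (a q y) = t' p r (a p x)" using nat p by metis
    then show ?thesis using r p a class_eq_iff[OF d'] by metis
  qed
  moreover have "(p, x) \<in> colim_class I le S t p x" by (simp add: colim_class_def)
  ultimately show ?thesis by blast
qed

text \<open>Path components commute with filtered colimits: \<open>E r\<close> are the edges at stage \<open>r\<close> and
  \<open>Q\<close> the edges of the colimit.\<close>

lemma colim_components:
  assumes d: "diagram S t" and p: "p \<in> I" "F \<in> S p" "G \<in> S p"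
    and E_S: "\<And>r x y. \<lbrakk>r \<in> I; E r x y\<rbrakk> \<Longrightarrow> x \<in> S r \<and> y \<in> S r"
    and E_t: "\<And>q r x y. \<lbrakk>q \<in> I; r \<in> I; le r q; E q x y\<rbrakk> \<Longrightarrow> E r (t q r x) (t q r y)"
    and Q: "\<And>f g. Q f g \<longleftrightarrow> (\<exists>r\<in>I. \<exists>x y. E r x y \<and> f = colim_class I le S t r x \<and>
                                                g = colim_class I le S t r y)"
  shows "equivclp Q (colim_class I le S t p F) (colim_class I le S t p G) \<longleftrightarrow>
    (\<exists>r\<in>I. le r p \<and> equivclp (E r) (t p r F) (t p r G))" (is "?L \<longleftrightarrow> ?R")
proof
  let ?c = "colim_class I le S t"
  have push: "equivclp (E r) (t q r x) (t q r y)"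
    if "q \<in> I" "r \<in> I" "le r q" "equivclp (E q) x y" for q r x y
    using that(4) by (rule equivclp_map) (use E_t that in blast)
  have Q_dom: "(\<exists>s\<in>I. \<exists>z\<in>S s. f = ?c s z) \<and> (\<exists>s\<in>I. \<exists>z\<in>S s. g = ?c s z)" if "Q f g" for f g
    using that Q[of f g] E_S by fastforce
  \<comment> \<open>An edge of the colimit comes from an edge at some stage \<open>a\<close> whose
    ends agree with \<open>x\<close> and \<open>y\<close> only further on, at \<open>b\<close> and
    \<open>e\<close>. Below both stages it joins the images of \<open>x\<close> and \<open>y\<close>
    themselves.\<close>
  have one: "\<exists>r\<in>I. le r q \<and> le r s \<and> equivclp (E r) (t q r x) (t s r y)"
    if qs: "q \<in> I" "s \<in> I" "x \<in> S q" "y \<in> S s" and "Q (?c q x) (?c s y)" for q s x y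
  proof -
    from that obtain a u v where a: "a \<in> I" "E a u v" "?c q x = ?c a u" "?c s y = ?c a v"
      using Q by auto
    then have uv: "u \<in> S a" "v \<in> S a" using E_S by auto
    obtain b where b: "b \<in> I" "le b q" "le b a" "t q b x = t a b u"
      using class_eq_iff[OF d qs(1,3) a(1) uv(1)] a by auto
    obtain e where e: "e \<in> I" "le e s" "le e a" "t s e y = t a e v"
      using class_eq_iff[OF d qs(2,4) a(1) uv(2)] a by auto
    obtain r where r: "r \<in> I" "le r b" "le r e" using lower_bound b e by blast
    have "t q r x = t a r u" "t s r y = t a r v"
      using diagram_comp[OF d] qs a b e r uv by metis+
    moreover have "le r a" "le r q" "le r s" using le_trans qs a b e r by blast+
    ultimately show ?thesis using E_t[OF a(1) r(1)] a r by (metis r_into_equivclp)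
  qed
  \<comment> \<open>The invariant carries a representative at an arbitrary index \<open>q\<close>,
    since intermediate vertices of the zigzag need not be represented at stage
    \<open>p\<close>.\<close>
  have "equivclp Q (?c p F) g \<Longrightarrow>
      \<exists>q\<in>I. \<exists>y\<in>S q. g = ?c q y \<and> (\<exists>r\<in>I. le r p \<and> le r q \<and> equivclp (E r) (t p r F) (t q r y))" for g
  proof (induction rule: equivclp_induct)
    case base
    show ?case
      by (intro bexI[of _ p] bexI[of _ F] conjI refl le_refl p equivclp_refl)
  next
    case (step g h)
    then obtain q y r where q: "q \<in> I" "y \<in> S q" "g = ?c q y"
      "r \<in> I" "le r p" "le r q" "equivclp (E r) (t p r F) (t q r y)" by blast
    from step(2) obtain s z where s: "s \<in> I" "z \<in> S s" "h = ?c s z"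
      using Q_dom by meson
    have "\<exists>r\<in>I. le r q \<and> le r s \<and> equivclp (E r) (t q r y) (t s r z)"
      using step(2) one[of q s y z] one[of s q z y] q s by (meson equivclp_sym)
    then obtain a where a: "a \<in> I" "le a q" "le a s" "equivclp (E a) (t q a y) (t s a z)"
      by blast
    obtain b where b: "b \<in> I" "le b r" "le b a" using lower_bound q a by blast
    have "equivclp (E b) (t p b F) (t q b y)"
      using push[OF q(4) b(1,2) q(7)] diagram_comp[OF d] p q b by metis
    moreover have "equivclp (E b) (t q b y) (t s b z)"
      using push[OF a(1) b(1,3) a(4)] diagram_comp[OF d] q s a b by metis
    ultimately have "equivclp (E b) (t p b F) (t s b z)" by (rule equivclp_trans)
    moreover have "le b p" "le b s" using le_trans p q s a b by blast+
    ultimately show ?case using s b by blast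
  qed
  moreover assume ?L
  ultimately obtain q y r where q: "q \<in> I" "y \<in> S q" "?c p G = ?c q y"
      "r \<in> I" "le r p" "le r q" "equivclp (E r) (t p r F) (t q r y)" by blast
  \<comment> \<open>The representative reached at the end of the zigzag has only the class of
    \<open>G\<close>; it agrees with \<open>G\<close> from some stage \<open>a\<close> on.\<close>
  then obtain a where a: "a \<in> I" "le a p" "le a q" "t p a G = t q a y"
    using class_eq_iff[OF d] p by blast
  obtain b where b: "b \<in> I" "le b r" "le b a" using lower_bound q a by blast
  have "equivclp (E b) (t p b F) (t q b y)"
    using push[OF q(4) b(1,2) q(7)] diagram_comp[OF d] p q b by metis
  moreover have "t q b y = t p b G" using diagram_comp[OF d] p q a b by metis
  ultimately show ?R using b le_trans p q by metis
next
  let ?c = "colim_class I le S t"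
  assume ?R
  then obtain r where r: "r \<in> I" "le r p" "equivclp (E r) (t p r F) (t p r G)" by blast
  have "equivclp Q (?c r (t p r F)) (?c r (t p r G))"
    using r(3)
  proof (rule equivclp_map)
    show "equivclp Q (?c r x) (?c r y)" if "E r x y" for x y
      using that Q[of "?c r x" "?c r y"] r(1) by blast
  qed
  then show ?L using class_push[OF d] p r by simp
qed

lemma sset_colim_act:
  assumes d: "\<And>n. diagram (\<lambda>p. cells (D p) n) (\<lambda>p q. t p q n)"
    and closed: "\<And>p x. \<lbrakk>p \<in> I; x \<in> cells (D p) n\<rbrakk> \<Longrightarrow> act (D p) n \<theta> x \<in> cells (D p) m"
    and nat: "\<And>p q x. \<lbrakk>p \<in> I; q \<in> I; le q p; x \<in> cells (D p) n\<rbrakk>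
      \<Longrightarrow> act (D q) n \<theta> (t p q n x) = t p q m (act (D p) n \<theta> x)"
    and \<theta>: "\<theta> \<in> ops m n" and p: "p \<in> I" "x \<in> cells (D p) n"
  shows "act (sset_colim I le D t) n \<theta> (sset_colim_class I le D t n p x) =
    sset_colim_class I le D t m p (act (D p) n \<theta> x)"
proof -
  have "act (sset_colim I le D t) n \<theta> c =
      (\<Union>(q, y)\<in>c. sset_colim_class I le D t m q (act (D q) n \<theta> y))" for c
    using \<theta> by (simp add: sset_colim_def ops_def)
  then show ?thesis
    unfolding sset_colim_class_def using UN_class[OF d d p, of "\<lambda>q. act (D q) n \<theta>" m] closed nat
    by simp
qed

end


section \<open>The order on subobjects of the final object\<close>

text \<open>The boundary of the 0-simplex is empty, so filling it produces a vertex.\<close>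

lemma contractible_nonempty:
  assumes "contractible X" shows "cells X 0 \<noteq> {}"
proof -
  have "bdry X 0 (\<lambda>_. undefined)" by (simp add: bdry_def)
  then show ?thesis using assms by (auto simp: contractible_def fills_bdry_def)
qed

text \<open>The part common to the three models. \<open>hom_refl\<close> and
  \<open>hom_trans\<close> turn existence of a map into a preorder; \<open>prd_proj\<close> is all
  that is kept of the universal property of products, and it makes meets lower bounds.\<close>

locale final_filter =
  fixes H :: "('o, 'm, 'z) homs_scheme" and prd :: "'o \<Rightarrow> 'o \<Rightarrow> 'o \<Rightarrow> bool" and \<Phi> :: "'o set set"
  assumes filter: "product_closed_filter H prd \<Phi>"
    and hom_refl: "x \<in> obj H \<Longrightarrow> cells (maps H x x) 0 \<noteq> {}"
    and hom_trans: "\<lbrakk>x \<in> obj H; y \<in> obj H; z \<in> obj H; cells (maps H x y) 0 \<noteq> {};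
                     cells (maps H y z) 0 \<noteq> {}\<rbrakk> \<Longrightarrow> cells (maps H x z) 0 \<noteq> {}"
    and prd_proj: "\<lbrakk>a \<in> obj H; b \<in> obj H; prd a b r\<rbrakk> \<Longrightarrow>
                     cells (maps H r a) 0 \<noteq> {} \<and> cells (maps H r b) 0 \<noteq> {}"
begin

text \<open>An element of \<open>Sub1\<close> is the image of one representative \<open>w\<close>
  under a relation, so membership is first described relative to \<open>w\<close>; reflexivity and
  transitivity of the existence of maps then remove this choice.\<close>

lemma member_class:
  assumes "p \<in> \<Phi>"
  obtains w where "subfinal H w"
    "\<And>v. v \<in> p \<longleftrightarrow> subfinal H v \<and> cells (maps H w v) 0 \<noteq> {} \<and> cells (maps H v w) 0 \<noteq> {}"
proof -
  have "p \<in> Sub1 H" using filter assms by (auto simp: product_closed_filter_def)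
  then show ?thesis using that by (auto simp: Sub1_def quotient_def)
qed

lemma member_subfinal: "\<lbrakk>p \<in> \<Phi>; u \<in> p\<rbrakk> \<Longrightarrow> subfinal H u"
  by (metis member_class)

lemma member_obj: "\<lbrakk>p \<in> \<Phi>; u \<in> p\<rbrakk> \<Longrightarrow> u \<in> obj H"
  using member_subfinal by (auto simp: subfinal_def)

lemma member_hom:
  assumes "p \<in> \<Phi>" "u \<in> p" "v \<in> p"
  shows "cells (maps H u v) 0 \<noteq> {}"
proof -
  obtain w where w: "subfinal H w"
    "\<And>v. v \<in> p \<longleftrightarrow> subfinal H v \<and> cells (maps H w v) 0 \<noteq> {} \<and> cells (maps H v w) 0 \<noteq> {}"
    using member_class assms(1) by metis
  have "cells (maps H u w) 0 \<noteq> {}" "cells (maps H w v) 0 \<noteq> {}"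
    using w(2) assms by blast+
  moreover have "u \<in> obj H" "w \<in> obj H" "v \<in> obj H"
    using w(1) member_obj[OF assms(1)] assms by (simp_all add: subfinal_def)
  ultimately show ?thesis by (metis hom_trans)
qed

lemma member_nonempty:
  assumes "p \<in> \<Phi>" shows "\<exists>u. u \<in> p"
proof -
  obtain w where w: "subfinal H w"
    "\<And>v. v \<in> p \<longleftrightarrow> subfinal H v \<and> cells (maps H w v) 0 \<noteq> {} \<and> cells (maps H v w) 0 \<noteq> {}"
    using member_class assms(1) by metis
  have "w \<in> p" using w(1) w(2)[of w] hom_refl[of w] by (simp add: subfinal_def)
  then show ?thesis ..
qed

lemma meet_in: "\<lbrakk>p \<in> \<Phi>; q \<in> \<Phi>\<rbrakk> \<Longrightarrow> sub_meet prd p q \<in> \<Phi>"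
  using filter by (simp add: product_closed_filter_def)

lemma top_in: "sub_top H \<in> \<Phi>"
  using filter by (simp add: product_closed_filter_def)

text \<open>\<open>sub_meet\<close> is merely a set of products of representatives. It is inhabited
  because the filter contains it and every member of the filter is an equivalence class; the
  projections of any inhabitant give both inequalities.\<close>

lemma meet_le:
  assumes "p \<in> \<Phi>" "q \<in> \<Phi>"
  shows "sub_le H (sub_meet prd p q) p" "sub_le H (sub_meet prd p q) q"
proof -
  obtain r where r: "r \<in> sub_meet prd p q" using member_nonempty[OF meet_in[OF assms]] by blast
  then obtain u v where "u \<in> p" "v \<in> q" "prd u v r" by (auto simp: sub_meet_def)
  then show "sub_le H (sub_meet prd p q) p" "sub_le H (sub_meet prd p q) q"
    using r prd_proj member_obj assms unfolding sub_le_def by blast+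
qed

lemma le_top:
  assumes "p \<in> \<Phi>" shows "sub_le H p (sub_top H)"
proof -
  obtain u t where "u \<in> p" "t \<in> sub_top H" using member_nonempty assms top_in by meson
  moreover then have "contractible (maps H u t)"
    using member_obj assms by (auto simp: sub_top_def final_object_def)
  then have "cells (maps H u t) 0 \<noteq> {}"
    using contractible_nonempty by blast
  ultimately show ?thesis by (auto simp: sub_le_def)
qed

sublocale filtered_index \<Phi> "sub_le H"
proof
  fix p q r
  assume p: "p \<in> \<Phi>"
  then obtain u where "u \<in> p" using member_nonempty by blast
  then show "sub_le H p p"
    using member_hom[OF p] by (auto simp: sub_le_def)
  assume q: "q \<in> \<Phi>"
  then show "\<exists>r\<in>\<Phi>. sub_le H r p \<and> sub_le H r q"
    using p meet_in meet_le by blast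
  assume r: "r \<in> \<Phi>"
  assume "sub_le H q p"
  then obtain c d where cd: "c \<in> q" "d \<in> p" "cells (maps H c d) 0 \<noteq> {}"
    unfolding sub_le_def by blast
  assume "sub_le H r q"
  then obtain a b where ab: "a \<in> r" "b \<in> q" "cells (maps H a b) 0 \<noteq> {}"
    unfolding sub_le_def by blast
  \<comment> \<open>\<open>b\<close> and \<open>c\<close> may be different representatives of the
    middle class \<open>q\<close>, so a map between them has to be inserted.\<close>
  have "cells (maps H b c) 0 \<noteq> {}" using member_hom[OF q] ab cd by blast
  then have "cells (maps H a c) 0 \<noteq> {}"
    using hom_trans[of a b c] member_obj[OF r] member_obj[OF q] ab cd by simp
  then have "cells (maps H a d) 0 \<noteq> {}"
    using hom_trans[of a c d] member_obj[OF r] member_obj[OF q] member_obj[OF p] ab cd by simp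
  then show "sub_le H r p" unfolding sub_le_def using ab cd by blast
qed

text \<open>The colimit provides a stage \<open>r\<close> below \<open>V\<close>, while the theorem
  speaks of \<open>V \<and> U\<close>. Choosing \<open>U = r\<close> and restricting further to
  \<open>V \<and> r\<close> gives one direction; in the other, the meet itself is a stage below
  \<open>V\<close>.\<close>

lemma ex_meet_iff:
  assumes d: "diagram S t" and V: "V \<in> \<Phi>" "F \<in> S V" "G \<in> S V"
    and E_t: "\<And>q r x y. \<lbrakk>q \<in> \<Phi>; r \<in> \<Phi>; sub_le H r q; E q x y\<rbrakk> \<Longrightarrow> E r (t q r x) (t q r y)"
  shows "(\<exists>r\<in>\<Phi>. sub_le H r V \<and> equivclp (E r) (t V r F) (t V r G)) \<longleftrightarrow>
    (\<exists>U\<in>\<Phi>. equivclp (E (sub_meet prd V U)) (t V (sub_meet prd V U) F) (t V (sub_meet prd V U) G))"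
proof
  assume "\<exists>r\<in>\<Phi>. sub_le H r V \<and> equivclp (E r) (t V r F) (t V r G)"
  then obtain r where r: "r \<in> \<Phi>" "sub_le H r V" "equivclp (E r) (t V r F) (t V r G)" by blast
  let ?m = "sub_meet prd V r"
  have m: "?m \<in> \<Phi>" "sub_le H ?m r" using meet_in meet_le V r by auto
  have "equivclp (E ?m) (t r ?m (t V r F)) (t r ?m (t V r G))"
    using r(3) by (rule equivclp_map) (use E_t r m in blast)
  then show "\<exists>U\<in>\<Phi>. equivclp (E (sub_meet prd V U)) (t V (sub_meet prd V U) F) (t V (sub_meet prd V U) G)"
    using diagram_comp[OF d V(1) r(1) m(1) r(2) m(2)] V r by auto
next
  assume "\<exists>U\<in>\<Phi>. equivclp (E (sub_meet prd V U)) (t V (sub_meet prd V U) F) (t V (sub_meet prd V U) G)"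
  then show "\<exists>r\<in>\<Phi>. sub_le H r V \<and> equivclp (E r) (t V r F) (t V r G)"
    using meet_in meet_le V by metis
qed

end


section \<open>Simplicial sets\<close>

lemma simplicial_set_cells:
  "\<lbrakk>simplicial_set X; x \<in> cells X n; \<theta> \<in> ops m n\<rbrakk> \<Longrightarrow> act X n \<theta> x \<in> cells X m"
  by (simp add: simplicial_set_def)

lemma simplicial_set_id: "\<lbrakk>simplicial_set X; x \<in> cells X n\<rbrakk> \<Longrightarrow> act X n [0..<Suc n] x = x"
  by (simp add: simplicial_set_def)

lemma simplicial_set_act_act:
  "\<lbrakk>simplicial_set X; x \<in> cells X n; \<theta> \<in> ops m n; \<phi> \<in> ops (length \<phi> - 1) m\<rbrakk>
    \<Longrightarrow> act X m \<phi> (act X n \<theta> x) = act X n (ocomp \<theta> \<phi>) x"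
  unfolding simplicial_set_def by blast

lemmas ops_simps = ops_def ocomp_def eval_nat_numeral

lemma cst_0: "\<lbrakk>simplicial_set X; x \<in> cells X 0\<rbrakk> \<Longrightarrow> cst X 0 x = x"
  using simplicial_set_id[of X x 0] by (simp add: cst_def)

lemma replicate_ops: "replicate (Suc n) 0 \<in> ops n 0"
  by (auto simp: ops_def)

lemma cst_cells: "\<lbrakk>simplicial_set X; x \<in> cells X 0\<rbrakk> \<Longrightarrow> cst X n x \<in> cells X n"
  unfolding cst_def by (rule simplicial_set_cells[OF _ _ replicate_ops])

lemma act_cst:
  assumes "simplicial_set X" "x \<in> cells X 0" "\<theta> \<in> ops m n"
  shows "act X n \<theta> (cst X n x) = cst X m x"
proof -
  have "ocomp (replicate (Suc n) 0) \<theta> = replicate (Suc m) 0"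
  proof -
    have "i < Suc n" if "i \<in> set \<theta>" for i using assms(3) that by (auto simp: ops_def)
    then have "map ((!) (replicate (Suc n) 0)) \<theta> = map (\<lambda>_. 0) \<theta>"
      by (intro map_cong refl nth_replicate) auto
    then show ?thesis
      using assms(3) unfolding ocomp_def by (simp add: ops_def map_replicate_const)
  qed
  then show ?thesis
    using simplicial_set_act_act[OF assms(1,2) replicate_ops, of \<theta> n] assms(3)
    by (auto simp: cst_def ops_def)
qed

lemma edge_cells: "\<lbrakk>simplicial_set X; edge X x y\<rbrakk> \<Longrightarrow> x \<in> cells X 0 \<and> y \<in> cells X 0"
  unfolding edge_def
  using simplicial_set_cells[of X _ 1 "[0]" 0] simplicial_set_cells[of X _ 1 "[1]" 0]
  by (auto simp: ops_def)

lemma edge_refl: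
  assumes "simplicial_set X" "x \<in> cells X 0" shows "edge X x x"
proof -
  have "act X 1 [0] (cst X 1 x) = x" "act X 1 [1] (cst X 1 x) = x"
    using act_cst[OF assms, of _ 0 1] cst_0[OF assms] by (simp_all add: ops_def)
  then show ?thesis using cst_cells[OF assms] by (auto simp: edge_def)
qed

lemma contractible_edge:
  assumes "contractible X" "a \<in> cells X 0" "b \<in> cells X 0"
  shows "edge X a b"
proof -
  \<comment> \<open>Face 0 omits vertex 0 and is therefore the end of the edge, so \<open>b\<close>
    comes first.\<close>
  have "bdry X 1 (\<lambda>i. if i = 0 then b else a)" using assms by (simp add: bdry_def)
  then obtain e where e: "fills_bdry X 1 (\<lambda>i. if i = 0 then b else a) e"
    using assms by (auto simp: contractible_def)
  then have "face X 1 0 e = b" "face X 1 1 e = a" "e \<in> cells X 1" by (auto simp: fills_bdry_def)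
  then show ?thesis by (auto simp: edge_def face_def)
qed

lemma contractible_triangle:
  assumes c: "contractible X" and e: "e\<^sub>0 \<in> cells X 1" "e\<^sub>1 \<in> cells X 1" "e\<^sub>2 \<in> cells X 1"
    and v: "act X 1 [0] e\<^sub>0 = act X 1 [1] e\<^sub>2" "act X 1 [1] e\<^sub>0 = act X 1 [1] e\<^sub>1"
      "act X 1 [0] e\<^sub>1 = act X 1 [0] e\<^sub>2"
  shows "\<exists>\<rho>\<in>cells X 2. act X 2 [1, 2] \<rho> = e\<^sub>0 \<and> act X 2 [0, 2] \<rho> = e\<^sub>1 \<and> act X 2 [0, 1] \<rho> = e\<^sub>2"
proof -
  define b where "b = (\<lambda>i::nat. if i = 0 then e\<^sub>0 else if i = 1 then e\<^sub>1 else e\<^sub>2)"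
  have "bdry X 2 b"
    using e v by (auto simp: bdry_def b_def face_def eval_nat_numeral le_Suc_eq less_Suc_eq)
  then obtain \<rho> where \<rho>: "fills_bdry X 2 b \<rho>"
    using c by (auto simp: contractible_def)
  then have "face X 2 0 \<rho> = e\<^sub>0" "face X 2 1 \<rho> = e\<^sub>1" "face X 2 2 \<rho> = e\<^sub>2" "\<rho> \<in> cells X 2"
    by (auto simp: fills_bdry_def b_def)
  then show ?thesis by (auto simp: face_def eval_nat_numeral)
qed


section \<open>Quasi-categories\<close>

locale quasi_cat =
  fixes C :: "'a sset"
  assumes quasi_category: "quasi_category C"
begin

lemma simplicial: "simplicial_set C"
  using quasi_category by (simp add: quasi_category_def)

lemmas C_cells = simplicial_set_cells[OF simplicial]
lemmas C_act = simplicial_set_act_act[OF simplicial]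

lemma C_id:
  "x \<in> cells C 0 \<Longrightarrow> act C 0 [0] x = x"
  "x \<in> cells C 1 \<Longrightarrow> act C 1 [0, 1] x = x"
  "x \<in> cells C 2 \<Longrightarrow> act C 2 [0, 1, 2] x = x"
  using simplicial_set_id[OF simplicial, of x 0] simplicial_set_id[OF simplicial, of x 1]
    simplicial_set_id[OF simplicial, of x 2] by (simp_all add: eval_nat_numeral)

section \<open>Inner horns in dimensions 2, 3 and 4\<close>

lemma inner_horn:
  assumes "0 < k" "k < n" "horn C n k h"
  obtains x where "x \<in> cells C n" "\<And>i. \<lbrakk>i \<le> n; i \<noteq> k\<rbrakk> \<Longrightarrow> face C n i x = h i"
  using assms quasi_category unfolding quasi_category_def fills_horn_def by meson

text \<open>This lemma and the next three express inner horn filling through vertex lists, so that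
  the faces and their compatibility conditions can be read off as sublists.\<close>

lemma fill_horn_2_1:
  assumes "f \<in> cells C 1" "g \<in> cells C 1" "act C 1 [1] f = act C 1 [0] g"
  shows "\<exists>\<sigma>\<in>cells C 2. act C 2 [0, 1] \<sigma> = f \<and> act C 2 [1, 2] \<sigma> = g"
proof -
  define h where "h = (\<lambda>i::nat. if i = 0 then g else f)"
  have "horn C 2 1 h"
    using assms by (auto simp: horn_def h_def face_def eval_nat_numeral le_Suc_eq less_Suc_eq)
  then obtain x where "x \<in> cells C 2" "\<And>i. \<lbrakk>i \<le> 2; i \<noteq> 1\<rbrakk> \<Longrightarrow> face C 2 i x = h i"
    using inner_horn[of 1 2 h] by auto
  from this(1) this(2)[of 0] this(2)[of 2] show ?thesis
    by (auto simp: face_def h_def eval_nat_numeral)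
qed

lemma fill_horn_3_1:
  assumes "a \<in> cells C 2" "b \<in> cells C 2" "c \<in> cells C 2"
    and "act C 2 [0, 2] a = act C 2 [1, 2] b" "act C 2 [0, 1] a = act C 2 [1, 2] c"
      "act C 2 [0, 1] b = act C 2 [0, 1] c"
  shows "\<exists>\<tau>\<in>cells C 3. act C 3 [1, 2, 3] \<tau> = a \<and> act C 3 [0, 1, 3] \<tau> = b \<and> act C 3 [0, 1, 2] \<tau> = c"
proof -
  define h where "h = (\<lambda>i::nat. if i = 0 then a else if i = 2 then b else c)"
  have "horn C 3 1 h"
    using assms by (auto simp: horn_def h_def face_def eval_nat_numeral le_Suc_eq less_Suc_eq)
  then obtain x where "x \<in> cells C 3" "\<And>i. \<lbrakk>i \<le> 3; i \<noteq> 1\<rbrakk> \<Longrightarrow> face C 3 i x = h i"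
    using inner_horn[of 1 3 h] by auto
  from this(1) this(2)[of 0] this(2)[of 2] this(2)[of 3] show ?thesis
    by (auto simp: face_def h_def eval_nat_numeral)
qed

lemma fill_horn_3_2:
  assumes "a \<in> cells C 2" "b \<in> cells C 2" "c \<in> cells C 2"
    and "act C 2 [1, 2] a = act C 2 [1, 2] b" "act C 2 [0, 1] a = act C 2 [1, 2] c"
      "act C 2 [0, 1] b = act C 2 [0, 2] c"
  shows "\<exists>\<tau>\<in>cells C 3. act C 3 [1, 2, 3] \<tau> = a \<and> act C 3 [0, 2, 3] \<tau> = b \<and> act C 3 [0, 1, 2] \<tau> = c"
proof -
  define h where "h = (\<lambda>i::nat. if i = 0 then a else if i = 1 then b else c)"
  have "horn C 3 2 h"
    using assms by (auto simp: horn_def h_def face_def eval_nat_numeral le_Suc_eq less_Suc_eq)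
  then obtain x where "x \<in> cells C 3" "\<And>i. \<lbrakk>i \<le> 3; i \<noteq> 2\<rbrakk> \<Longrightarrow> face C 3 i x = h i"
    using inner_horn[of 2 3 h] by auto
  from this(1) this(2)[of 0] this(2)[of 1] this(2)[of 3] show ?thesis
    by (auto simp: face_def h_def eval_nat_numeral)
qed

lemma fill_horn_4_2:
  assumes "a \<in> cells C 3" "b \<in> cells C 3" "c \<in> cells C 3" "d \<in> cells C 3"
    and "act C 3 [1, 2, 3] a = act C 3 [1, 2, 3] b" "act C 3 [0, 1, 3] a = act C 3 [1, 2, 3] c"
      "act C 3 [0, 1, 2] a = act C 3 [1, 2, 3] d" "act C 3 [0, 1, 3] b = act C 3 [0, 2, 3] c"
      "act C 3 [0, 1, 2] b = act C 3 [0, 2, 3] d" "act C 3 [0, 1, 2] c = act C 3 [0, 1, 2] d"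
  shows "\<exists>\<omega>\<in>cells C 4. act C 4 [1, 2, 3, 4] \<omega> = a \<and> act C 4 [0, 2, 3, 4] \<omega> = b \<and>
    act C 4 [0, 1, 2, 4] \<omega> = c \<and> act C 4 [0, 1, 2, 3] \<omega> = d"
proof -
  define h where "h = (\<lambda>i::nat. if i = 0 then a else if i = 1 then b else if i = 3 then c else d)"
  have "horn C 4 2 h"
    using assms by (auto simp: horn_def h_def face_def eval_nat_numeral le_Suc_eq less_Suc_eq)
  then obtain x where "x \<in> cells C 4" "\<And>i. \<lbrakk>i \<le> 4; i \<noteq> 2\<rbrakk> \<Longrightarrow> face C 4 i x = h i"
    using inner_horn[of 2 4 h] by auto
  from this(1) this(2)[of 0] this(2)[of 1] this(2)[of 3] this(2)[of 4] show ?thesis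
    by (auto simp: face_def h_def eval_nat_numeral)
qed

section \<open>Right mapping spaces and maps into a subobject of the final object\<close>

lemma hom_right_0: "x \<in> cells C 0 \<Longrightarrow>
    f \<in> cells (hom_right C x y) 0 \<longleftrightarrow> f \<in> cells C 1 \<and> act C 1 [0] f = x \<and> act C 1 [1] f = y"
  using C_id(1) by (auto simp: hom_right_def cst_def)

lemma hom_right_1: "e \<in> cells (hom_right C x y) 1 \<longleftrightarrow>
    e \<in> cells C 2 \<and> act C 2 [0, 1] e = act C 0 [0, 0] x \<and> act C 2 [2] e = y"
  by (auto simp: hom_right_def cst_def eval_nat_numeral)

lemma edge_hom_right: "edge (hom_right C x y) f g \<longleftrightarrow>
    (\<exists>\<sigma>\<in>cells C 2. act C 2 [0, 1] \<sigma> = act C 0 [0, 0] x \<and> act C 2 [2] \<sigma> = y \<and>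
       act C 2 [0, 2] \<sigma> = f \<and> act C 2 [1, 2] \<sigma> = g)"
  by (auto simp: edge_def hom_right_def cst_def eval_nat_numeral)

text \<open>A triangle with vertices \<open>x\<close>, \<open>y\<close>, \<open>u\<close> is glued to a loop at \<open>A : x \<rightarrow> u\<close>; contracting the
  loop repairs the face that the first horn filler leaves uncontrolled.\<close>

lemma lift_edge:
  assumes sub: "subfinal (qc_homs C) u" and A: "A \<in> cells C 1" "act C 1 [1] A = u"
    and F: "F \<in> cells C 2" "act C 2 [0, 2] F = A" "act C 2 [1, 2] F = B"
    and G: "G \<in> cells C 2" "act C 2 [0, 2] G = A" "act C 2 [1, 2] G = B"
    and \<sigma>: "\<sigma> \<in> cells C 2" "act C 2 [0, 1] \<sigma> = act C 0 [0, 0] (act C 1 [0] A)"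
      "act C 2 [0, 2] \<sigma> = act C 2 [0, 1] F" "act C 2 [1, 2] \<sigma> = act C 2 [0, 1] G"
  shows "\<exists>\<omega>\<in>cells C 3. act C 3 [0, 1, 2] \<omega> = \<sigma> \<and> act C 3 [0, 2, 3] \<omega> = F \<and>
    act C 3 [1, 2, 3] \<omega> = G \<and> act C 3 [0, 1, 3] \<omega> = act C 1 [0, 0, 1] A"
proof -
  define x where "x = act C 1 [0] A"
  define D where "D = act C 1 [0, 0, 1] A"
  have x: "x \<in> cells C 0" using A by (simp add: x_def C_cells ops_simps)
  have "A \<in> cells (hom_right C x u) 0" using hom_right_0[OF x] A by (simp add: x_def)
  then have con: "contractible (hom_right C x u)"
    using sub x unfolding subfinal_def qc_homs_def by auto
  obtain \<tau> where \<tau>: "\<tau> \<in> cells C 3" "act C 3 [1, 2, 3] \<tau> = G" "act C 3 [0, 2, 3] \<tau> = F"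
      "act C 3 [0, 1, 2] \<tau> = \<sigma>"
    using fill_horn_3_2[of G F \<sigma>] F G \<sigma> by auto
  define L where "L = act C 3 [0, 1, 3] \<tau>"
  have L: "L \<in> cells C 2" using \<tau> by (simp add: L_def C_cells ops_simps)
  have "act C 2 [0, 1] L = act C 2 [0, 1] (act C 3 [0, 1, 2] \<tau>)"
    "act C 2 [0, 2] L = act C 2 [0, 2] (act C 3 [0, 2, 3] \<tau>)"
    "act C 2 [1, 2] L = act C 2 [0, 2] (act C 3 [1, 2, 3] \<tau>)"
    using \<tau>(1) by (simp_all add: L_def C_act ops_simps)
  then have L': "act C 2 [0, 1] L = act C 0 [0, 0] x" "act C 2 [0, 2] L = A" "act C 2 [1, 2] L = A"
    using \<tau> \<sigma> F G by (simp_all add: x_def)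
  have "act C 2 [2] L = act C 1 [1] (act C 2 [0, 2] L)"
    using L by (simp add: C_act ops_simps)
  then have L2: "act C 2 [2] L = u" using L' A by simp
  have D: "D \<in> cells C 2" using A by (simp add: D_def C_cells ops_simps)
  have D': "act C 2 [0, 1] D = act C 0 [0, 0] x" "act C 2 [0, 2] D = A" "act C 2 [1, 2] D = A"
    "act C 2 [2] D = u"
    using A C_id(2)[OF A(1)] by (simp_all add: D_def x_def C_act ops_simps)
  \<comment> \<open>\<open>D\<close> is the constant loop at \<open>A\<close> in the space of maps
    from \<open>x\<close> to \<open>u\<close>, and \<open>L\<close>, the face left free by the horn,
    is another loop at \<open>A\<close>. The triangle with edges \<open>D\<close>, \<open>L\<close>,
    \<open>D\<close> is a null-homotopy of \<open>L\<close>.\<close>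
  have "\<exists>\<rho>\<in>cells (hom_right C x u) 2. act (hom_right C x u) 2 [1, 2] \<rho> = D \<and>
      act (hom_right C x u) 2 [0, 2] \<rho> = L \<and> act (hom_right C x u) 2 [0, 1] \<rho> = D"
    by (rule contractible_triangle[OF con])
      (use L L' L2 D D' in \<open>simp_all add: hom_right_1\<close>, simp_all add: hom_right_def cst_def eval_nat_numeral)
  then obtain \<rho> where \<rho>: "\<rho> \<in> cells C 3" "act C 3 [0, 1, 2] \<rho> = act C 0 [0, 0, 0] x"
      "act C 3 [1, 2, 3] \<rho> = D" "act C 3 [0, 2, 3] \<rho> = L" "act C 3 [0, 1, 3] \<rho> = D"
    by (auto simp: hom_right_def cst_def eval_nat_numeral)
  \<comment> \<open>The target is a 4-simplex with vertices \<open>x, x, x, y, u\<close>. Its faces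
    opposite to vertices 0, 1, 3, 4 are \<open>a\<close>, \<open>\<tau>\<close>,
    \<open>\<rho>\<close>, \<open>d\<close>, where \<open>\<tau>\<close> and \<open>\<rho>\<close>
    share the triangle \<open>L\<close>. The degeneracies \<open>a\<close> and \<open>d\<close> are
    chosen so that the missing face, opposite to vertex 2, has the faces \<open>\<sigma>\<close>,
    \<open>F\<close>, \<open>G\<close> of \<open>\<tau>\<close> but the degenerate triangle
    \<open>D\<close> in place of \<open>L\<close>.\<close>
  define a where "a = act C 2 [0, 0, 1, 2] G"
  define d where "d = act C 2 [0, 1, 1, 2] \<sigma>"
  have ad: "a \<in> cells C 3" "d \<in> cells C 3" using G \<sigma> by (simp_all add: a_def d_def C_cells ops_simps)
  have a1: "act C 3 [1, 2, 3] a = G" "act C 3 [0, 2, 3] a = G"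
    using G(1) C_id(3)[OF G(1)] by (simp_all add: a_def C_act ops_simps)
  have "act C 3 [0, 1, 3] a = act C 1 [0, 0, 1] (act C 2 [0, 2] G)"
    "act C 3 [0, 1, 2] a = act C 1 [0, 0, 1] (act C 2 [0, 1] G)"
    using G(1) by (simp_all add: a_def C_act ops_simps)
  then have a2: "act C 3 [0, 1, 3] a = D" "act C 3 [0, 1, 2] a = act C 1 [0, 0, 1] (act C 2 [0, 1] G)"
    using G by (simp_all add: D_def)
  have d1: "act C 3 [0, 2, 3] d = \<sigma>" "act C 3 [0, 1, 3] d = \<sigma>"
    using \<sigma>(1) C_id(3)[OF \<sigma>(1)] by (simp_all add: d_def C_act ops_simps)
  have "act C 3 [1, 2, 3] d = act C 1 [0, 0, 1] (act C 2 [1, 2] \<sigma>)"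
    "act C 3 [0, 1, 2] d = act C 1 [0, 1, 1] (act C 2 [0, 1] \<sigma>)"
    using \<sigma>(1) by (simp_all add: d_def C_act ops_simps)
  moreover have "act C 1 [0, 1, 1] (act C 0 [0, 0] x) = act C 0 [0, 0, 0] x"
    using x by (simp add: C_act ops_simps)
  ultimately have d2: "act C 3 [1, 2, 3] d = act C 1 [0, 0, 1] (act C 2 [0, 1] G)"
    "act C 3 [0, 1, 2] d = act C 0 [0, 0, 0] x"
    using \<sigma> by (simp_all add: x_def)
  obtain \<omega> where \<omega>: "\<omega> \<in> cells C 4" "act C 4 [1, 2, 3, 4] \<omega> = a" "act C 4 [0, 2, 3, 4] \<omega> = \<tau>"
      "act C 4 [0, 1, 2, 4] \<omega> = \<rho>" "act C 4 [0, 1, 2, 3] \<omega> = d"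
    using fill_horn_4_2[of a \<tau> \<rho> d] ad a1 a2 d1 d2 \<tau> \<rho> by (auto simp: L_def)
  define \<omega>' where "\<omega>' = act C 4 [0, 1, 3, 4] \<omega>"
  have "\<omega>' \<in> cells C 3" using \<omega> by (simp add: \<omega>'_def C_cells ops_simps)
  moreover have "act C 3 [0, 1, 2] \<omega>' = act C 3 [0, 1, 3] (act C 4 [0, 1, 2, 3] \<omega>)"
    "act C 3 [0, 2, 3] \<omega>' = act C 3 [0, 2, 3] (act C 4 [0, 2, 3, 4] \<omega>)"
    "act C 3 [1, 2, 3] \<omega>' = act C 3 [0, 2, 3] (act C 4 [1, 2, 3, 4] \<omega>)"
    "act C 3 [0, 1, 3] \<omega>' = act C 3 [0, 1, 3] (act C 4 [0, 1, 2, 4] \<omega>)"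
    using \<omega>(1) by (simp_all add: \<omega>'_def C_act ops_simps)
  ultimately show ?thesis using \<omega> a1 d1 \<tau> \<rho> by (metis D_def)
qed

text \<open>A composite of \<open>m\<close> and \<open>B\<close> is some map from \<open>x\<close>
  to \<open>u\<close>, not necessarily \<open>A\<close>. Contractibility gives a homotopy
  \<open>e\<close> from \<open>A\<close> to it, and a 3-simplex with vertices
  \<open>x, x, y, u\<close> glues \<open>e\<close> to the composition triangle. A degenerate
  triangle on \<open>m\<close> as third face ensures that the new triangle still starts with
  \<open>m\<close>.\<close>

lemma lift_vertex:
  assumes sub: "subfinal (qc_homs C) u"
    and A: "A \<in> cells C 1" "act C 1 [1] A = u" and B: "B \<in> cells C 1" "act C 1 [1] B = u"
    and m: "m \<in> cells C 1" "act C 1 [0] m = act C 1 [0] A" "act C 1 [1] m = act C 1 [0] B"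
  shows "\<exists>F\<in>cells C 2. act C 2 [0, 1] F = m \<and> act C 2 [0, 2] F = A \<and> act C 2 [1, 2] F = B"
proof -
  define x where "x = act C 1 [0] A"
  have x: "x \<in> cells C 0" using A by (simp add: x_def C_cells ops_simps)
  have A': "A \<in> cells (hom_right C x u) 0" using hom_right_0[OF x] A by (simp add: x_def)
  then have con: "contractible (hom_right C x u)"
    using sub x unfolding subfinal_def qc_homs_def by auto
  obtain \<sigma> where \<sigma>: "\<sigma> \<in> cells C 2" "act C 2 [0, 1] \<sigma> = m" "act C 2 [1, 2] \<sigma> = B"
    using fill_horn_2_1[of m B] m B by auto
  have "act C 2 [0, 2] \<sigma> \<in> cells C 1"
    "act C 1 [0] (act C 2 [0, 2] \<sigma>) = act C 1 [0] (act C 2 [0, 1] \<sigma>)"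
    "act C 1 [1] (act C 2 [0, 2] \<sigma>) = act C 1 [1] (act C 2 [1, 2] \<sigma>)"
    using \<sigma>(1) by (simp_all add: C_act C_cells ops_simps)
  then have "act C 2 [0, 2] \<sigma> \<in> cells (hom_right C x u) 0"
    using hom_right_0[OF x] \<sigma> m B by (simp add: x_def)
  then have "edge (hom_right C x u) A (act C 2 [0, 2] \<sigma>)"
    using contractible_edge[OF con A'] by blast
  then obtain e where e: "e \<in> cells C 2" "act C 2 [0, 1] e = act C 0 [0, 0] x"
      "act C 2 [0, 2] e = A" "act C 2 [1, 2] e = act C 2 [0, 2] \<sigma>"
    by (auto simp: edge_hom_right)
  define c where "c = act C 1 [0, 0, 1] m"
  have c: "c \<in> cells C 2" "act C 2 [1, 2] c = m" "act C 2 [0, 2] c = m"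
    "act C 2 [0, 1] c = act C 0 [0, 0] (act C 1 [0] m)"
    using m(1) C_id(2)[OF m(1)] by (simp_all add: c_def C_act C_cells ops_simps)
  obtain \<tau> where \<tau>: "\<tau> \<in> cells C 3" "act C 3 [1, 2, 3] \<tau> = \<sigma>" "act C 3 [0, 1, 3] \<tau> = e"
      "act C 3 [0, 1, 2] \<tau> = c"
    using fill_horn_3_1[of \<sigma> e c] \<sigma> e c m by (auto simp: x_def)
  define F where "F = act C 3 [0, 2, 3] \<tau>"
  have "F \<in> cells C 2" using \<tau> by (simp add: F_def C_cells ops_simps)
  moreover have "act C 2 [0, 1] F = act C 2 [0, 2] (act C 3 [0, 1, 2] \<tau>)"
    "act C 2 [0, 2] F = act C 2 [0, 2] (act C 3 [0, 1, 3] \<tau>)"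
    "act C 2 [1, 2] F = act C 2 [1, 2] (act C 3 [1, 2, 3] \<tau>)"
    using \<tau>(1) by (simp_all add: F_def C_act ops_simps)
  ultimately show ?thesis using \<tau> c e \<sigma> by metis
qed

end

section \<open>The filter quotient of a quasi-category\<close>

lemma ops_snoc: "\<theta> \<in> ops m n \<Longrightarrow> \<theta> @ [Suc n] \<in> ops (Suc m) (Suc n)"
  by (auto simp: ops_def sorted_append)

lemma over_cells:
  assumes X: "simplicial_set X" and x: "x \<in> cells (over X v) n" and \<theta>: "\<theta> \<in> ops m n"
  shows "act (over X v) n \<theta> x \<in> cells (over X v) m"
proof -
  have x': "x \<in> cells X (Suc n)" "act X (Suc n) [Suc n] x = v" using x by (auto simp: over_def)
  have "act X (Suc m) [Suc m] (act X (Suc n) (\<theta> @ [Suc n]) x) = act X (Suc n) [Suc n] x"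
    using simplicial_set_act_act[OF X x'(1) ops_snoc[OF \<theta>], of "[Suc m]"] \<theta>
    by (auto simp: ops_def ocomp_def nth_append)
  then show ?thesis
    using x' simplicial_set_cells[OF X x'(1) ops_snoc[OF \<theta>]] by (simp add: over_def)
qed

locale quasi_cat_filter = quasi_cat C for C :: "'a sset" +
  fixes \<Phi> :: "'a set set" and rep :: "'a set \<Rightarrow> 'a" and T :: "'a set \<Rightarrow> 'a set \<Rightarrow> nat \<Rightarrow> 'a \<Rightarrow> 'a"
  assumes pcf: "product_closed_filter (qc_homs C) (qc_product C) \<Phi>"
    and filter_diagram: "qc_filter_diagram C \<Phi> rep T"

sublocale quasi_cat_filter \<subseteq> final_filter "qc_homs C" "qc_product C" \<Phi>
proof
  show "product_closed_filter (qc_homs C) (qc_product C) \<Phi>" by (rule pcf)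
  fix x y z assume x: "x \<in> obj (qc_homs C)"
  then have x0: "x \<in> cells C 0" by (simp add: qc_homs_def)
  then have "act C 0 [0, 0] x \<in> cells (maps (qc_homs C) x x) 0"
    using C_id(1)[OF x0] by (simp add: qc_homs_def hom_right_0 C_act C_cells ops_simps)
  then show "cells (maps (qc_homs C) x x) 0 \<noteq> {}" by blast
  assume y: "y \<in> obj (qc_homs C)" and "cells (maps (qc_homs C) x y) 0 \<noteq> {}"
    and "cells (maps (qc_homs C) y z) 0 \<noteq> {}"
  then obtain f g where "f \<in> cells (hom_right C x y) 0" "g \<in> cells (hom_right C y z) 0"
    by (auto simp: qc_homs_def)
  then have fg: "f \<in> cells C 1" "act C 1 [0] f = x" "act C 1 [1] f = y"
    "g \<in> cells C 1" "act C 1 [0] g = y" "act C 1 [1] g = z"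
    using hom_right_0[OF x0] hom_right_0[of y] y by (simp_all add: qc_homs_def)
  obtain \<sigma> where \<sigma>: "\<sigma> \<in> cells C 2" "act C 2 [0, 1] \<sigma> = f" "act C 2 [1, 2] \<sigma> = g"
    using fill_horn_2_1[of f g] fg by auto
  have "act C 2 [0, 2] \<sigma> \<in> cells C 1"
    "act C 1 [0] (act C 2 [0, 2] \<sigma>) = act C 1 [0] (act C 2 [0, 1] \<sigma>)"
    "act C 1 [1] (act C 2 [0, 2] \<sigma>) = act C 1 [1] (act C 2 [1, 2] \<sigma>)"
    using \<sigma>(1) by (simp_all add: C_act C_cells ops_simps)
  then have "act C 2 [0, 2] \<sigma> \<in> cells (maps (qc_homs C) x z) 0"
    using x0 fg \<sigma> by (simp add: qc_homs_def hom_right_0)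
  then show "cells (maps (qc_homs C) x z) 0 \<noteq> {}" by blast
next
  fix a b r assume "qc_product C a b r"
  then obtain p q where pq: "p \<in> cells C 1" "q \<in> cells C 1" "act C 1 [1] p = a" "act C 1 [1] q = b"
    "act C 1 [0] p = act C 1 [0] q" "act C 1 [0] p = r"
    by (auto simp: qc_product_def qc_product_cone_def final_object_def qc_homs_def pair_cones_def
        eval_nat_numeral)
  then have "r \<in> cells C 0" by (auto simp: C_cells ops_simps)
  then show "cells (maps (qc_homs C) r a) 0 \<noteq> {} \<and> cells (maps (qc_homs C) r b) 0 \<noteq> {}"
    using pq hom_right_0 by (auto simp: qc_homs_def)
qed

context quasi_cat_filter
begin

abbreviation le :: "'a set \<Rightarrow> 'a set \<Rightarrow> bool" where "le \<equiv> sub_le (qc_homs C)"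

abbreviation top1 :: "'a set" where "top1 \<equiv> sub_top (qc_homs C)"

abbreviation slice :: "'a set \<Rightarrow> 'a sset" where "slice p \<equiv> over C (rep p)"

abbreviation cls :: "nat \<Rightarrow> 'a set \<Rightarrow> 'a \<Rightarrow> ('a set \<times> 'a) set" where "cls \<equiv> qc_class C \<Phi> rep T"

abbreviation quot :: "('a set \<times> 'a) set sset" where "quot \<equiv> qc_filter_quotient C \<Phi> rep T"

lemma T_map: "\<lbrakk>p \<in> \<Phi>; q \<in> \<Phi>; le q p\<rbrakk> \<Longrightarrow> simp_map (slice p) (slice q) (T p q)"
  using filter_diagram by (simp add: qc_filter_diagram_def qc_times_functor_def)

lemma T_cells: "\<lbrakk>p \<in> \<Phi>; q \<in> \<Phi>; le q p; x \<in> cells (slice p) n\<rbrakk> \<Longrightarrow> T p q n x \<in> cells (slice q) n"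
  using T_map by (simp add: simp_map_def)

lemma T_act: "\<lbrakk>p \<in> \<Phi>; q \<in> \<Phi>; le q p; x \<in> cells (slice p) n; \<theta> \<in> ops m n\<rbrakk>
    \<Longrightarrow> T p q m (act (slice p) n \<theta> x) = act (slice q) n \<theta> (T p q n x)"
  using T_map unfolding simp_map_def by blast

lemma T_diagram: "diagram (\<lambda>p. cells (slice p) n) (\<lambda>p q. T p q n)"
  using filter_diagram by (simp add: diagram_def qc_filter_diagram_def T_cells)

lemma T_comp: "\<lbrakk>p \<in> \<Phi>; q \<in> \<Phi>; r \<in> \<Phi>; le q p; le r q; x \<in> cells (slice p) n\<rbrakk>
    \<Longrightarrow> T q r n (T p q n x) = T p r n x"
  using diagram_comp[OF T_diagram] by blast

lemma cls_eq: "cls n = colim_class \<Phi> le (\<lambda>p. cells (slice p) n) (\<lambda>p q. T p q n)"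
  by (simp add: qc_class_def sset_colim_class_def fun_eq_iff)

lemma quot_act:
  assumes p: "p \<in> \<Phi>" "x \<in> cells (slice p) n" and \<theta>: "\<theta> \<in> ops m n"
  shows "act quot n \<theta> (cls n p x) = cls m p (act (slice p) n \<theta> x)"
  unfolding qc_filter_quotient_def qc_class_def
  by (rule sset_colim_act[OF T_diagram _ _ \<theta> p])
    (use over_cells[OF simplicial] T_act \<theta> in auto)

lemma quot_cells: "cells quot n = {cls n p x | p x. p \<in> \<Phi> \<and> x \<in> cells (slice p) n}"
  by (simp add: qc_filter_quotient_def sset_colim_def colim_set_def cls_eq)

lemma cls_push:
  "\<lbrakk>p \<in> \<Phi>; q \<in> \<Phi>; le q p; x \<in> cells (slice p) n\<rbrakk> \<Longrightarrow> cls n q (T p q n x) = cls n p x"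
  unfolding cls_eq by (rule class_push[OF T_diagram])

context
  fixes X Y assumes X: "X \<in> cells (slice top1) 0" and Y: "Y \<in> cells (slice top1) 0"
begin

abbreviation stage :: "'a set \<Rightarrow> 'a sset" where
  "stage p \<equiv> hom_right (slice p) (qc_times C T X p) (qc_times C T Y p)"

lemma times_cells: "p \<in> \<Phi> \<Longrightarrow> qc_times C T X p \<in> cells (slice p) 0"
    "p \<in> \<Phi> \<Longrightarrow> qc_times C T Y p \<in> cells (slice p) 0"
  using T_cells[OF top_in _ le_top] X Y by (simp_all add: qc_times_def)

lemma times_T: "\<lbrakk>p \<in> \<Phi>; q \<in> \<Phi>; le q p\<rbrakk> \<Longrightarrow> T p q 0 (qc_times C T X p) = qc_times C T X q"
    "\<lbrakk>p \<in> \<Phi>; q \<in> \<Phi>; le q p\<rbrakk> \<Longrightarrow> T p q 0 (qc_times C T Y p) = qc_times C T Y q"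
  using T_comp[OF top_in _ _ le_top] X Y by (simp_all add: qc_times_def)

lemma cls_times: "p \<in> \<Phi> \<Longrightarrow> cls 0 p (qc_times C T X p) = qc_P C \<Phi> rep T 0 X"
    "p \<in> \<Phi> \<Longrightarrow> cls 0 p (qc_times C T Y p) = qc_P C \<Phi> rep T 0 Y"
  using cls_push[OF top_in _ le_top] X Y by (simp_all add: qc_times_def qc_P_def)

lemma edge_stage: "edge (stage p) F G \<longleftrightarrow>
    (\<exists>\<sigma>\<in>cells (slice p) 2. act (slice p) 2 [2] \<sigma> = qc_times C T Y p \<and>
       act (slice p) 2 [0, 1] \<sigma> = act (slice p) 0 [0, 0] (qc_times C T X p) \<and>
       act (slice p) 2 [0, 2] \<sigma> = F \<and> act (slice p) 2 [1, 2] \<sigma> = G)"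
  by (auto simp: edge_def hom_right_def cst_def eval_nat_numeral)

lemma edge_quot: "edge (qc_filter_maps C \<Phi> rep T X Y) f g \<longleftrightarrow>
    (\<exists>e\<in>cells quot 2. act quot 2 [2] e = qc_P C \<Phi> rep T 0 Y \<and>
       act quot 2 [0, 1] e = act quot 0 [0, 0] (qc_P C \<Phi> rep T 0 X) \<and>
       act quot 2 [0, 2] e = f \<and> act quot 2 [1, 2] e = g)"
  by (auto simp: edge_def qc_filter_maps_def hom_right_def cst_def eval_nat_numeral)

lemma triangle_ops: "[2] \<in> ops 0 2" "[0, 1] \<in> ops 1 2" "[0, 2] \<in> ops 1 2" "[1, 2] \<in> ops 1 2"
    "[0, 0] \<in> ops 1 0"
  by (simp_all add: ops_simps)

text \<open>In degree one, forming mapping spaces commutes with the colimit. A triangle of the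
  quotient is represented in a single slice, but the conditions on its last vertex and its initial
  edge are equations between classes. Each of them becomes a true equation at some stage,
  \<open>r1\<close> and \<open>r2\<close>, and a common lower bound realises both.\<close>

lemma edge_quot_iff: "edge (qc_filter_maps C \<Phi> rep T X Y) f g \<longleftrightarrow>
    (\<exists>r\<in>\<Phi>. \<exists>F G. edge (stage r) F G \<and> f = cls 1 r F \<and> g = cls 1 r G)"
proof
  assume "edge (qc_filter_maps C \<Phi> rep T X Y) f g"
  then obtain e where e: "e \<in> cells quot 2" "act quot 2 [2] e = qc_P C \<Phi> rep T 0 Y"
       "act quot 2 [0, 1] e = act quot 0 [0, 0] (qc_P C \<Phi> rep T 0 X)"
       "act quot 2 [0, 2] e = f" "act quot 2 [1, 2] e = g"
    by (auto simp: edge_quot)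
  then obtain p \<sigma> where p: "p \<in> \<Phi>" and \<sigma>: "\<sigma> \<in> cells (slice p) 2" "e = cls 2 p \<sigma>"
    by (auto simp: quot_cells)
  note a = quot_act[OF p \<sigma>(1)] and c = over_cells[OF simplicial]
  have "cls 0 p (act (slice p) 2 [2] \<sigma>) = cls 0 p (qc_times C T Y p)"
    using e(2) a[OF triangle_ops(1)] cls_times(2)[OF p] \<sigma>(2) by simp
  then obtain r1 where r1: "r1 \<in> \<Phi>" "le r1 p"
      "T p r1 0 (act (slice p) 2 [2] \<sigma>) = T p r1 0 (qc_times C T Y p)"
    unfolding cls_eq
    using class_eq_iff[OF T_diagram p c[OF \<sigma>(1) triangle_ops(1)] p times_cells(2)[OF p]] by auto
  have "cls 1 p (act (slice p) 2 [0, 1] \<sigma>) = act quot 0 [0, 0] (cls 0 p (qc_times C T X p))"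
    using e(3) a[OF triangle_ops(2)] cls_times(1)[OF p] \<sigma>(2) by simp
  also have "\<dots> = cls 1 p (act (slice p) 0 [0, 0] (qc_times C T X p))"
    by (rule quot_act[OF p times_cells(1)[OF p] triangle_ops(5)])
  finally obtain r2 where r2: "r2 \<in> \<Phi>" "le r2 p"
      "T p r2 1 (act (slice p) 2 [0, 1] \<sigma>) = T p r2 1 (act (slice p) 0 [0, 0] (qc_times C T X p))"
    unfolding cls_eq
    using class_eq_iff[OF T_diagram p c[OF \<sigma>(1) triangle_ops(2)] p
        c[OF times_cells(1)[OF p] triangle_ops(5)]] by auto
  obtain r where r: "r \<in> \<Phi>" "le r r1" "le r r2" using lower_bound r1 r2 by blast
  have rp: "le r p" using le_trans p r1 r by blast
  note Ta = T_act[OF p r(1) rp]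
  have "act (slice r) 2 [2] (T p r 2 \<sigma>) = T r1 r 0 (T p r1 0 (act (slice p) 2 [2] \<sigma>))"
    using Ta[OF \<sigma>(1) triangle_ops(1)] T_comp[OF p r1(1) r(1) r1(2) r(2) c[OF \<sigma>(1) triangle_ops(1)]]
    by simp
  also have "\<dots> = T p r 0 (qc_times C T Y p)"
    using r1(3) T_comp[OF p r1(1) r(1) r1(2) r(2) times_cells(2)[OF p]] by simp
  also have "\<dots> = qc_times C T Y r" by (rule times_T(2)[OF p r(1) rp])
  finally have 1: "act (slice r) 2 [2] (T p r 2 \<sigma>) = qc_times C T Y r" .
  have "act (slice r) 2 [0, 1] (T p r 2 \<sigma>) = T r2 r 1 (T p r2 1 (act (slice p) 2 [0, 1] \<sigma>))"
    using Ta[OF \<sigma>(1) triangle_ops(2)] T_comp[OF p r2(1) r(1) r2(2) r(3) c[OF \<sigma>(1) triangle_ops(2)]]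
    by simp
  also have "\<dots> = T p r 1 (act (slice p) 0 [0, 0] (qc_times C T X p))"
    using r2(3) T_comp[OF p r2(1) r(1) r2(2) r(3) c[OF times_cells(1)[OF p] triangle_ops(5)]] by simp
  also have "\<dots> = act (slice r) 0 [0, 0] (qc_times C T X r)"
    using Ta[OF times_cells(1)[OF p] triangle_ops(5)] times_T(1)[OF p r(1) rp] by simp
  finally have 2: "act (slice r) 2 [0, 1] (T p r 2 \<sigma>) = act (slice r) 0 [0, 0] (qc_times C T X r)" .
  have s: "T p r 2 \<sigma> \<in> cells (slice r) 2" "e = cls 2 r (T p r 2 \<sigma>)"
    using T_cells[OF p r(1) rp \<sigma>(1)] cls_push[OF p r(1) rp \<sigma>(1)] \<sigma>(2) by simp_all
  have "edge (stage r) (act (slice r) 2 [0, 2] (T p r 2 \<sigma>)) (act (slice r) 2 [1, 2] (T p r 2 \<sigma>))"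
    using s 1 2 by (auto simp: edge_stage)
  moreover have "f = cls 1 r (act (slice r) 2 [0, 2] (T p r 2 \<sigma>))"
    "g = cls 1 r (act (slice r) 2 [1, 2] (T p r 2 \<sigma>))"
    using e(4,5) s quot_act[OF r(1) s(1)] triangle_ops by simp_all
  ultimately show "\<exists>r\<in>\<Phi>. \<exists>F G. edge (stage r) F G \<and> f = cls 1 r F \<and> g = cls 1 r G"
    using r(1) by blast
next
  assume "\<exists>r\<in>\<Phi>. \<exists>F G. edge (stage r) F G \<and> f = cls 1 r F \<and> g = cls 1 r G"
  then obtain r \<sigma> where r: "r \<in> \<Phi>" and \<sigma>: "\<sigma> \<in> cells (slice r) 2"
    "act (slice r) 2 [2] \<sigma> = qc_times C T Y r"
    "act (slice r) 2 [0, 1] \<sigma> = act (slice r) 0 [0, 0] (qc_times C T X r)"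
    "f = cls 1 r (act (slice r) 2 [0, 2] \<sigma>)" "g = cls 1 r (act (slice r) 2 [1, 2] \<sigma>)"
    by (auto simp: edge_stage)
  have "cls 2 r \<sigma> \<in> cells quot 2" using r \<sigma> by (auto simp: quot_cells)
  then show "edge (qc_filter_maps C \<Phi> rep T X Y) f g"
    unfolding edge_quot
    by (rule bexI[rotated])
      (use quot_act[OF r \<sigma>(1)] triangle_ops \<sigma> cls_times[OF r]
        quot_act[OF r times_cells(1)[OF r] triangle_ops(5)] in simp)
qed

lemma stage_cells: "F \<in> cells (stage p) 0 \<Longrightarrow> F \<in> cells (slice p) 1"
  by (simp add: hom_right_def)

lemma edge_stage_cells:
  assumes "edge (stage p) F G" shows "F \<in> cells (slice p) 1 \<and> G \<in> cells (slice p) 1"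
  using assms over_cells[OF simplicial _ triangle_ops(3)] over_cells[OF simplicial _ triangle_ops(4)]
  unfolding edge_stage by blast

lemma edge_stage_T:
  assumes p: "p \<in> \<Phi>" "q \<in> \<Phi>" "le q p" and "edge (stage p) F G"
  shows "edge (stage q) (T p q 1 F) (T p q 1 G)"
proof -
  obtain \<sigma> where \<sigma>: "\<sigma> \<in> cells (slice p) 2" "act (slice p) 2 [2] \<sigma> = qc_times C T Y p"
       "act (slice p) 2 [0, 1] \<sigma> = act (slice p) 0 [0, 0] (qc_times C T X p)"
       "act (slice p) 2 [0, 2] \<sigma> = F" "act (slice p) 2 [1, 2] \<sigma> = G"
    using assms(4) by (auto simp: edge_stage)
  note a = T_act[OF p \<sigma>(1)]
  show ?thesis
    unfolding edge_stage
    by (rule bexI[OF _ T_cells[OF p \<sigma>(1)]])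
      (use a[OF triangle_ops(1)] a[OF triangle_ops(2)] a[OF triangle_ops(3)] a[OF triangle_ops(4)]
        T_act[OF p times_cells(1)[OF p(1)] triangle_ops(5)] times_T[OF p] \<sigma> in simp)
qed

lemma stage_components:
  assumes V: "V \<in> \<Phi>" "F \<in> cells (stage V) 0" "G \<in> cells (stage V) 0"
  shows "same_component (qc_filter_maps C \<Phi> rep T X Y) (cls 1 V F) (cls 1 V G) \<longleftrightarrow>
    (\<exists>U\<in>\<Phi>. same_component (stage (sub_meet (qc_product C) V U))
       (T V (sub_meet (qc_product C) V U) 1 F) (T V (sub_meet (qc_product C) V U) 1 G))"
proof -
  note st = stage_cells[OF V(2)] stage_cells[OF V(3)]
  have "equivclp (edge (qc_filter_maps C \<Phi> rep T X Y)) (cls 1 V F) (cls 1 V G) \<longleftrightarrow>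
    (\<exists>r\<in>\<Phi>. le r V \<and> equivclp (edge (stage r)) (T V r 1 F) (T V r 1 G))"
    unfolding cls_eq
  proof (rule colim_components[OF T_diagram V(1) st])
    show "F \<in> cells (slice r) 1 \<and> G \<in> cells (slice r) 1" if "edge (stage r) F G" for r F G
      using edge_stage_cells that .
  qed (use edge_stage_T edge_quot_iff[unfolded cls_eq] in simp_all)
  also have "\<dots> \<longleftrightarrow> (\<exists>U\<in>\<Phi>. equivclp (edge (stage (sub_meet (qc_product C) V U)))
       (T V (sub_meet (qc_product C) V U) 1 F) (T V (sub_meet (qc_product C) V U) 1 G))"
    by (rule ex_meet_iff[OF T_diagram V(1) st, of "\<lambda>r. edge (stage r)"]) (rule edge_stage_T)
  finally show ?thesis unfolding same_component_eq .
qed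

section \<open>Homotopies over a member of the filter and homotopies in the quasi-category\<close>

text \<open>The slice is unwound to simplices of \<open>C\<close>. The condition on the last vertex
  disappears because the edge \<open>[1, 2]\<close>, being the structure map of \<open>Y\<close>,
  already ends at \<open>rep p\<close>.\<close>

lemma stage_0:
  assumes p: "p \<in> \<Phi>"
  shows "F \<in> cells (stage p) 0 \<longleftrightarrow> F \<in> cells C 2 \<and> act C 2 [0, 2] F = qc_times C T X p \<and>
    act C 2 [1, 2] F = qc_times C T Y p" (is "_ \<longleftrightarrow> ?R")
proof -
  have x: "qc_times C T X p \<in> cells C 1" "qc_times C T Y p \<in> cells C 1" "act C 1 [1] (qc_times C T Y p) = rep p"
    using times_cells[OF p] by (auto simp: over_def)
  have "act C 1 [1] (act C 2 [1, 2] F) = act C 2 [2] F" if "F \<in> cells C 2"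
    using that by (simp add: C_act ops_simps)
  moreover have "act C 1 [0, 1] (qc_times C T X p) = qc_times C T X p" using x C_id by simp
  ultimately show ?thesis
    using x(3) by (auto simp: hom_right_def over_def cst_def eval_nat_numeral)
qed

lemma edge_stageI:
  assumes p: "p \<in> \<Phi>" and "\<omega> \<in> cells C 3" "act C 3 [0, 2, 3] \<omega> = F" "act C 3 [1, 2, 3] \<omega> = G"
    "act C 3 [0, 1, 3] \<omega> = act C 1 [0, 0, 1] (qc_times C T X p)" "act C 2 [1, 2] F = qc_times C T Y p"
  shows "edge (stage p) F G"
proof -
  have "act C 1 [1] (qc_times C T Y p) = rep p" using times_cells[OF p] by (auto simp: over_def)
  moreover have "act C 3 [3] \<omega> = act C 1 [1] (act C 2 [1, 2] (act C 3 [0, 2, 3] \<omega>))"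
    "act C 3 [2, 3] \<omega> = act C 2 [1, 2] (act C 3 [0, 2, 3] \<omega>)"
    using assms(2) by (simp_all add: C_act C_cells ops_simps)
  ultimately show ?thesis using assms unfolding edge_stage
    by (intro bexI[of _ \<omega>]) (simp_all add: over_def eval_nat_numeral)
qed

lemma forget_eq: "forget C 0 A = act C 1 [0] A" "forget C 1 F = act C 2 [0, 1] F"
  by (simp_all add: forget_def eval_nat_numeral)

text \<open>A homotopy over \<open>rep p\<close> is a 3-simplex of \<open>C\<close>; its face
  opposite to the vertex \<open>rep p\<close> is a homotopy between the underlying maps.\<close>

lemma forget_edge:
  assumes p: "p \<in> \<Phi>" and "edge (stage p) F G"
  shows "edge (hom_right C (forget C 0 (qc_times C T X p)) (forget C 0 (qc_times C T Y p)))
    (forget C 1 F) (forget C 1 G)"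
proof -
  obtain \<omega> where \<omega>: "\<omega> \<in> cells C 3" "act C 3 [2, 3] \<omega> = qc_times C T Y p"
      "act C 3 [0, 1, 3] \<omega> = act C 1 [0, 0, 1] (qc_times C T X p)"
      "act C 3 [0, 2, 3] \<omega> = F" "act C 3 [1, 2, 3] \<omega> = G"
    using assms(2) unfolding edge_stage by (auto simp: over_def eval_nat_numeral)
  have X': "qc_times C T X p \<in> cells C 1" using times_cells[OF p] by (auto simp: over_def)
  have "act C 2 [0, 1] (act C 1 [0, 0, 1] (qc_times C T X p)) = act C 0 [0, 0] (act C 1 [0] (qc_times C T X p))"
    using X' by (simp add: C_act ops_simps)
  moreover have "act C 2 [0, 1] (act C 3 [0, 1, 2] \<omega>) = act C 2 [0, 1] (act C 3 [0, 1, 3] \<omega>)"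
    "act C 2 [0, 2] (act C 3 [0, 1, 2] \<omega>) = act C 2 [0, 1] (act C 3 [0, 2, 3] \<omega>)"
    "act C 2 [1, 2] (act C 3 [0, 1, 2] \<omega>) = act C 2 [0, 1] (act C 3 [1, 2, 3] \<omega>)"
    "act C 2 [2] (act C 3 [0, 1, 2] \<omega>) = act C 1 [0] (act C 3 [2, 3] \<omega>)"
    "act C 3 [0, 1, 2] \<omega> \<in> cells C 2"
    using \<omega>(1) by (simp_all add: C_act C_cells ops_simps)
  ultimately show ?thesis
    using \<omega> unfolding edge_hom_right forget_eq by auto
qed

text \<open>The direction from \<open>C\<close> back to the slice is \<open>equivclp_lift\<close>
  along the restriction of a triangle to its edge \<open>[0, 1]\<close>: \<open>lift_vertex\<close>
  provides surjectivity, \<open>lift_edge\<close> lifts homotopies, and degenerate triangles are the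
  reflexive edges. Both lifting lemmas rest on \<open>rep p\<close> being a subobject of the final
  object.\<close>

lemma forget_components:
  assumes p: "p \<in> \<Phi>" and FG: "F \<in> cells (stage p) 0" "G \<in> cells (stage p) 0"
  shows "same_component (stage p) F G \<longleftrightarrow>
    same_component (hom_right C (forget C 0 (qc_times C T X p)) (forget C 0 (qc_times C T Y p)))
      (forget C 1 F) (forget C 1 G)"
proof
  assume "same_component (stage p) F G"
  then show "same_component (hom_right C (forget C 0 (qc_times C T X p)) (forget C 0 (qc_times C T Y p)))
      (forget C 1 F) (forget C 1 G)"
    unfolding same_component_eq by (rule equivclp_map) (use forget_edge p in blast)
next
  define A B where "A = qc_times C T X p" and "B = qc_times C T Y p"
  have A: "A \<in> cells C 1" "act C 1 [1] A = rep p" and B: "B \<in> cells C 1" "act C 1 [1] B = rep p"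
    using times_cells[OF p] by (auto simp: over_def A_def B_def)
  have sub: "subfinal (qc_homs C) (rep p)"
    using member_subfinal[OF p] filter_diagram p by (auto simp: qc_filter_diagram_def)
  have stage_0: "F \<in> cells (stage p) 0 \<longleftrightarrow>
      F \<in> cells C 2 \<and> act C 2 [0, 2] F = A \<and> act C 2 [1, 2] F = B" for F
    unfolding A_def B_def by (rule stage_0[OF p])
  \<comment> \<open>A zigzag in \<open>C\<close> may pass through any morphism between the
    underlying objects, so all of them have to be lifted to triangles over
    \<open>rep p\<close>.\<close>
  define S where "S = {m \<in> cells C 1. act C 1 [0] m = act C 1 [0] A \<and> act C 1 [1] m = act C 1 [0] B}"
  assume "same_component (hom_right C (forget C 0 (qc_times C T X p)) (forget C 0 (qc_times C T Y p)))
      (forget C 1 F) (forget C 1 G)"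
  then have "equivclp (edge (hom_right C (act C 1 [0] A) (act C 1 [0] B)))
     (act C 2 [0, 1] F) (act C 2 [0, 1] G)"
    by (simp only: forget_eq same_component_eq A_def B_def)
  then show "same_component (stage p) F G"
    unfolding same_component_eq
  proof (rule equivclp_lift[OF _ FG, where S = S])
    fix m m' assume "edge (hom_right C (act C 1 [0] A) (act C 1 [0] B)) m m'"
    then obtain \<sigma> where \<sigma>: "\<sigma> \<in> cells C 2" "act C 2 [0, 1] \<sigma> = act C 0 [0, 0] (act C 1 [0] A)"
      "act C 2 [2] \<sigma> = act C 1 [0] B" "m = act C 2 [0, 2] \<sigma>" "m' = act C 2 [1, 2] \<sigma>"
      by (auto simp: edge_hom_right)
    have "act C 1 [0] (act C 0 [0, 0] (act C 1 [0] A)) = act C 1 [0] A"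
      "act C 1 [1] (act C 0 [0, 0] (act C 1 [0] A)) = act C 1 [0] A"
      using A by (simp_all add: C_act C_cells ops_simps)
    moreover have "act C 1 [0] (act C 2 [0, 2] \<sigma>) = act C 1 [0] (act C 2 [0, 1] \<sigma>)"
      "act C 1 [0] (act C 2 [1, 2] \<sigma>) = act C 1 [1] (act C 2 [0, 1] \<sigma>)"
      "act C 1 [1] (act C 2 [0, 2] \<sigma>) = act C 2 [2] \<sigma>" "act C 1 [1] (act C 2 [1, 2] \<sigma>) = act C 2 [2] \<sigma>"
      "act C 2 [0, 2] \<sigma> \<in> cells C 1" "act C 2 [1, 2] \<sigma> \<in> cells C 1"
      using \<sigma>(1) by (simp_all add: C_act C_cells ops_simps)
    ultimately show "m \<in> S \<and> m' \<in> S" using \<sigma> by (simp add: S_def)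
  next
    fix F assume "F \<in> cells (stage p) 0"
    then have F: "F \<in> cells C 2" "act C 2 [0, 2] F = A" "act C 2 [1, 2] F = B" by (simp_all add: stage_0)
    define m where "m = act C 2 [0, 1] F"
    have "m \<in> cells C 1" "act C 1 [0] m = act C 1 [0] (act C 2 [0, 2] F)"
      "act C 1 [1] m = act C 1 [0] (act C 2 [1, 2] F)"
      using F(1) by (simp_all add: m_def C_act C_cells ops_simps)
    then have m: "m \<in> cells C 1" "act C 1 [0] m = act C 1 [0] A" "act C 1 [1] m = act C 1 [0] B"
      using F by simp_all
    define c where "c = act C 1 [0, 0, 1] m"
    have "c \<in> cells C 2" "act C 2 [0, 1] c = act C 0 [0, 0] (act C 1 [0] m)"
      "act C 2 [2] c = act C 1 [1] m" "act C 2 [0, 2] c = m" "act C 2 [1, 2] c = m"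
      using m(1) C_id(2)[OF m(1)] by (simp_all add: c_def C_act C_cells ops_simps)
    then show "edge (hom_right C (act C 1 [0] A) (act C 1 [0] B)) (act C 2 [0, 1] F) (act C 2 [0, 1] F)"
      using m unfolding edge_hom_right m_def[symmetric] by auto
  next
    fix m assume "m \<in> S"
    then show "\<exists>F\<in>cells (stage p) 0. act C 2 [0, 1] F = m"
      using lift_vertex[OF sub A B, of m] by (auto simp: S_def stage_0)
  next
    fix F G assume F: "F \<in> cells (stage p) 0" and G: "G \<in> cells (stage p) 0"
      and "edge (hom_right C (act C 1 [0] A) (act C 1 [0] B)) (act C 2 [0, 1] F) (act C 2 [0, 1] G)"
    then obtain \<sigma> where \<sigma>: "\<sigma> \<in> cells C 2" "act C 2 [0, 1] \<sigma> = act C 0 [0, 0] (act C 1 [0] A)"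
      "act C 2 [0, 2] \<sigma> = act C 2 [0, 1] F" "act C 2 [1, 2] \<sigma> = act C 2 [0, 1] G"
      by (auto simp: edge_hom_right)
    then obtain \<omega> where "\<omega> \<in> cells C 3" "act C 3 [0, 2, 3] \<omega> = F" "act C 3 [1, 2, 3] \<omega> = G"
      "act C 3 [0, 1, 3] \<omega> = act C 1 [0, 0, 1] A"
      using lift_edge[OF sub A, of F B G \<sigma>] F G by (auto simp: stage_0)
    then have "edge (stage p) F G"
      using edge_stageI[OF p] F by (simp add: A_def stage_0 B_def)
    then show "equivclp (edge (stage p)) F G" by blast
  qed
qed

lemma stage_T_cells:
  assumes p: "p \<in> \<Phi>" "q \<in> \<Phi>" "le q p" and F: "F \<in> cells (stage p) 0"
  shows "T p q 1 F \<in> cells (stage q) 0"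
proof -
  have ops: "[0] \<in> ops 0 1" "[1] \<in> ops 0 1" "[0] \<in> ops 0 0" by (simp_all add: ops_simps)
  have "F \<in> cells (slice p) 1" "act (slice p) 1 [1] F = qc_times C T Y p"
    "act (slice p) 1 [0] F = act (slice p) 0 [0] (qc_times C T X p)"
    using F by (auto simp: hom_right_def cst_def)
  then show ?thesis
    using T_act[OF p _ ops(1), of F] T_act[OF p _ ops(2), of F]
      T_act[OF p times_cells(1)[OF p(1)] ops(3)] times_T[OF p] T_cells[OF p, of F 1]
    by (simp add: hom_right_def cst_def)
qed

lemma quasi_category_components:
  assumes V: "V \<in> \<Phi>" "F \<in> cells (stage V) 0" "G \<in> cells (stage V) 0"
  shows "same_component (qc_filter_maps C \<Phi> rep T X Y) (cls 1 V F) (cls 1 V G) \<longleftrightarrow>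
    (\<exists>U\<in>\<Phi>. same_component
       (hom_right C (forget C 0 (qc_times C T X (sub_meet (qc_product C) V U)))
                    (forget C 0 (qc_times C T Y (sub_meet (qc_product C) V U))))
       (qc_times_id C T V U F) (qc_times_id C T V U G))"
  unfolding stage_components[OF V] qc_times_id_def
  using forget_components meet_in[OF V(1)] stage_T_cells[OF V(1) meet_in meet_le(1)] V by simp

end

end


section \<open>Kan enriched categories\<close>

locale kan_cat =
  fixes K :: "('o, 'm) enriched"
  assumes kan_enriched: "kan_enriched_category K"
begin

abbreviation hom :: "'o \<Rightarrow> 'o \<Rightarrow> 'm set" where "hom X Y \<equiv> cells (maps K X Y) 0"

abbreviation comp :: "'o \<Rightarrow> 'o \<Rightarrow> 'o \<Rightarrow> 'm \<Rightarrow> 'm \<Rightarrow> 'm" where "comp X Y Z \<equiv> kcomp K X Y Z 0"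

abbreviation homotopic :: "'o \<Rightarrow> 'o \<Rightarrow> 'm \<Rightarrow> 'm \<Rightarrow> bool" where
  "homotopic X Y \<equiv> equivclp (edge (maps K X Y))"

lemma maps_simplicial: "\<lbrakk>X \<in> obj K; Y \<in> obj K\<rbrakk> \<Longrightarrow> simplicial_set (maps K X Y)"
  using kan_enriched by (simp add: kan_enriched_category_def kan_complex_def)

lemma kcomp_map: "\<lbrakk>X \<in> obj K; Y \<in> obj K; Z \<in> obj K\<rbrakk> \<Longrightarrow>
    simp_map (sset_prod (maps K Y Z) (maps K X Y)) (maps K X Z) (\<lambda>n (g, f). kcomp K X Y Z n g f)"
  using kan_enriched by (simp add: kan_enriched_category_def)

lemma kcomp_cells: "\<lbrakk>X \<in> obj K; Y \<in> obj K; Z \<in> obj K; g \<in> cells (maps K Y Z) n; f \<in> cells (maps K X Y) n\<rbrakk>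
    \<Longrightarrow> kcomp K X Y Z n g f \<in> cells (maps K X Z) n"
  using kcomp_map[of X Y Z] by (fastforce simp: simp_map_def sset_prod_def)

lemma kcomp_act: "\<lbrakk>X \<in> obj K; Y \<in> obj K; Z \<in> obj K; g \<in> cells (maps K Y Z) n; f \<in> cells (maps K X Y) n;
      \<theta> \<in> ops m n\<rbrakk>
    \<Longrightarrow> act (maps K X Z) n \<theta> (kcomp K X Y Z n g f) =
      kcomp K X Y Z m (act (maps K Y Z) n \<theta> g) (act (maps K X Y) n \<theta> f)"
  using kcomp_map[of X Y Z] by (fastforce simp: simp_map_def sset_prod_def)

lemma kcomp_assoc: "\<lbrakk>A \<in> obj K; X \<in> obj K; Y \<in> obj K; Z \<in> obj K; f \<in> cells (maps K A X) n;
      g \<in> cells (maps K X Y) n; h \<in> cells (maps K Y Z) n\<rbrakk>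
    \<Longrightarrow> kcomp K A Y Z n h (kcomp K A X Y n g f) = kcomp K A X Z n (kcomp K X Y Z n h g) f"
  using kan_enriched by (simp add: kan_enriched_category_def)

lemma kcomp_cst:
  assumes "X \<in> obj K" "Y \<in> obj K" "Z \<in> obj K" "g \<in> hom Y Z" "f \<in> hom X Y"
  shows "kcomp K X Y Z n (cst (maps K Y Z) n g) (cst (maps K X Y) n f) = cst (maps K X Z) n (comp X Y Z g f)"
  unfolding cst_def by (rule kcomp_act[OF assms replicate_ops, symmetric])

text \<open>Whiskering: the edge is composed with the constant edge on \<open>f\<close>, whose two
  vertices are both \<open>f\<close>.\<close>

lemma edge_comp_left:
  assumes o: "X \<in> obj K" "Y \<in> obj K" "Z \<in> obj K" and "edge (maps K Y Z) g g'" and f: "f \<in> hom X Y"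
  shows "edge (maps K X Z) (comp X Y Z g f) (comp X Y Z g' f)"
proof -
  obtain e where e: "e \<in> cells (maps K Y Z) 1" "act (maps K Y Z) 1 [0] e = g" "act (maps K Y Z) 1 [1] e = g'"
    using assms by (auto simp: edge_def)
  have ops: "[0] \<in> ops 0 1" "[1] \<in> ops 0 1" by (simp_all add: ops_simps)
  have s: "simplicial_set (maps K X Y)" using maps_simplicial o by blast
  show ?thesis unfolding edge_def
    using kcomp_cells[OF o e(1) cst_cells[OF s f]] kcomp_act[OF o e(1) cst_cells[OF s f] ops(1)]
      kcomp_act[OF o e(1) cst_cells[OF s f] ops(2)] act_cst[OF s f ops(1)] act_cst[OF s f ops(2)]
      cst_0[OF s f] e by (intro bexI) simp_all
qed

lemma edge_comp_right:
  assumes o: "X \<in> obj K" "Y \<in> obj K" "Z \<in> obj K" and g: "g \<in> hom Y Z" and "edge (maps K X Y) f f'"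
  shows "edge (maps K X Z) (comp X Y Z g f) (comp X Y Z g f')"
proof -
  obtain e where e: "e \<in> cells (maps K X Y) 1" "act (maps K X Y) 1 [0] e = f" "act (maps K X Y) 1 [1] e = f'"
    using assms by (auto simp: edge_def)
  have ops: "[0] \<in> ops 0 1" "[1] \<in> ops 0 1" by (simp_all add: ops_simps)
  have s: "simplicial_set (maps K Y Z)" using maps_simplicial o by blast
  show ?thesis unfolding edge_def
    using kcomp_cells[OF o cst_cells[OF s g] e(1)] kcomp_act[OF o cst_cells[OF s g] e(1) ops(1)]
      kcomp_act[OF o cst_cells[OF s g] e(1) ops(2)] act_cst[OF s g ops(1)] act_cst[OF s g ops(2)]
      cst_0[OF s g] e by (intro bexI) simp_all
qed

lemma homotopic_comp_left:
  assumes "X \<in> obj K" "Y \<in> obj K" "Z \<in> obj K" "homotopic Y Z g g'" "f \<in> hom X Y"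
  shows "homotopic X Z (comp X Y Z g f) (comp X Y Z g' f)"
  using assms(4) by (rule equivclp_map) (use edge_comp_left assms in blast)

lemma homotopic_comp_right:
  assumes "X \<in> obj K" "Y \<in> obj K" "Z \<in> obj K" "g \<in> hom Y Z" "homotopic X Y f f'"
  shows "homotopic X Z (comp X Y Z g f) (comp X Y Z g f')"
  using assms(5) by (rule equivclp_map) (use edge_comp_right assms in blast)

end

section \<open>Strict products with members of the filter\<close>

locale kan_cat_filter = kan_cat K for K :: "('o, 'm) enriched" +
  fixes \<Phi> :: "'o set set" and R :: "('o, 'm) filter_products"
  assumes pcf: "product_closed_filter K (kan_product K) \<Phi>"
    and products: "kan_filter_products K \<Phi> R"

sublocale kan_cat_filter \<subseteq> final_filter K "kan_product K" \<Phi>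
proof
  show "product_closed_filter K (kan_product K) \<Phi>" by (rule pcf)
  fix x y z assume o: "x \<in> obj K"
  then show "hom x x \<noteq> {}"
    using kan_enriched by (auto simp: kan_enriched_category_def)
  assume "y \<in> obj K" "z \<in> obj K" "hom x y \<noteq> {}" "hom y z \<noteq> {}"
  then show "hom x z \<noteq> {}" using kcomp_cells[of x y z _ 0] o by blast
next
  fix a b r assume "kan_product K a b r"
  then show "hom r a \<noteq> {} \<and> hom r b \<noteq> {}" by (auto simp: kan_product_def)
qed

context kan_cat_filter
begin

abbreviation le :: "'o set \<Rightarrow> 'o set \<Rightarrow> bool" where "le \<equiv> sub_le K"

abbreviation tms :: "'o \<Rightarrow> 'o set \<Rightarrow> 'o" where "tms \<equiv> ftimes R"

lemma repr_subfinal: "p \<in> \<Phi> \<Longrightarrow> subfinal K (repr R p)"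
  using products member_subfinal by (auto simp: kan_filter_products_def)

lemma repr_obj: "p \<in> \<Phi> \<Longrightarrow> repr R p \<in> obj K"
  using repr_subfinal by (auto simp: subfinal_def)

text \<open>The vertex \<open>a\<close> excludes the empty alternative in \<open>subfinal\<close>,
  and in the remaining contractible space any two vertices are joined by an edge.\<close>

lemma repr_edge: "\<lbrakk>p \<in> \<Phi>; Z \<in> obj K; a \<in> hom Z (repr R p); b \<in> hom Z (repr R p)\<rbrakk>
    \<Longrightarrow> edge (maps K Z (repr R p)) a b"
  using repr_subfinal[of p] contractible_edge[of "maps K Z (repr R p)" a b]
  by (auto simp: subfinal_def)

lemma incl_hom: "\<lbrakk>p \<in> \<Phi>; q \<in> \<Phi>; le q p\<rbrakk> \<Longrightarrow> incl R q p \<in> hom (repr R q) (repr R p)"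
  using products by (simp add: kan_filter_products_def)

lemma incl_comp: "\<lbrakk>p \<in> \<Phi>; q \<in> \<Phi>; r \<in> \<Phi>; le q p; le r q\<rbrakk>
    \<Longrightarrow> comp (repr R r) (repr R q) (repr R p) (incl R q p) (incl R r q) = incl R r p"
  using products by (simp add: kan_filter_products_def)

context
  fixes X p assumes X: "X \<in> obj K" and p: "p \<in> \<Phi>"
begin

lemma tms_obj: "tms X p \<in> obj K"
  using products X p by (simp add: kan_filter_products_def)

lemma proj_hom: "proj1 R X p \<in> hom (tms X p) X" "proj2 R X p \<in> hom (tms X p) (repr R p)"
  using products X p by (simp_all add: kan_filter_products_def)

context
  fixes Z assumes Z: "Z \<in> obj K"
begin

lemma product_bij:
  "bij_betw (\<lambda>h. (postc K Z (tms X p) X (proj1 R X p) n h,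
                  postc K Z (tms X p) (repr R p) (proj2 R X p) n h))
     (cells (maps K Z (tms X p)) n) (cells (maps K Z X) n \<times> cells (maps K Z (repr R p)) n)"
  using products X p Z by (simp add: kan_filter_products_def)

text \<open>Simplicial operators send constant simplices on the projections to constant simplices,
  so the dimensionwise bijections of \<open>product_bij\<close> form a map of simplicial
  sets.\<close>

lemma postc_act:
  assumes "h \<in> cells (maps K Z (tms X p)) n" "\<theta> \<in> ops m n"
  shows "postc K Z (tms X p) X (proj1 R X p) m (act (maps K Z (tms X p)) n \<theta> h) =
      act (maps K Z X) n \<theta> (postc K Z (tms X p) X (proj1 R X p) n h)"
    and "postc K Z (tms X p) (repr R p) (proj2 R X p) m (act (maps K Z (tms X p)) n \<theta> h) =
      act (maps K Z (repr R p)) n \<theta> (postc K Z (tms X p) (repr R p) (proj2 R X p) n h)"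
proof -
  note s1 = maps_simplicial[OF tms_obj X] and s2 = maps_simplicial[OF tms_obj repr_obj[OF p]]
  show "postc K Z (tms X p) X (proj1 R X p) m (act (maps K Z (tms X p)) n \<theta> h) =
      act (maps K Z X) n \<theta> (postc K Z (tms X p) X (proj1 R X p) n h)"
    using kcomp_act[OF Z tms_obj X cst_cells[OF s1 proj_hom(1)] assms] act_cst[OF s1 proj_hom(1) assms(2)]
    by (simp add: postc_def)
  show "postc K Z (tms X p) (repr R p) (proj2 R X p) m (act (maps K Z (tms X p)) n \<theta> h) =
      act (maps K Z (repr R p)) n \<theta> (postc K Z (tms X p) (repr R p) (proj2 R X p) n h)"
    using kcomp_act[OF Z tms_obj repr_obj[OF p] cst_cells[OF s2 proj_hom(2)] assms]
      act_cst[OF s2 proj_hom(2) assms(2)]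
    by (simp add: postc_def)
qed

lemma product_eqI:
  assumes "h \<in> cells (maps K Z (tms X p)) n" "h' \<in> cells (maps K Z (tms X p)) n"
    and "postc K Z (tms X p) X (proj1 R X p) n h = postc K Z (tms X p) X (proj1 R X p) n h'"
    and "postc K Z (tms X p) (repr R p) (proj2 R X p) n h = postc K Z (tms X p) (repr R p) (proj2 R X p) n h'"
  shows "h = h'"
  using inj_onD[OF bij_betw_imp_inj_on[OF product_bij[of n]] _ assms(1,2)] assms(3,4) by simp

lemma pairing_spec:
  assumes "a \<in> cells (maps K Z X) n" "b \<in> cells (maps K Z (repr R p)) n"
  shows "pairing K R Z X p n a b \<in> cells (maps K Z (tms X p)) n \<and>
    postc K Z (tms X p) X (proj1 R X p) n (pairing K R Z X p n a b) = a \<and>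
    postc K Z (tms X p) (repr R p) (proj2 R X p) n (pairing K R Z X p n a b) = b"
  unfolding pairing_def
proof (rule theI')
  have "(a, b) \<in> (\<lambda>h. (postc K Z (tms X p) X (proj1 R X p) n h,
                  postc K Z (tms X p) (repr R p) (proj2 R X p) n h)) ` cells (maps K Z (tms X p)) n"
    using bij_betw_imp_surj_on[OF product_bij[of n]] assms by simp
  then obtain h where h: "h \<in> cells (maps K Z (tms X p)) n"
    "postc K Z (tms X p) X (proj1 R X p) n h = a" "postc K Z (tms X p) (repr R p) (proj2 R X p) n h = b"
    by auto
  show "\<exists>!h. h \<in> cells (maps K Z (tms X p)) n \<and>
      postc K Z (tms X p) X (proj1 R X p) n h = a \<and>
      postc K Z (tms X p) (repr R p) (proj2 R X p) n h = b"
    by (rule ex1I[of _ h]) (use h in \<open>auto intro: product_eqI\<close>)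
qed

lemma postc_0: "postc K Z (tms X p) X (proj1 R X p) 0 h = comp Z (tms X p) X (proj1 R X p) h"
    "postc K Z (tms X p) (repr R p) (proj2 R X p) 0 h = comp Z (tms X p) (repr R p) (proj2 R X p) h"
  using cst_0[OF maps_simplicial[OF tms_obj X] proj_hom(1)]
    cst_0[OF maps_simplicial[OF tms_obj repr_obj[OF p]] proj_hom(2)] by (simp_all add: postc_def)

lemma pairing_0:
  assumes "a \<in> hom Z X" "b \<in> hom Z (repr R p)"
  shows "pairing K R Z X p 0 a b \<in> hom Z (tms X p)"
    "comp Z (tms X p) X (proj1 R X p) (pairing K R Z X p 0 a b) = a"
    "comp Z (tms X p) (repr R p) (proj2 R X p) (pairing K R Z X p 0 a b) = b"
  using pairing_spec[OF assms] by (simp_all add: postc_0)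

lemma pairing_eta:
  assumes "h \<in> hom Z (tms X p)"
  shows "pairing K R Z X p 0 (comp Z (tms X p) X (proj1 R X p) h)
    (comp Z (tms X p) (repr R p) (proj2 R X p) h) = h"
proof -
  have c: "comp Z (tms X p) X (proj1 R X p) h \<in> hom Z X"
    "comp Z (tms X p) (repr R p) (proj2 R X p) h \<in> hom Z (repr R p)"
    using kcomp_cells Z X tms_obj proj_hom repr_obj[OF p] assms by auto
  show ?thesis
    by (rule product_eqI[OF pairing_0(1)[OF c] assms]) (simp_all only: postc_0 pairing_0[OF c])
qed

text \<open>The product comparison is bijective in dimension 1 as well, so two edges can be paired
  without being changed up to homotopy; the ends of the paired edge are recognised by their
  components.\<close>

lemma pairing_edge:
  assumes "edge (maps K Z X) a a'" "edge (maps K Z (repr R p)) b b'"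
  shows "edge (maps K Z (tms X p)) (pairing K R Z X p 0 a b) (pairing K R Z X p 0 a' b')"
proof -
  obtain d e where d: "d \<in> cells (maps K Z X) 1" "act (maps K Z X) 1 [0] d = a" "act (maps K Z X) 1 [1] d = a'"
    and e: "e \<in> cells (maps K Z (repr R p)) 1" "act (maps K Z (repr R p)) 1 [0] e = b"
      "act (maps K Z (repr R p)) 1 [1] e = b'"
    using assms by (auto simp: edge_def)
  define h where "h = pairing K R Z X p 1 d e"
  have ops: "[0] \<in> ops 0 1" "[1] \<in> ops 0 1" by (simp_all add: ops_simps)
  have h: "h \<in> cells (maps K Z (tms X p)) 1" "postc K Z (tms X p) X (proj1 R X p) 1 h = d"
    "postc K Z (tms X p) (repr R p) (proj2 R X p) 1 h = e"
    using pairing_spec[OF d(1) e(1)] by (simp_all add: h_def)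
  have c: "a \<in> hom Z X" "a' \<in> hom Z X" "b \<in> hom Z (repr R p)" "b' \<in> hom Z (repr R p)"
    using edge_cells[OF maps_simplicial[OF Z X] assms(1)]
      edge_cells[OF maps_simplicial[OF Z repr_obj[OF p]] assms(2)] by simp_all
  note cells = simplicial_set_cells[OF maps_simplicial[OF Z tms_obj] h(1)]
  have "act (maps K Z (tms X p)) 1 [0] h = pairing K R Z X p 0 a b"
    by (rule product_eqI[OF cells[OF ops(1)]])
      (use pairing_spec[OF c(1,3)] postc_act[OF h(1) ops(1)] h d e in simp_all)
  moreover have "act (maps K Z (tms X p)) 1 [1] h = pairing K R Z X p 0 a' b'"
    by (rule product_eqI[OF cells[OF ops(2)]])
      (use pairing_spec[OF c(2,4)] postc_act[OF h(1) ops(2)] h d e in simp_all)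
  ultimately show ?thesis using h(1) by (auto simp: edge_def)
qed

text \<open>The second components are homotopic because \<open>p\<close> is a subobject of the final object.\<close>

lemma homotopic_productI:
  assumes h: "h \<in> hom Z (tms X p)" "h' \<in> hom Z (tms X p)"
    and hom: "homotopic Z X (comp Z (tms X p) X (proj1 R X p) h) (comp Z (tms X p) X (proj1 R X p) h')"
  shows "homotopic Z (tms X p) h h'"
proof -
  let ?f = "comp Z (tms X p) X (proj1 R X p)" and ?g = "comp Z (tms X p) (repr R p) (proj2 R X p)"
  have c: "?f h' \<in> hom Z X" "?g h \<in> hom Z (repr R p)" "?g h' \<in> hom Z (repr R p)"
    using kcomp_cells Z X tms_obj proj_hom repr_obj[OF p] h by auto
  \<comment> \<open>The components are moved one after the other: the first along a zigzag of
    unknown length with the second held constant, then the second along a single edge.\<close>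
  have "homotopic Z (tms X p) (pairing K R Z X p 0 (?f h) (?g h)) (pairing K R Z X p 0 (?f h') (?g h))"
    using hom
  proof (rule equivclp_map)
    fix x y assume "edge (maps K Z X) x y"
    then show "homotopic Z (tms X p) (pairing K R Z X p 0 x (?g h)) (pairing K R Z X p 0 y (?g h))"
      using pairing_edge[OF _ repr_edge[OF p Z c(2) c(2)]] by blast
  qed
  moreover have "edge (maps K Z (tms X p)) (pairing K R Z X p 0 (?f h') (?g h)) (pairing K R Z X p 0 (?f h') (?g h'))"
    by (intro pairing_edge edge_refl maps_simplicial repr_edge c Z X p)
  ultimately show ?thesis
    unfolding pairing_eta[OF h(1)] pairing_eta[OF h(2)]
    by (rule equivclp_trans[OF _ r_into_equivclp])
qed

end

end

lemma times_incl:
  assumes X: "X \<in> obj K" and p: "p \<in> \<Phi>" "q \<in> \<Phi>" "le q p"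
  shows "times_incl K R X q p \<in> hom (tms X q) (tms X p)"
    and "comp (tms X q) (tms X p) X (proj1 R X p) (times_incl K R X q p) = proj1 R X q"
    and "comp (tms X q) (tms X p) (repr R p) (proj2 R X p) (times_incl K R X q p) =
      comp (tms X q) (repr R q) (repr R p) (incl R q p) (proj2 R X q)"
proof -
  note pq = X p(2)
  have "comp (tms X q) (repr R q) (repr R p) (incl R q p) (proj2 R X q) \<in> hom (tms X q) (repr R p)"
    using kcomp_cells[OF tms_obj[OF pq] repr_obj[OF p(2)] repr_obj[OF p(1)] incl_hom[OF p] proj_hom(2)[OF pq]] .
  from pairing_0[OF X p(1) tms_obj[OF pq] proj_hom(1)[OF pq] this]
  show "times_incl K R X q p \<in> hom (tms X q) (tms X p)"
    and "comp (tms X q) (tms X p) X (proj1 R X p) (times_incl K R X q p) = proj1 R X q"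
    and "comp (tms X q) (tms X p) (repr R p) (proj2 R X p) (times_incl K R X q p) =
      comp (tms X q) (repr R q) (repr R p) (incl R q p) (proj2 R X q)"
    by (simp_all add: times_incl_def)
qed

text \<open>Both sides have the same two components: the first is the projection to
  \<open>X\<close>, the second agrees by functoriality of \<open>incl\<close>.\<close>

lemma times_incl_comp:
  assumes X: "X \<in> obj K" and p: "p \<in> \<Phi>" "q \<in> \<Phi>" "r \<in> \<Phi>" "le q p" "le r q"
  shows "comp (tms X r) (tms X q) (tms X p) (times_incl K R X q p) (times_incl K R X r q) =
    times_incl K R X r p"
proof -
  have le: "le r p" using le_trans p by blast
  note o = tms_obj[OF X p(1)] tms_obj[OF X p(2)] tms_obj[OF X p(3)]
  note b = repr_obj[OF p(1)] repr_obj[OF p(2)] repr_obj[OF p(3)]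
  note qp = times_incl[OF X p(1,2,4)] and rq = times_incl[OF X p(2,3,5)]
    and rp = times_incl[OF X p(1,3) le]
  note p1 = proj_hom[OF X p(1)] and p2 = proj_hom[OF X p(2)] and p3 = proj_hom[OF X p(3)]
  note i = incl_hom[OF p(1,2,4)] incl_hom[OF p(2,3,5)]
  have c: "comp (tms X r) (tms X q) (tms X p) (times_incl K R X q p) (times_incl K R X r q)
      \<in> hom (tms X r) (tms X p)"
    by (rule kcomp_cells[OF o(3,2,1) qp(1) rq(1)])
  have "comp (tms X r) (tms X p) (repr R p) (proj2 R X p)
       (comp (tms X r) (tms X q) (tms X p) (times_incl K R X q p) (times_incl K R X r q)) =
    comp (tms X r) (tms X q) (repr R p) (comp (tms X q) (repr R q) (repr R p) (incl R q p) (proj2 R X q))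
      (times_incl K R X r q)"
    using kcomp_assoc[OF o(3,2,1) b(1) rq(1) qp(1) p1(2)] qp(3) by simp
  also have "\<dots> = comp (tms X r) (repr R q) (repr R p) (incl R q p)
      (comp (tms X r) (repr R r) (repr R q) (incl R r q) (proj2 R X r))"
    using kcomp_assoc[OF o(3,2) b(2,1) rq(1) p2(2) i(1)] rq(3) by simp
  also have "\<dots> = comp (tms X r) (repr R r) (repr R p) (incl R r p) (proj2 R X r)"
    using kcomp_assoc[OF o(3) b(3,2,1) p3(2) i(2,1)] incl_comp[OF p] by simp
  finally show ?thesis
    by (intro product_eqI[OF X p(1) o(3) c rp(1)])
      (use kcomp_assoc[OF o(3,2,1) X rq(1) qp(1) p1(1)] qp(2) rq(2) rp in
        \<open>simp_all add: postc_0[OF X p(1) o(3)]\<close>)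
qed

section \<open>Mapping spaces of the Kan enriched filter quotient\<close>

context
  fixes X Y assumes X: "X \<in> obj K" and Y: "Y \<in> obj K"
begin

abbreviation restr :: "'o set \<Rightarrow> 'o set \<Rightarrow> nat \<Rightarrow> 'm \<Rightarrow> 'm" where
  "restr p q \<equiv> prec K (tms X q) (tms X p) Y (times_incl K R X q p)"

abbreviation stage :: "'o set \<Rightarrow> 'm sset" where "stage p \<equiv> maps K (tms X p) Y"

lemma stage_simplicial: "p \<in> \<Phi> \<Longrightarrow> simplicial_set (stage p)"
  by (intro maps_simplicial tms_obj X Y)

lemma restr_diagram: "diagram (\<lambda>p. cells (stage p) n) (\<lambda>p q. restr p q n)"
  unfolding diagram_def
proof (intro conjI ballI impI)
  fix p q f assume p: "p \<in> \<Phi>" "q \<in> \<Phi>" "le q p" and f: "f \<in> cells (stage p) n"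
  have s: "simplicial_set (maps K (tms X q) (tms X p))"
    by (intro maps_simplicial tms_obj X p)
  show "restr p q n f \<in> cells (stage q) n"
    unfolding prec_def
    by (intro kcomp_cells tms_obj X Y p f cst_cells[OF s] times_incl)
next
  fix p q r f assume p: "p \<in> \<Phi>" "q \<in> \<Phi>" "r \<in> \<Phi>" "le q p \<and> le r q" and f: "f \<in> cells (stage p) n"
  have s: "simplicial_set (maps K (tms X q) (tms X p))" "simplicial_set (maps K (tms X r) (tms X q))"
    by (intro maps_simplicial tms_obj X p)+
  note t = times_incl(1)[OF X p(1,2) conjunct1[OF p(4)]] times_incl(1)[OF X p(2,3) conjunct2[OF p(4)]]
  note o = tms_obj[OF X p(1)] tms_obj[OF X p(2)] tms_obj[OF X p(3)]
  show "restr q r n (restr p q n f) = restr p r n f"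
    using kcomp_assoc[OF o(3,2,1) Y cst_cells[OF s(2) t(2)] cst_cells[OF s(1) t(1)] f]
      kcomp_cst[OF o(3,2,1) t, of n] times_incl_comp[OF X p(1-3)] p(4)
    by (simp add: prec_def)
qed

lemma restr_act:
  assumes p: "p \<in> \<Phi>" "q \<in> \<Phi>" "le q p" and f: "f \<in> cells (stage p) n" and \<theta>: "\<theta> \<in> ops m n"
  shows "act (stage q) n \<theta> (restr p q n f) = restr p q m (act (stage p) n \<theta> f)"
proof -
  have s: "simplicial_set (maps K (tms X q) (tms X p))"
    by (intro maps_simplicial tms_obj X p)
  note t = times_incl(1)[OF X p]
  show ?thesis
    using kcomp_act[OF tms_obj[OF X p(2)] tms_obj[OF X p(1)] Y f cst_cells[OF s t] \<theta>]
      act_cst[OF s t \<theta>] by (simp add: prec_def)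
qed

lemma restr_0: "\<lbrakk>p \<in> \<Phi>; q \<in> \<Phi>; le q p\<rbrakk>
    \<Longrightarrow> restr p q 0 f = comp (tms X q) (tms X p) Y f (times_incl K R X q p)"
  using cst_0[OF maps_simplicial[OF tms_obj tms_obj] times_incl(1)] X by (simp add: prec_def)

abbreviation cls :: "nat \<Rightarrow> 'o set \<Rightarrow> 'm \<Rightarrow> ('o set \<times> 'm) set" where
  "cls \<equiv> kan_class K \<Phi> R X Y"

lemma cls_eq: "cls n = colim_class \<Phi> le (\<lambda>p. cells (stage p) n) (\<lambda>p q. restr p q n)"
  by (simp add: kan_class_def sset_colim_class_def fun_eq_iff)

text \<open>The quotient has the objects of \<open>K\<close> and its mapping spaces are themselves
  the colimits. An edge is therefore the class of an edge at one stage, with no condition on source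
  and target left to be realised later, in contrast to the colimit of slices.\<close>

lemma edge_quot_iff: "edge (maps (kan_filter_quotient K \<Phi> R) X Y) f g \<longleftrightarrow>
    (\<exists>r\<in>\<Phi>. \<exists>F G. edge (stage r) F G \<and> f = cls 0 r F \<and> g = cls 0 r G)"
proof -
  have act: "act (maps (kan_filter_quotient K \<Phi> R) X Y) 1 \<theta> (cls 1 p h) = cls 0 p (act (stage p) 1 \<theta> h)"
    if "p \<in> \<Phi>" "h \<in> cells (stage p) 1" "\<theta> \<in> ops 0 1" for p h \<theta>
    unfolding kan_class_def kan_filter_quotient_def
    using sset_colim_act[of stage restr 1 \<theta> 0 p h, OF restr_diagram _ _ that(3,1,2)]
      simplicial_set_cells[OF stage_simplicial _ that(3)] restr_act that(3) by simp
  have cells: "cells (maps (kan_filter_quotient K \<Phi> R) X Y) 1 = {cls 1 p h | p h. p \<in> \<Phi> \<and> h \<in> cells (stage p) 1}"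
    by (simp add: kan_filter_quotient_def sset_colim_def colim_set_def kan_class_def sset_colim_class_def)
  have "edge (maps (kan_filter_quotient K \<Phi> R) X Y) f g \<longleftrightarrow> (\<exists>p\<in>\<Phi>. \<exists>h\<in>cells (stage p) 1.
      act (maps (kan_filter_quotient K \<Phi> R) X Y) 1 [0] (cls 1 p h) = f \<and>
      act (maps (kan_filter_quotient K \<Phi> R) X Y) 1 [1] (cls 1 p h) = g)"
    unfolding edge_def cells by auto
  also have "\<dots> \<longleftrightarrow> (\<exists>p\<in>\<Phi>. \<exists>h\<in>cells (stage p) 1.
      cls 0 p (act (stage p) 1 [0] h) = f \<and> cls 0 p (act (stage p) 1 [1] h) = g)"
    by (intro bex_cong refl) (simp add: act[unfolded One_nat_def] ops_def)
  also have "\<dots> \<longleftrightarrow> (\<exists>r\<in>\<Phi>. \<exists>F G. edge (stage r) F G \<and> f = cls 0 r F \<and> g = cls 0 r G)"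
    unfolding edge_def by blast
  finally show ?thesis .
qed

lemma stage_components:
  assumes V: "V \<in> \<Phi>" "F \<in> hom (tms X V) Y" "G \<in> hom (tms X V) Y"
  shows "same_component (maps (kan_filter_quotient K \<Phi> R) X Y) (cls 0 V F) (cls 0 V G) \<longleftrightarrow>
    (\<exists>r\<in>\<Phi>. le r V \<and> homotopic (tms X r) Y (comp (tms X r) (tms X V) Y F (times_incl K R X r V))
       (comp (tms X r) (tms X V) Y G (times_incl K R X r V)))"
proof -
  have "equivclp (edge (maps (kan_filter_quotient K \<Phi> R) X Y)) (cls 0 V F) (cls 0 V G) \<longleftrightarrow>
    (\<exists>r\<in>\<Phi>. le r V \<and> homotopic (tms X r) Y (restr V r 0 F) (restr V r 0 G))"
    unfolding cls_eq
  proof (rule colim_components[OF restr_diagram V])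
    show "F \<in> cells (stage r) 0 \<and> G \<in> cells (stage r) 0" if "r \<in> \<Phi>" "edge (stage r) F G" for r F G
      using edge_cells[OF stage_simplicial] that by simp
    show "edge (stage r) (restr q r 0 F) (restr q r 0 G)"
      if "q \<in> \<Phi>" "r \<in> \<Phi>" "le r q" "edge (stage q) F G" for q r F G
      using that edge_comp_left[OF tms_obj[OF X] tms_obj[OF X] Y _ times_incl(1)[OF X]]
      by (simp add: restr_0)
  qed (use edge_quot_iff[unfolded cls_eq] in simp)
  then show ?thesis unfolding same_component_eq using restr_0 V by auto
qed

text \<open>Homotopies are carried between \<open>X \<times> r\<close> and
  \<open>(X \<times> V) \<times> U\<close> by precomposition with comparison maps. In the targets,
  the factors taken from the filter are added by \<open>homotopic_productI\<close> and removed by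
  composing with projections.\<close>

lemma kan_components:
  assumes V: "V \<in> \<Phi>" "F \<in> hom (tms X V) (tms Y V)" "G \<in> hom (tms X V) (tms Y V)"
  shows "same_component (maps (kan_filter_quotient K \<Phi> R) X Y)
      (kan_mor K \<Phi> R X Y V F) (kan_mor K \<Phi> R X Y V G) \<longleftrightarrow>
    (\<exists>U\<in>\<Phi>. same_component (maps K (tms (tms X V) U) (tms (tms Y V) U))
       (kan_times_id K R (tms X V) (tms Y V) U F) (kan_times_id K R (tms X V) (tms Y V) U G))"
proof -
  let ?A = "tms X V" and ?B = "tms Y V"
  let ?\<pi> = "comp ?A ?B Y (proj1 R Y V)"
  let ?t = "\<lambda>r. times_incl K R X r V"
  have A: "?A \<in> obj K" and B: "?B \<in> obj K" using tms_obj X Y V(1) by auto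
  note \<pi> = proj_hom(1)[OF Y V(1)]
  have \<pi>_hom: "?\<pi> H \<in> hom ?A Y" if "H \<in> hom ?A ?B" for H
    by (rule kcomp_cells[OF A B Y \<pi> that])
  have Z: "tms ?A U \<in> obj K" "tms ?B U \<in> obj K" if "U \<in> \<Phi>" for U using tms_obj A B that by auto
  have ti: "kan_times_id K R ?A ?B U H \<in> hom (tms ?A U) (tms ?B U)"
      "comp (tms ?A U) (tms ?B U) ?B (proj1 R ?B U) (kan_times_id K R ?A ?B U H) =
         comp (tms ?A U) ?A ?B H (proj1 R ?A U)"
    if U: "U \<in> \<Phi>" and H: "H \<in> hom ?A ?B" for U H
    unfolding kan_times_id_def
    by (intro pairing_0 B U Z kcomp_cells A H proj_hom)+
  have "(\<exists>r\<in>\<Phi>. le r V \<and> homotopic (tms X r) Y (comp (tms X r) ?A Y (?\<pi> F) (?t r))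
       (comp (tms X r) ?A Y (?\<pi> G) (?t r))) \<longleftrightarrow>
    (\<exists>U\<in>\<Phi>. homotopic (tms ?A U) (tms ?B U) (kan_times_id K R ?A ?B U F) (kan_times_id K R ?A ?B U G))"
  proof
    assume "\<exists>r\<in>\<Phi>. le r V \<and> homotopic (tms X r) Y (comp (tms X r) ?A Y (?\<pi> F) (?t r))
       (comp (tms X r) ?A Y (?\<pi> G) (?t r))"
    then obtain r where r: "r \<in> \<Phi>" "le r V" and
      hom: "homotopic (tms X r) Y (comp (tms X r) ?A Y (?\<pi> F) (?t r)) (comp (tms X r) ?A Y (?\<pi> G) (?t r))"
      by blast
    let ?Z = "tms ?A r"
    let ?p = "proj1 R ?A r"
    note Zr = Z[OF r(1)] and Xr = tms_obj[OF X r(1)] and p = proj_hom[OF A r(1)]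
    note t = times_incl[OF X V(1) r]
    \<comment> \<open>\<open>k\<close> goes from \<open>(X \<times> V) \<times> r\<close> to
      \<open>X \<times> r\<close> and drops the factor \<open>V\<close>.\<close>
    define k where "k = pairing K R ?Z X r 0 (comp ?Z ?A X (proj1 R X V) ?p) (proj2 R ?A r)"
    have k: "k \<in> hom ?Z (tms X r)" "comp ?Z (tms X r) X (proj1 R X r) k = comp ?Z ?A X (proj1 R X V) ?p"
      unfolding k_def
      by (intro pairing_0 X r Zr kcomp_cells A proj_hom V)+
    \<comment> \<open>\<open>j\<close> and the projection \<open>?p\<close> are both maps from
      \<open>(X \<times> V) \<times> r\<close> to \<open>X \<times> V\<close>. Their components in
      \<open>V\<close> may differ, one of them being obtained through \<open>r\<close>, but their
      components in \<open>X\<close> agree; this makes \<open>j\<close> and \<open>?p\<close>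
      homotopic.\<close>
    define j where "j = comp ?Z (tms X r) ?A (?t r) k"
    have j: "j \<in> hom ?Z ?A" unfolding j_def by (intro kcomp_cells Zr Xr A t k)
    have "comp ?Z ?A X (proj1 R X V) j = comp ?Z ?A X (proj1 R X V) ?p"
      unfolding j_def
      using kcomp_assoc[OF Zr(1) Xr A X k(1) t(1) proj_hom(1)[OF X V(1)]] t(2) k(2) by simp
    then have jp: "homotopic ?Z ?A j ?p"
      by (intro homotopic_productI X V Zr j p) simp
    have ass: "comp ?Z ?A Y (?\<pi> H) j = comp ?Z (tms X r) Y (comp (tms X r) ?A Y (?\<pi> H) (?t r)) k"
      if "H \<in> hom ?A ?B" for H
      unfolding j_def by (rule kcomp_assoc[OF Zr(1) Xr A Y k(1) t(1) \<pi>_hom[OF that]])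
    have "homotopic ?Z Y (comp ?Z ?A Y (?\<pi> F) ?p) (comp ?Z ?A Y (?\<pi> F) j)"
      by (intro homotopic_comp_right Zr A Y \<pi>_hom V equivclp_sym[OF jp])
    moreover have "homotopic ?Z Y (comp ?Z ?A Y (?\<pi> F) j) (comp ?Z ?A Y (?\<pi> G) j)"
      unfolding ass[OF V(2)] ass[OF V(3)] by (intro homotopic_comp_left Zr Xr Y hom k)
    moreover have "homotopic ?Z Y (comp ?Z ?A Y (?\<pi> G) j) (comp ?Z ?A Y (?\<pi> G) ?p)"
      by (intro homotopic_comp_right Zr A Y \<pi>_hom V jp)
    ultimately have "homotopic ?Z Y (comp ?Z ?A Y (?\<pi> F) ?p) (comp ?Z ?A Y (?\<pi> G) ?p)"
      by (meson equivclp_trans)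
    then have "homotopic ?Z Y (comp ?Z ?B Y (proj1 R Y V) (comp ?Z ?A ?B F ?p))
        (comp ?Z ?B Y (proj1 R Y V) (comp ?Z ?A ?B G ?p))"
      using kcomp_assoc[OF Zr(1) A B Y p(1) V(2) \<pi>] kcomp_assoc[OF Zr(1) A B Y p(1) V(3) \<pi>] by simp
    \<comment> \<open>The homotopy so far lives in the space of maps to \<open>Y\<close>. It is
      lifted first to \<open>Y \<times> V\<close> and then to
      \<open>(Y \<times> V) \<times> r\<close>.\<close>
    then have *: "homotopic ?Z ?B (comp ?Z ?A ?B F ?p) (comp ?Z ?A ?B G ?p)"
      by (intro homotopic_productI Y V Zr kcomp_cells A B p)
    have "homotopic ?Z (tms ?B r) (kan_times_id K R ?A ?B r F) (kan_times_id K R ?A ?B r G)"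
      by (rule homotopic_productI[OF B r(1) Zr(1)]) (use ti[OF r(1)] V * in simp_all)
    then show "\<exists>U\<in>\<Phi>. homotopic (tms ?A U) (tms ?B U) (kan_times_id K R ?A ?B U F) (kan_times_id K R ?A ?B U G)"
      using r(1) by blast
  next
    assume "\<exists>U\<in>\<Phi>. homotopic (tms ?A U) (tms ?B U) (kan_times_id K R ?A ?B U F) (kan_times_id K R ?A ?B U G)"
    then obtain U where U: "U \<in> \<Phi>" and
      hom: "homotopic (tms ?A U) (tms ?B U) (kan_times_id K R ?A ?B U F) (kan_times_id K R ?A ?B U G)"
      by blast
    define r where "r = sub_meet (kan_product K) V U"
    have r: "r \<in> \<Phi>" "le r V" "le r U" using meet_in meet_le V(1) U by (simp_all add: r_def)
    note Zr = Z[OF U] and Xr = tms_obj[OF X r(1)] and p = proj_hom(1)[OF A U] and q = proj_hom(1)[OF B U]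
    note t = times_incl(1)[OF X V(1) r(1,2)]
    \<comment> \<open>In this direction \<open>k\<close> goes from \<open>X \<times> r\<close> to
      \<open>(X \<times> V) \<times> U\<close>, with components induced by \<open>r \<le> V\<close>
      and \<open>r \<le> U\<close>. Its first component is the transition map exactly, so the
      restricted morphisms are recovered by equations and not merely up to homotopy.\<close>
    define k where "k = pairing K R (tms X r) ?A U 0 (?t r)
      (comp (tms X r) (repr R r) (repr R U) (incl R r U) (proj2 R X r))"
    have k: "k \<in> hom (tms X r) (tms ?A U)" "comp (tms X r) (tms ?A U) ?A (proj1 R ?A U) k = ?t r"
      unfolding k_def
      by (intro pairing_0 A U Xr t kcomp_cells repr_obj incl_hom proj_hom X r)+
    have "comp (tms X r) (tms ?A U) Y (comp (tms ?A U) ?B Y (proj1 R Y V)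
        (comp (tms ?A U) (tms ?B U) ?B (proj1 R ?B U) (kan_times_id K R ?A ?B U H))) k =
      comp (tms X r) ?A Y (?\<pi> H) (?t r)" if H: "H \<in> hom ?A ?B" for H
    proof -
      have "comp (tms ?A U) ?B Y (proj1 R Y V)
        (comp (tms ?A U) (tms ?B U) ?B (proj1 R ?B U) (kan_times_id K R ?A ?B U H)) =
        comp (tms ?A U) ?A Y (?\<pi> H) (proj1 R ?A U)"
        unfolding ti(2)[OF U H] by (rule kcomp_assoc[OF Zr(1) A B Y p H \<pi>])
      then show ?thesis
        using kcomp_assoc[OF Xr Zr(1) A Y k(1) p \<pi>_hom[OF H]] k(2) by simp
    qed
    note e = this[OF V(2)] this[OF V(3)]
    have "homotopic (tms X r) Y (comp (tms X r) ?A Y (?\<pi> F) (?t r)) (comp (tms X r) ?A Y (?\<pi> G) (?t r))"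
      unfolding e[symmetric]
      by (intro homotopic_comp_left homotopic_comp_right Xr Zr Y B k q \<pi> hom)
    then show "\<exists>r\<in>\<Phi>. le r V \<and> homotopic (tms X r) Y (comp (tms X r) ?A Y (?\<pi> F) (?t r))
       (comp (tms X r) ?A Y (?\<pi> G) (?t r))"
      using r by blast
  qed
  then show ?thesis
    using stage_components[OF V(1) \<pi>_hom[OF V(2)] \<pi>_hom[OF V(3)]]
    unfolding kan_mor_def same_component_eq by simp
qed

end

end


section \<open>Segal spaces\<close>

locale segal =
  fixes W :: "'w bisset"
  assumes segal: "segal_space W"
begin

lemma bisimplicial: "bisimplicial_set W" and reedy: "reedy_fibrant W"
  using segal by (auto simp: segal_space_def)

lemma col_simplicial: "simplicial_set (col W n)" and row_simplicial: "simplicial_set (row W l)"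
  using bisimplicial by (auto simp: bisimplicial_set_def)

lemma h_cells: "\<lbrakk>w \<in> bcells W n l; \<theta> \<in> ops m n\<rbrakk> \<Longrightarrow> hact W n l \<theta> w \<in> bcells W m l"
  using simplicial_set_cells[OF row_simplicial[of l], of w n \<theta> m] by (simp add: row_def)

lemma v_cells: "\<lbrakk>w \<in> bcells W n l; \<phi> \<in> ops k l\<rbrakk> \<Longrightarrow> vact W n l \<phi> w \<in> bcells W n k"
  using simplicial_set_cells[OF col_simplicial[of n], of w l \<phi> k] by (simp add: col_def)

lemma h_act: "\<lbrakk>w \<in> bcells W n l; \<theta> \<in> ops m n; \<phi> \<in> ops (length \<phi> - 1) m\<rbrakk>
    \<Longrightarrow> hact W m l \<phi> (hact W n l \<theta> w) = hact W n l (ocomp \<theta> \<phi>) w"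
  using simplicial_set_act_act[OF row_simplicial[of l], of w n \<theta> m \<phi>] by (simp add: row_def)

lemma v_act: "\<lbrakk>w \<in> bcells W n l; \<theta> \<in> ops m l; \<phi> \<in> ops (length \<phi> - 1) m\<rbrakk>
    \<Longrightarrow> vact W n m \<phi> (vact W n l \<theta> w) = vact W n l (ocomp \<theta> \<phi>) w"
  using simplicial_set_act_act[OF col_simplicial[of n], of w l \<theta> m \<phi>] by (simp add: col_def)

lemma vh: "\<lbrakk>w \<in> bcells W n l; \<theta> \<in> ops m n; \<phi> \<in> ops (length \<phi> - 1) l\<rbrakk>
    \<Longrightarrow> vact W m l \<phi> (hact W n l \<theta> w) = hact W n (length \<phi> - 1) \<theta> (vact W n l \<phi> w)"
  using bisimplicial unfolding bisimplicial_set_def by metis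

lemmas W_simps = h_cells v_cells h_act v_act vh ops_simps

lemma v_id: "w \<in> bcells W n 0 \<Longrightarrow> vact W n 0 [0] w = w" "w \<in> bcells W n 1 \<Longrightarrow> vact W n 1 [0, 1] w = w"
  using simplicial_set_id[OF col_simplicial[of n], of w 0] simplicial_set_id[OF col_simplicial[of n], of w 1]
  by (simp_all add: col_def)

lemma h_id: "w \<in> bcells W 0 l \<Longrightarrow> hact W 0 l [0] w = w"
  using simplicial_set_id[OF row_simplicial[of l], of w 0] by (simp add: row_def)

lemma cst_col: "cst (col W n) 0 w = vact W n 0 [0] w" "cst (col W n) 1 w = vact W n 0 [0, 0] w"
    "cst (col W n) 2 w = vact W n 0 [0, 0, 0] w"
  by (simp_all add: cst_def col_def eval_nat_numeral)

lemma face_col: "face (col W n) l i w = vact W n l ([0..<i] @ [Suc i..<Suc l]) w"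
  by (simp add: face_def col_def)

lemma face_row: "face (row W l) n i w = hact W n l ([0..<i] @ [Suc i..<Suc n]) w"
  by (simp add: face_def row_def)

lemma matching_act: "face (matching W n) l i y = (\<lambda>j\<in>{..n}. face (col W (n - 1)) l i (y j))"
  by (simp add: face_def matching_def col_def)

section \<open>Lifting along the Reedy fibrations in categorical degrees 1 and 2\<close>

text \<open>A point of the first matching space is a pair of objects, so Reedy fibrancy fills horns
  in the space of morphisms with source and target prescribed in advance.\<close>

lemma fill_horn_1:
  assumes h: "horn (col W 1) l k h" and st: "s \<in> bcells W 0 l" "t \<in> bcells W 0 l"
    and hs: "\<And>i. \<lbrakk>i \<le> l; i \<noteq> k\<rbrakk> \<Longrightarrow> hact W 1 (l - 1) [0] (h i) = face (col W 0) l i s"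
    and ht: "\<And>i. \<lbrakk>i \<le> l; i \<noteq> k\<rbrakk> \<Longrightarrow> hact W 1 (l - 1) [1] (h i) = face (col W 0) l i t"
  shows "\<exists>x. fills_horn (col W 1) l k h x \<and> hact W 1 l [0] x = s \<and> hact W 1 l [1] x = t"
proof -
  \<comment> \<open>Matching points are indexed by the omitted vertex: face 0 of a morphism is its
    target.\<close>
  define y where "y = (\<lambda>j\<in>{..1::nat}. if j = 0 then t else s)"
  have fib: "kan_fibration (col W 1) (matching W 1) (\<lambda>l w. \<lambda>i\<in>{..1}. face (row W l) 1 i w)"
    using reedy by (simp add: reedy_fibrant_def)
  have y: "y \<in> cells (matching W 1) l"
    using st by (auto simp: matching_def y_def bdry_def row_def)
  have "\<forall>i\<le>l. i \<noteq> k \<longrightarrow> (\<lambda>j\<in>{..1}. face (row W (l - 1)) 1 j (h i)) = face (matching W 1) l i y"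
    using hs ht by (auto simp: matching_act y_def face_row fun_eq_iff le_Suc_eq)
  then obtain x where x: "fills_horn (col W 1) l k h x" "(\<lambda>i\<in>{..1}. face (row W l) 1 i x) = y"
    using fib h y unfolding kan_fibration_def by blast
  have "hact W 1 l [0] x = s" "hact W 1 l [1] x = t"
    using fun_cong[OF x(2), of 1] fun_cong[OF x(2), of 0] by (simp_all add: face_row y_def)
  then show ?thesis using x(1) by blast
qed

text \<open>The analogue for triangles: a point of the second matching space is a compatible triple
  of edges \<open>a\<close>, \<open>b\<close>, \<open>c\<close>, and a spatial horn of triangles is
  filled over it.\<close>

lemma fill_horn_2:
  assumes h: "horn (col W 2) l k h" and e: "a \<in> bcells W 1 l" "b \<in> bcells W 1 l" "c \<in> bcells W 1 l"
    and ab: "hact W 1 l [1] a = hact W 1 l [0] b" and ac: "hact W 1 l [0] a = hact W 1 l [0] c"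
    and bc: "hact W 1 l [1] b = hact W 1 l [1] c"
    and ha: "\<And>i. \<lbrakk>i \<le> l; i \<noteq> k\<rbrakk> \<Longrightarrow> hact W 2 (l - 1) [0, 1] (h i) = face (col W 1) l i a"
    and hb: "\<And>i. \<lbrakk>i \<le> l; i \<noteq> k\<rbrakk> \<Longrightarrow> hact W 2 (l - 1) [1, 2] (h i) = face (col W 1) l i b"
    and hc: "\<And>i. \<lbrakk>i \<le> l; i \<noteq> k\<rbrakk> \<Longrightarrow> hact W 2 (l - 1) [0, 2] (h i) = face (col W 1) l i c"
  shows "\<exists>x. fills_horn (col W 2) l k h x \<and>
    hact W 2 l [0, 1] x = a \<and> hact W 2 l [1, 2] x = b \<and> hact W 2 l [0, 2] x = c"
proof -
  define y where "y = (\<lambda>j\<in>{..2::nat}. if j = 0 then b else if j = 1 then c else a)"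
  have fib: "kan_fibration (col W 2) (matching W 2) (\<lambda>l w. \<lambda>i\<in>{..2}. face (row W l) 2 i w)"
    using reedy by (simp add: reedy_fibrant_def)
  have y: "y \<in> cells (matching W 2) l"
    using e ab ac bc
    by (auto simp: matching_def y_def bdry_def face_row eval_nat_numeral le_Suc_eq less_Suc_eq)
      (simp_all add: row_def)
  have "\<forall>i\<le>l. i \<noteq> k \<longrightarrow> (\<lambda>j\<in>{..2}. face (row W (l - 1)) 2 j (h i)) = face (matching W 2) l i y"
    using ha hb hc
    by (auto simp: matching_act y_def face_row fun_eq_iff le_Suc_eq eval_nat_numeral)
  then obtain x where x: "fills_horn (col W 2) l k h x" "(\<lambda>i\<in>{..2}. face (row W l) 2 i x) = y"
    using fib h y unfolding kan_fibration_def by blast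
  have "hact W 2 l [0, 1] x = a" "hact W 2 l [1, 2] x = b" "hact W 2 l [0, 2] x = c"
    using fun_cong[OF x(2), of 2] fun_cong[OF x(2), of 0] fun_cong[OF x(2), of 1]
    by (simp_all add: face_row y_def eval_nat_numeral)
  then show ?thesis using x(1) by blast
qed

text \<open>The horn of the interval that omits face \<open>e\<close> consists of face
  \<open>1 - e\<close> alone, which is the vertex numbered \<open>e\<close>.\<close>

lemma fills_horn_1:
  assumes w: "fills_horn (col W n) 1 e (\<lambda>_. x) w" and e: "e = 0 \<or> e = 1"
  shows "w \<in> bcells W n 1" "vact W n 1 [e] w = x"
proof -
  show "w \<in> bcells W n 1" using w by (simp add: fills_horn_def col_def)
  have "face (col W n) 1 (1 - e) w = x" using w e by (auto simp: fills_horn_def)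
  then show "vact W n 1 [e] w = x" using e by (elim disjE) (simp_all add: face_col)
qed

text \<open>Path lifting is horn filling in spatial dimension 1, where a horn is a single endpoint;
  \<open>e\<close> tells which endpoint is given.\<close>

lemma lift_path_1:
  assumes x: "x \<in> bcells W 1 0" and st: "s \<in> bcells W 0 1" "t \<in> bcells W 0 1" and e: "e = 0 \<or> e = 1"
    and "hact W 1 0 [0] x = vact W 0 1 [e] s" "hact W 1 0 [1] x = vact W 0 1 [e] t"
  shows "\<exists>w\<in>bcells W 1 1. hact W 1 1 [0] w = s \<and> hact W 1 1 [1] w = t \<and> vact W 1 1 [e] w = x"
proof -
  have "horn (col W 1) 1 e (\<lambda>_. x)"
    using x e by (auto simp: horn_def le_Suc_eq less_Suc_eq) (auto simp: col_def)
  moreover have "hact W 1 (1 - 1) [0] x = face (col W 0) 1 i s \<and>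
      hact W 1 (1 - 1) [1] x = face (col W 0) 1 i t" if "i \<le> 1" "i \<noteq> e" for i
    using that e assms(5,6) by (auto simp: face_col le_Suc_eq)
  ultimately obtain w where w: "fills_horn (col W 1) 1 e (\<lambda>_. x) w"
    "hact W 1 1 [0] w = s" "hact W 1 1 [1] w = t"
    using fill_horn_1[OF _ st, of e "\<lambda>_. x"] by blast
  then show ?thesis using fills_horn_1[OF w(1) e] by blast
qed

lemma lift_path_2:
  assumes x: "x \<in> bcells W 2 0" and abc: "a \<in> bcells W 1 1" "b \<in> bcells W 1 1" "c \<in> bcells W 1 1"
      "hact W 1 1 [1] a = hact W 1 1 [0] b" "hact W 1 1 [0] a = hact W 1 1 [0] c"
      "hact W 1 1 [1] b = hact W 1 1 [1] c"
    and e: "e = 0 \<or> e = 1"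
    and "hact W 2 0 [0, 1] x = vact W 1 1 [e] a" "hact W 2 0 [1, 2] x = vact W 1 1 [e] b"
      "hact W 2 0 [0, 2] x = vact W 1 1 [e] c"
  shows "\<exists>w\<in>bcells W 2 1. hact W 2 1 [0, 1] w = a \<and> hact W 2 1 [1, 2] w = b \<and> hact W 2 1 [0, 2] w = c \<and>
    vact W 2 1 [e] w = x"
proof -
  have "horn (col W 2) 1 e (\<lambda>_. x)"
    using x e by (auto simp: horn_def le_Suc_eq less_Suc_eq) (auto simp: col_def)
  moreover have "hact W 2 (1 - 1) [0, 1] x = face (col W 1) 1 i a \<and>
      hact W 2 (1 - 1) [1, 2] x = face (col W 1) 1 i b \<and>
      hact W 2 (1 - 1) [0, 2] x = face (col W 1) 1 i c" if "i \<le> 1" "i \<noteq> e" for i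
    using that e assms(9-11) by (auto simp: face_col le_Suc_eq)
  ultimately obtain w where w: "fills_horn (col W 2) 1 e (\<lambda>_. x) w"
    "hact W 2 1 [0, 1] w = a" "hact W 2 1 [1, 2] w = b" "hact W 2 1 [0, 2] w = c"
    using fill_horn_2[OF _ abc, of e "\<lambda>_. x"] by blast
  then show ?thesis using fills_horn_1[OF w(1) e] by blast
qed

text \<open>The spatial horn omitting face 2 is outer. It can be filled because the spatial
  direction has lifting for all horns, so a path can be altered at its start while its end is
  kept.\<close>

lemma fill_triangle_1:
  assumes f: "f\<^sub>0 \<in> bcells W 1 1" "f\<^sub>1 \<in> bcells W 1 1" "vact W 1 1 [1] f\<^sub>0 = vact W 1 1 [1] f\<^sub>1"
    and st: "s \<in> bcells W 0 2" "t \<in> bcells W 0 2"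
    and "hact W 1 1 [0] f\<^sub>0 = vact W 0 2 [1, 2] s" "hact W 1 1 [1] f\<^sub>0 = vact W 0 2 [1, 2] t"
      "hact W 1 1 [0] f\<^sub>1 = vact W 0 2 [0, 2] s" "hact W 1 1 [1] f\<^sub>1 = vact W 0 2 [0, 2] t"
  shows "\<exists>w\<in>bcells W 1 2. vact W 1 2 [1, 2] w = f\<^sub>0 \<and> vact W 1 2 [0, 2] w = f\<^sub>1 \<and>
    hact W 1 2 [0] w = s \<and> hact W 1 2 [1] w = t"
proof -
  define h where "h = (\<lambda>i::nat. if i = 0 then f\<^sub>0 else f\<^sub>1)"
  have "horn (col W 1) 2 2 h"
    using f by (auto simp: horn_def h_def face_col eval_nat_numeral le_Suc_eq less_Suc_eq)
      (auto simp: col_def)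
  moreover have "hact W 1 (2 - 1) [0] (h i) = face (col W 0) 2 i s \<and>
      hact W 1 (2 - 1) [1] (h i) = face (col W 0) 2 i t" if "i \<le> 2" "i \<noteq> 2" for i
  proof -
    have "i = 0 \<or> i = 1" using that by linarith
    then show ?thesis using assms(6-9) by (elim disjE) (simp_all add: h_def face_col eval_nat_numeral)
  qed
  ultimately obtain w where w: "fills_horn (col W 1) 2 2 h w"
    "hact W 1 2 [0] w = s" "hact W 1 2 [1] w = t"
    using fill_horn_1[OF _ st, of 2 h] by blast
  then have "w \<in> bcells W 1 2" "face (col W 1) 2 0 w = f\<^sub>0" "face (col W 1) 2 1 w = f\<^sub>1"
    by (auto simp: fills_horn_def h_def) (auto simp: col_def)
  then show ?thesis using w by (auto simp: face_col eval_nat_numeral)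
qed

text \<open>The hypotheses state that \<open>a\<close>, \<open>b\<close>, \<open>c\<close> bound a
  categorical triangle in spatial degree 2. Horns of triangles are filled over this
  boundary.\<close>

context
  fixes a b c assumes abc: "a \<in> bcells W 1 2" "b \<in> bcells W 1 2" "c \<in> bcells W 1 2"
      "hact W 1 2 [1] a = hact W 1 2 [0] b" "hact W 1 2 [0] a = hact W 1 2 [0] c"
      "hact W 1 2 [1] b = hact W 1 2 [1] c"
begin

lemma fill_triangle_2_2:
  assumes f: "f\<^sub>0 \<in> bcells W 2 1" "f\<^sub>1 \<in> bcells W 2 1" "vact W 2 1 [1] f\<^sub>0 = vact W 2 1 [1] f\<^sub>1"
    and "hact W 2 1 [0, 1] f\<^sub>0 = vact W 1 2 [1, 2] a" "hact W 2 1 [1, 2] f\<^sub>0 = vact W 1 2 [1, 2] b"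
      "hact W 2 1 [0, 2] f\<^sub>0 = vact W 1 2 [1, 2] c"
      "hact W 2 1 [0, 1] f\<^sub>1 = vact W 1 2 [0, 2] a" "hact W 2 1 [1, 2] f\<^sub>1 = vact W 1 2 [0, 2] b"
      "hact W 2 1 [0, 2] f\<^sub>1 = vact W 1 2 [0, 2] c"
  shows "\<exists>w\<in>bcells W 2 2. vact W 2 2 [1, 2] w = f\<^sub>0 \<and> vact W 2 2 [0, 2] w = f\<^sub>1 \<and>
    hact W 2 2 [0, 1] w = a \<and> hact W 2 2 [1, 2] w = b \<and> hact W 2 2 [0, 2] w = c"
proof -
  define h where "h = (\<lambda>i::nat. if i = 0 then f\<^sub>0 else f\<^sub>1)"
  have "horn (col W 2) 2 2 h"
    using f by (auto simp: horn_def h_def face_col eval_nat_numeral le_Suc_eq less_Suc_eq)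
      (auto simp: col_def eval_nat_numeral)
  moreover have "hact W 2 (2 - 1) [0, 1] (h i) = face (col W 1) 2 i a \<and>
      hact W 2 (2 - 1) [1, 2] (h i) = face (col W 1) 2 i b \<and>
      hact W 2 (2 - 1) [0, 2] (h i) = face (col W 1) 2 i c" if "i \<le> 2" "i \<noteq> 2" for i
  proof -
    have "i = 0 \<or> i = 1" using that by linarith
    then show ?thesis using assms(4-9) by (elim disjE) (simp_all add: h_def face_col eval_nat_numeral)
  qed
  ultimately obtain w where w: "fills_horn (col W 2) 2 2 h w"
    "hact W 2 2 [0, 1] w = a" "hact W 2 2 [1, 2] w = b" "hact W 2 2 [0, 2] w = c"
    using fill_horn_2[OF _ abc, of 2 h] by blast
  then have "w \<in> bcells W 2 2" "face (col W 2) 2 0 w = f\<^sub>0" "face (col W 2) 2 1 w = f\<^sub>1"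
    by (auto simp: fills_horn_def h_def) (auto simp: col_def)
  then show ?thesis using w by (auto simp: face_col eval_nat_numeral)
qed

lemma fill_triangle_2_1:
  assumes f: "f\<^sub>0 \<in> bcells W 2 1" "f\<^sub>2 \<in> bcells W 2 1" "vact W 2 1 [0] f\<^sub>0 = vact W 2 1 [1] f\<^sub>2"
    and "hact W 2 1 [0, 1] f\<^sub>0 = vact W 1 2 [1, 2] a" "hact W 2 1 [1, 2] f\<^sub>0 = vact W 1 2 [1, 2] b"
      "hact W 2 1 [0, 2] f\<^sub>0 = vact W 1 2 [1, 2] c"
      "hact W 2 1 [0, 1] f\<^sub>2 = vact W 1 2 [0, 1] a" "hact W 2 1 [1, 2] f\<^sub>2 = vact W 1 2 [0, 1] b"
      "hact W 2 1 [0, 2] f\<^sub>2 = vact W 1 2 [0, 1] c"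
  shows "\<exists>w\<in>bcells W 2 2. vact W 2 2 [1, 2] w = f\<^sub>0 \<and> vact W 2 2 [0, 1] w = f\<^sub>2 \<and>
    hact W 2 2 [0, 1] w = a \<and> hact W 2 2 [1, 2] w = b \<and> hact W 2 2 [0, 2] w = c"
proof -
  define h where "h = (\<lambda>i::nat. if i = 0 then f\<^sub>0 else f\<^sub>2)"
  have "horn (col W 2) 2 1 h"
    using f by (auto simp: horn_def h_def face_col eval_nat_numeral le_Suc_eq less_Suc_eq)
      (auto simp: col_def eval_nat_numeral)
  moreover have "hact W 2 (2 - 1) [0, 1] (h i) = face (col W 1) 2 i a \<and>
      hact W 2 (2 - 1) [1, 2] (h i) = face (col W 1) 2 i b \<and>
      hact W 2 (2 - 1) [0, 2] (h i) = face (col W 1) 2 i c" if "i \<le> 2" "i \<noteq> 1" for i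
  proof -
    have "i = 0 \<or> i = 2" using that by linarith
    then show ?thesis using assms(4-9) by (elim disjE) (simp_all add: h_def face_col eval_nat_numeral)
  qed
  ultimately obtain w where w: "fills_horn (col W 2) 2 1 h w"
    "hact W 2 2 [0, 1] w = a" "hact W 2 2 [1, 2] w = b" "hact W 2 2 [0, 2] w = c"
    using fill_horn_2[OF _ abc, of 1 h] by blast
  then have "w \<in> bcells W 2 2" "face (col W 2) 2 0 w = f\<^sub>0" "face (col W 2) 2 2 w = f\<^sub>2"
    by (auto simp: fills_horn_def h_def) (auto simp: col_def)
  then show ?thesis using w by (auto simp: face_col eval_nat_numeral)
qed

end

lemma degenerate:
  assumes "w \<in> bcells W n 0"
  shows "vact W n 0 [0, 0] w \<in> bcells W n 1" "vact W n 0 [0, 0, 0] w \<in> bcells W n 2"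
    "vact W n 1 [0] (vact W n 0 [0, 0] w) = w" "vact W n 1 [1] (vact W n 0 [0, 0] w) = w"
    "vact W n 2 [0, 1] (vact W n 0 [0, 0, 0] w) = vact W n 0 [0, 0] w"
    "vact W n 2 [0, 2] (vact W n 0 [0, 0, 0] w) = vact W n 0 [0, 0] w"
    "vact W n 2 [1, 2] (vact W n 0 [0, 0, 0] w) = vact W n 0 [0, 0] w"
  using assms v_id(1)[OF assms] by (simp_all add: W_simps)

lemma h_degenerate:
  assumes "w \<in> bcells W n 0" "\<theta> \<in> ops m n"
  shows "hact W n 1 \<theta> (vact W n 0 [0, 0] w) = vact W m 0 [0, 0] (hact W n 0 \<theta> w)"
    "hact W n 2 \<theta> (vact W n 0 [0, 0, 0] w) = vact W m 0 [0, 0, 0] (hact W n 0 \<theta> w)"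
  using assms(1) vh[OF assms, of "[0, 0]"] vh[OF assms, of "[0, 0, 0]"]
  by (simp_all add: ops_def eval_nat_numeral)

lemma edge_ops: "[0] \<in> ops 0 1" "[1] \<in> ops 0 1" "[0, 1] \<in> ops 1 2" "[1, 2] \<in> ops 1 2" "[0, 2] \<in> ops 1 2"
  by (simp_all add: ops_simps)

section \<open>The Segal map: composition and comparison of triangles with the same spine\<close>

abbreviation spine_map :: "nat \<Rightarrow> 'w \<Rightarrow> nat \<Rightarrow> 'w" where
  "spine_map \<equiv> \<lambda>l w. \<lambda>i\<in>{..<2}. hact W 2 l [i, Suc i] w"

lemma spine_equivalence: "weak_equivalence (col W 2) (spine W 2) spine_map"
  using segal unfolding segal_space_def by blast

lemma spine_fill:
  assumes "y \<in> cells (spine W 2) n" "bdry (col W 2) n d"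
    and "\<And>i. \<lbrakk>1 \<le> n; i \<le> n\<rbrakk> \<Longrightarrow> spine_map (n - 1) (d i) = face (spine W 2) n i y"
  shows "\<exists>x. fills_bdry (col W 2) n d x \<and> homotopic_rel (spine W 2) n (spine_map n x) y"
proof -
  have "\<forall>n d. \<forall>y\<in>cells (spine W 2) n. bdry (col W 2) n d \<and>
      (1 \<le> n \<longrightarrow> (\<forall>i\<le>n. spine_map (n - 1) (d i) = face (spine W 2) n i y)) \<longrightarrow>
      (\<exists>x. fills_bdry (col W 2) n d x \<and> homotopic_rel (spine W 2) n (spine_map n x) y)"
    using spine_equivalence unfolding weak_equivalence_def by (elim conjE)
  from this[rule_format, OF assms(1) conjI, OF assms(2)] show ?thesis using assms(3) by blast
qed

lemma spine_cells: "y \<in> cells (spine W 2) l \<longleftrightarrow> y \<in> {..<2} \<rightarrow>\<^sub>E bcells W 1 l \<and>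
    hact W 1 l [1] (y 0) = hact W 1 l [0] (y 1)"
  by (auto simp: spine_def less_Suc_eq eval_nat_numeral)

abbreviation pair :: "'w \<Rightarrow> 'w \<Rightarrow> nat \<Rightarrow> 'w" where
  "pair a b \<equiv> (\<lambda>i\<in>{..<2}. if i = 0 then a else b)"

lemma pair_spine: "\<lbrakk>a \<in> bcells W 1 l; b \<in> bcells W 1 l; hact W 1 l [1] a = hact W 1 l [0] b\<rbrakk>
    \<Longrightarrow> pair a b \<in> cells (spine W 2) l"
  unfolding spine_cells by (intro conjI restrict_PiE_iff[THEN iffD2]) simp_all

lemma spine_map_pair: "spine_map l w = pair (hact W 2 l [0, 1] w) (hact W 2 l [1, 2] w)"
  by (intro restrict_ext) (auto simp: less_Suc_eq eval_nat_numeral)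

lemma face_pair: "face (spine W 2) l i (pair a b) = pair (face (col W 1) l i a) (face (col W 1) l i b)"
  by (auto simp: face_def spine_def col_def fun_eq_iff)

lemma spine_components:
  assumes "y \<in> cells (spine W 2) l"
  shows "y 0 \<in> bcells W 1 l" "y 1 \<in> bcells W 1 l" "hact W 1 l [1] (y 0) = hact W 1 l [0] (y 1)"
  using assms PiE_mem[of y "{..<2}" "\<lambda>_. bcells W 1 l"] unfolding spine_cells by simp_all

text \<open>This is the weak equivalence in dimension 0. A composable pair need not be the spine of
  a triangle; it is only joined to such a spine by a path, whose two components are \<open>a\<close>
  and \<open>b\<close>.\<close>

lemma spine_vertex:
  assumes "f \<in> bcells W 1 0" "g \<in> bcells W 1 0" "hact W 1 0 [1] f = hact W 1 0 [0] g"
  shows "\<exists>\<sigma>\<in>bcells W 2 0. \<exists>a\<in>bcells W 1 1. \<exists>b\<in>bcells W 1 1. hact W 1 1 [1] a = hact W 1 1 [0] b \<and>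
    vact W 1 1 [0] a = f \<and> vact W 1 1 [1] a = hact W 2 0 [0, 1] \<sigma> \<and>
    vact W 1 1 [0] b = g \<and> vact W 1 1 [1] b = hact W 2 0 [1, 2] \<sigma>"
proof -
  define y where "y = pair f g"
  have "y \<in> cells (spine W 2) 0" unfolding y_def by (rule pair_spine[OF assms])
  then obtain \<sigma> where "fills_bdry (col W 2) 0 (\<lambda>_. undefined) \<sigma>"
    and \<sigma>2: "homotopic_rel (spine W 2) 0 (spine_map 0 \<sigma>) y"
    using spine_fill[of y 0 "\<lambda>_. undefined"] by (auto simp: bdry_def)
  then have \<sigma>: "\<sigma> \<in> bcells W 2 0" by (auto simp: fills_bdry_def col_def)
  obtain w where w: "w \<in> cells (spine W 2) 1" "face (spine W 2) 1 0 w = spine_map 0 \<sigma>"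
    "face (spine W 2) 1 1 w = y"
    using \<sigma>2 by (auto simp: homotopic_rel_def)
  have "vact W 1 1 [0] (w 0) = f" "vact W 1 1 [0] (w 1) = g"
    "vact W 1 1 [1] (w 0) = hact W 2 0 [0, 1] \<sigma>" "vact W 1 1 [1] (w 1) = hact W 2 0 [1, 2] \<sigma>"
    using fun_cong[OF w(3), of 0] fun_cong[OF w(3), of 1] fun_cong[OF w(2), of 0] fun_cong[OF w(2), of 1]
    by (simp_all add: face_def spine_def y_def eval_nat_numeral)
  then show ?thesis using \<sigma> spine_components[OF w(1)] by blast
qed

text \<open>This is the weak equivalence in dimension 1, applied to the constant path at the common
  spine of \<open>G\<close> and \<open>G'\<close>. It gives a path \<open>x\<close> of triangles
  whose spine is not constant, but is homotopic to the constant path relative to its ends;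
  \<open>a\<close> and \<open>b\<close> are the components of that homotopy.\<close>

lemma spine_edge:
  assumes G: "G \<in> bcells W 2 0" "G' \<in> bcells W 2 0"
    and g: "hact W 2 0 [0, 1] G = g" "hact W 2 0 [0, 1] G' = g"
    and B: "hact W 2 0 [1, 2] G = B" "hact W 2 0 [1, 2] G' = B"
  shows "\<exists>x\<in>bcells W 2 1. \<exists>a\<in>bcells W 1 2. \<exists>b\<in>bcells W 1 2. hact W 1 2 [1] a = hact W 1 2 [0] b \<and>
    vact W 2 1 [0] x = G' \<and> vact W 2 1 [1] x = G \<and>
    vact W 1 2 [0, 2] a = hact W 2 1 [0, 1] x \<and> vact W 1 2 [0, 1] a = vact W 1 0 [0, 0] g \<and>
    vact W 1 2 [1, 2] a = vact W 1 0 [0, 0] g \<and>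
    vact W 1 2 [0, 2] b = hact W 2 1 [1, 2] x \<and> vact W 1 2 [0, 1] b = vact W 1 0 [0, 0] B \<and>
    vact W 1 2 [1, 2] b = vact W 1 0 [0, 0] B"
proof -
  \<comment> \<open>Face 0 of a path is its end, so the path obtained runs from \<open>G'\<close> to
    \<open>G\<close>.\<close>
  define d where "d = (\<lambda>i::nat. if i = 0 then G else G')"
  have gB: "g \<in> bcells W 1 0" "B \<in> bcells W 1 0" "hact W 1 0 [1] g = hact W 1 0 [0] B"
    using G g(1) B(1) by (auto simp: W_simps)
  define y where "y = pair (vact W 1 0 [0, 0] g) (vact W 1 0 [0, 0] B)"
  have y: "y \<in> cells (spine W 2) 1"
    unfolding y_def
    using pair_spine degenerate(1)[OF gB(1)] degenerate(1)[OF gB(2)]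
      h_degenerate(1)[OF gB(1) edge_ops(2)] h_degenerate(1)[OF gB(2) edge_ops(1)] gB(3) by simp
  have "bdry (col W 2) 1 d" using G by (simp add: bdry_def d_def col_def)
  moreover have "spine_map (1 - 1) (d i) = face (spine W 2) 1 i y" if "i \<le> 1" for i
  proof -
    from that have "i = 0 \<or> i = 1" by linarith
    then have "hact W 2 0 [0, 1] (d i) = face (col W 1) 1 i (vact W 1 0 [0, 0] g) \<and>
      hact W 2 0 [1, 2] (d i) = face (col W 1) 1 i (vact W 1 0 [0, 0] B)"
      using g B degenerate(3,4)[OF gB(1)] degenerate(3,4)[OF gB(2)]
      by (elim disjE) (simp_all add: d_def face_col)
    then show ?thesis
      unfolding y_def face_pair spine_map_pair by (simp only: diff_self_eq_0)
  qed
  ultimately obtain x where x: "fills_bdry (col W 2) 1 d x"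
    and hr: "homotopic_rel (spine W 2) 1 (spine_map 1 x) y"
    using spine_fill[OF y, of d] by auto
  have x': "x \<in> bcells W 2 1" "vact W 2 1 [1] x = G" "vact W 2 1 [0] x = G'"
    using x spec[of "\<lambda>i. i \<le> 1 \<longrightarrow> face (col W 2) 1 i x = d i" 0]
      spec[of "\<lambda>i. i \<le> 1 \<longrightarrow> face (col W 2) 1 i x = d i" 1]
    by (simp_all add: fills_bdry_def d_def face_col) (simp add: col_def)
  obtain w where w: "w \<in> cells (spine W 2) 2" "face (spine W 2) 2 1 w = spine_map 1 x"
    "face (spine W 2) 2 2 w = y"
    "face (spine W 2) 2 0 w = act (spine W 2) 0 [0, 0] (face (spine W 2) 1 0 (spine_map 1 x))"
    using hr by (auto simp: homotopic_rel_def eval_nat_numeral)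
  have "vact W 1 2 [0, 2] (w 0) = hact W 2 1 [0, 1] x" "vact W 1 2 [0, 2] (w 1) = hact W 2 1 [1, 2] x"
    "vact W 1 2 [0, 1] (w 0) = vact W 1 0 [0, 0] g" "vact W 1 2 [0, 1] (w 1) = vact W 1 0 [0, 0] B"
    "vact W 1 2 [1, 2] (w 0) = vact W 1 0 [0, 0] (vact W 1 1 [1] (hact W 2 1 [0, 1] x))"
    "vact W 1 2 [1, 2] (w 1) = vact W 1 0 [0, 0] (vact W 1 1 [1] (hact W 2 1 [1, 2] x))"
    using fun_cong[OF w(2), of 0] fun_cong[OF w(2), of 1] fun_cong[OF w(3), of 0] fun_cong[OF w(3), of 1]
      fun_cong[OF w(4), of 0] fun_cong[OF w(4), of 1]
    by (simp_all add: face_def spine_def y_def eval_nat_numeral)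
  moreover have "vact W 1 1 [1] (hact W 2 1 [0, 1] x) = hact W 2 0 [0, 1] (vact W 2 1 [1] x)"
    "vact W 1 1 [1] (hact W 2 1 [1, 2] x) = hact W 2 0 [1, 2] (vact W 2 1 [1] x)"
    using x'(1) by (simp_all add: W_simps)
  ultimately show ?thesis using x' g(1) B(1) spine_components[OF w(1)]
    by (intro bexI[of _ x] bexI[of _ "w 0"] bexI[of _ "w 1"]) simp_all
qed

text \<open>The Segal condition composes \<open>f\<close> and \<open>g\<close> only up to a path of
  spines. Reedy fibrancy corrects this: the path is extended to the long edges by \<open>w\<close>,
  and then lifted to a path of triangles ending at \<open>\<sigma>\<close>. The start of that path
  has the spine \<open>f\<close>, \<open>g\<close> exactly.\<close>

lemma compose:
  assumes "f \<in> bcells W 1 0" "g \<in> bcells W 1 0" "hact W 1 0 [1] f = hact W 1 0 [0] g"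
  shows "\<exists>\<sigma>\<in>bcells W 2 0. hact W 2 0 [0, 1] \<sigma> = f \<and> hact W 2 0 [1, 2] \<sigma> = g"
proof -
  obtain \<sigma> a b where \<sigma>: "\<sigma> \<in> bcells W 2 0" and ab: "a \<in> bcells W 1 1" "b \<in> bcells W 1 1"
    "hact W 1 1 [1] a = hact W 1 1 [0] b" "vact W 1 1 [0] a = f" "vact W 1 1 [1] a = hact W 2 0 [0, 1] \<sigma>"
    "vact W 1 1 [0] b = g" "vact W 1 1 [1] b = hact W 2 0 [1, 2] \<sigma>"
    using spine_vertex[OF assms] by blast
  define c where "c = hact W 2 0 [0, 2] \<sigma>"
  have c: "c \<in> bcells W 1 0" "hact W 1 0 [0] c = hact W 1 0 [0] (hact W 2 0 [0, 1] \<sigma>)"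
    "hact W 1 0 [1] c = hact W 1 0 [1] (hact W 2 0 [1, 2] \<sigma>)"
    using \<sigma> by (simp_all add: c_def W_simps)
  have "vact W 0 1 [1] (hact W 1 1 [0] a) = hact W 1 0 [0] (vact W 1 1 [1] a)"
    "vact W 0 1 [1] (hact W 1 1 [1] b) = hact W 1 0 [1] (vact W 1 1 [1] b)"
    "hact W 1 1 [0] a \<in> bcells W 0 1" "hact W 1 1 [1] b \<in> bcells W 0 1"
    using ab(1,2) by (simp_all add: W_simps)
  then obtain w where w: "w \<in> bcells W 1 1" "hact W 1 1 [0] w = hact W 1 1 [0] a"
    "hact W 1 1 [1] w = hact W 1 1 [1] b" "vact W 1 1 [1] w = c"
    using lift_path_1[OF c(1), of "hact W 1 1 [0] a" "hact W 1 1 [1] b" 1] c ab by auto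
  obtain v where v: "v \<in> bcells W 2 1" "hact W 2 1 [0, 1] v = a" "hact W 2 1 [1, 2] v = b"
    using lift_path_2[OF \<sigma> ab(1,2) w(1), of 1] ab w by (auto simp: c_def)
  have "vact W 2 1 [0] v \<in> bcells W 2 0"
    "hact W 2 0 [0, 1] (vact W 2 1 [0] v) = vact W 1 1 [0] (hact W 2 1 [0, 1] v)"
    "hact W 2 0 [1, 2] (vact W 2 1 [0] v) = vact W 1 1 [0] (hact W 2 1 [1, 2] v)"
    using v(1) by (simp_all add: W_simps)
  then show ?thesis using v ab by auto
qed

section \<open>Mapping spaces of a Segal space and maps into a subobject of the final object\<close>

lemma map_space_cells: "w \<in> cells (map_space W x y) l \<longleftrightarrow> w \<in> bcells W 1 l \<and>
    hact W 1 l [0] w = cst (col W 0) l x \<and> hact W 1 l [1] w = cst (col W 0) l y"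
  by (simp add: map_space_def)

lemma map_space_0: "\<lbrakk>x \<in> bcells W 0 0; y \<in> bcells W 0 0\<rbrakk> \<Longrightarrow> w \<in> cells (map_space W x y) 0 \<longleftrightarrow>
    w \<in> bcells W 1 0 \<and> hact W 1 0 [0] w = x \<and> hact W 1 0 [1] w = y"
  by (simp add: map_space_cells cst_col v_id)

lemma edge_map_space: "edge (map_space W x y) f g \<longleftrightarrow> (\<exists>w\<in>bcells W 1 1.
    hact W 1 1 [0] w = vact W 0 0 [0, 0] x \<and> hact W 1 1 [1] w = vact W 0 0 [0, 0] y \<and>
    vact W 1 1 [0] w = f \<and> vact W 1 1 [1] w = g)"
  by (auto simp: edge_def map_space_def cst_col(2)[unfolded One_nat_def])

lemma triangle_vertices:
  assumes "w \<in> bcells W 2 l"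
  shows "hact W 1 l [0] (hact W 2 l [0, 2] w) = hact W 1 l [0] (hact W 2 l [0, 1] w)"
    "hact W 1 l [1] (hact W 2 l [0, 2] w) = hact W 1 l [1] (hact W 2 l [1, 2] w)"
    "hact W 1 l [1] (hact W 2 l [0, 1] w) = hact W 1 l [0] (hact W 2 l [1, 2] w)"
  using assms by (simp_all add: W_simps)

context
  fixes u x A assumes sub: "subfinal (css_homs W) u"
    and A: "A \<in> bcells W 1 0" "hact W 1 0 [0] A = x" "hact W 1 0 [1] A = u"
begin

lemma x_u: "x \<in> bcells W 0 0" "u \<in> bcells W 0 0"
  using A h_cells edge_ops by blast+

lemma map_contractible: "contractible (map_space W x u)"
proof -
  have "A \<in> cells (map_space W x u) 0" using map_space_0[OF x_u] A by simp
  then show ?thesis using sub x_u(1) by (auto simp: subfinal_def css_homs_def)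
qed

text \<open>The composite of \<open>m\<close> and \<open>B\<close> is connected to \<open>A\<close>
  by a path in the contractible space of maps from \<open>x\<close> to \<open>u\<close>. The
  composition triangle is transported backwards along this path with its spine held constant, and
  thereby acquires the long edge \<open>A\<close>.\<close>

lemma lift_vertex:
  assumes B: "B \<in> bcells W 1 0" "hact W 1 0 [1] B = u"
    and m: "m \<in> bcells W 1 0" "hact W 1 0 [0] m = x" "hact W 1 0 [1] m = hact W 1 0 [0] B"
  shows "\<exists>F\<in>bcells W 2 0. hact W 2 0 [0, 1] F = m \<and> hact W 2 0 [0, 2] F = A \<and> hact W 2 0 [1, 2] F = B"
proof -
  obtain \<sigma> where \<sigma>: "\<sigma> \<in> bcells W 2 0" "hact W 2 0 [0, 1] \<sigma> = m" "hact W 2 0 [1, 2] \<sigma> = B"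
    using compose[OF m(1) B(1) m(3)] by blast
  have "hact W 2 0 [0, 2] \<sigma> \<in> cells (map_space W x u) 0"
    using map_space_0[OF x_u] triangle_vertices[OF \<sigma>(1)] h_cells[OF \<sigma>(1) edge_ops(5)] \<sigma> m B by simp
  moreover have "A \<in> cells (map_space W x u) 0" using map_space_0[OF x_u] A by simp
  ultimately have "edge (map_space W x u) A (hact W 2 0 [0, 2] \<sigma>)"
    using contractible_edge[OF map_contractible] by blast
  then obtain e where e: "e \<in> bcells W 1 1" "hact W 1 1 [0] e = vact W 0 0 [0, 0] x"
    "hact W 1 1 [1] e = vact W 0 0 [0, 0] u" "vact W 1 1 [0] e = A" "vact W 1 1 [1] e = hact W 2 0 [0, 2] \<sigma>"
    by (auto simp: edge_map_space)
  obtain w where w: "w \<in> bcells W 2 1" "hact W 2 1 [0, 1] w = vact W 1 0 [0, 0] m"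
    "hact W 2 1 [1, 2] w = vact W 1 0 [0, 0] B" "hact W 2 1 [0, 2] w = e"
    using lift_path_2[OF \<sigma>(1) degenerate(1)[OF m(1)] degenerate(1)[OF B(1)] e(1), of 1]
      h_degenerate(1)[OF m(1) edge_ops(1)] h_degenerate(1)[OF m(1) edge_ops(2)]
      h_degenerate(1)[OF B(1) edge_ops(1)] h_degenerate(1)[OF B(1) edge_ops(2)]
      degenerate(4)[OF m(1)] degenerate(4)[OF B(1)] e m B \<sigma> by auto
  have "vact W 2 1 [0] w \<in> bcells W 2 0"
    "hact W 2 0 [0, 1] (vact W 2 1 [0] w) = vact W 1 1 [0] (hact W 2 1 [0, 1] w)"
    "hact W 2 0 [1, 2] (vact W 2 1 [0] w) = vact W 1 1 [0] (hact W 2 1 [1, 2] w)"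
    "hact W 2 0 [0, 2] (vact W 2 1 [0] w) = vact W 1 1 [0] (hact W 2 1 [0, 2] w)"
    using w(1) by (simp_all add: W_simps)
  then show ?thesis using w e degenerate(3)[OF m(1)] degenerate(3)[OF B(1)] by auto
qed

text \<open>The Segal condition gives a path over the spine; the loop that it induces on the long edges is
  contracted in the mapping space from \<open>x\<close> to \<open>u\<close>.\<close>

lemma triangle_unique:
  assumes G: "G \<in> bcells W 2 0" "G' \<in> bcells W 2 0"
    and g: "hact W 2 0 [0, 1] G = g" "hact W 2 0 [0, 1] G' = g"
    and B: "hact W 2 0 [1, 2] G = B" "hact W 2 0 [1, 2] G' = B"
    and GA: "hact W 2 0 [0, 2] G = A" "hact W 2 0 [0, 2] G' = A"
  shows "\<exists>w\<in>bcells W 2 1. hact W 2 1 [0, 2] w = vact W 1 0 [0, 0] A \<and>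
    hact W 2 1 [1, 2] w = vact W 1 0 [0, 0] B \<and> vact W 2 1 [0] w = G' \<and> vact W 2 1 [1] w = G"
proof -
  have gB: "g \<in> bcells W 1 0" "B \<in> bcells W 1 0" "hact W 1 0 [1] g = hact W 1 0 [0] B"
    "hact W 1 0 [0] g = x" "hact W 1 0 [1] B = u"
    using triangle_vertices[OF G(1)] h_cells[OF G(1) edge_ops(3)] h_cells[OF G(1) edge_ops(4)] g(1) B(1) GA(1) A
    by simp_all
  note dA = degenerate[OF A(1)] and dB = degenerate[OF gB(2)] and dg = degenerate[OF gB(1)]
    and dG = degenerate[OF G(1)]
  note hdA = h_degenerate[OF A(1) edge_ops(1)] h_degenerate[OF A(1) edge_ops(2)]
    and hdB = h_degenerate[OF gB(2) edge_ops(1)] h_degenerate[OF gB(2) edge_ops(2)]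
    and hdg = h_degenerate[OF gB(1) edge_ops(1)] h_degenerate[OF gB(1) edge_ops(2)]
    and hdG = h_degenerate[OF G(1) edge_ops(3)] h_degenerate[OF G(1) edge_ops(4)]
      h_degenerate[OF G(1) edge_ops(5)]
  obtain y a b where y: "y \<in> bcells W 2 1" "vact W 2 1 [0] y = G'" "vact W 2 1 [1] y = G"
    and ab: "a \<in> bcells W 1 2" "b \<in> bcells W 1 2" "hact W 1 2 [1] a = hact W 1 2 [0] b"
    and a: "vact W 1 2 [0, 2] a = hact W 2 1 [0, 1] y" "vact W 1 2 [0, 1] a = vact W 1 0 [0, 0] g"
      "vact W 1 2 [1, 2] a = vact W 1 0 [0, 0] g"
    and b: "vact W 1 2 [0, 2] b = hact W 2 1 [1, 2] y" "vact W 1 2 [0, 1] b = vact W 1 0 [0, 0] B"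
      "vact W 1 2 [1, 2] b = vact W 1 0 [0, 0] B"
    using spine_edge[OF G g B] by blast
  \<comment> \<open>The homotopies \<open>a\<close> and \<open>b\<close> concern only the spine. A
    compatible spatial triangle \<open>c\<close> on the long edges is needed before they can be
    lifted to triangles; \<open>c\<close> contains the path \<open>p\<close> and the constant path
    at \<open>A\<close>.\<close>
  define p where "p = hact W 2 1 [0, 2] y"
  have p: "p \<in> bcells W 1 1" "vact W 1 1 [1] p = hact W 2 0 [0, 2] (vact W 2 1 [1] y)"
    using y(1) by (simp_all add: p_def W_simps)
  have "vact W 0 2 [1, 2] (hact W 1 2 [0] a) = hact W 1 1 [0] (vact W 1 2 [1, 2] a)"
    "vact W 0 2 [0, 2] (hact W 1 2 [0] a) = hact W 1 1 [0] (vact W 1 2 [0, 2] a)"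
    "vact W 0 2 [1, 2] (hact W 1 2 [1] b) = hact W 1 1 [1] (vact W 1 2 [1, 2] b)"
    "vact W 0 2 [0, 2] (hact W 1 2 [1] b) = hact W 1 1 [1] (vact W 1 2 [0, 2] b)"
    "hact W 1 2 [0] a \<in> bcells W 0 2" "hact W 1 2 [1] b \<in> bcells W 0 2"
    using ab(1,2) by (simp_all add: W_simps)
  then obtain c where c: "c \<in> bcells W 1 2" "vact W 1 2 [1, 2] c = vact W 1 0 [0, 0] A"
    "vact W 1 2 [0, 2] c = p" "hact W 1 2 [0] c = hact W 1 2 [0] a" "hact W 1 2 [1] c = hact W 1 2 [1] b"
    using fill_triangle_1[OF dA(1) p(1), of "hact W 1 2 [0] a" "hact W 1 2 [1] b"]
      p y GA gB a b dA hdA hdB hdg A triangle_vertices[OF y(1)] by (auto simp: p_def)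
  have "\<exists>w\<in>bcells W 2 2. vact W 2 2 [1, 2] w = vact W 2 0 [0, 0] G \<and> vact W 2 2 [0, 2] w = y \<and>
    hact W 2 2 [0, 1] w = a \<and> hact W 2 2 [1, 2] w = b \<and> hact W 2 2 [0, 2] w = c"
    by (rule fill_triangle_2_2[OF ab(1,2) c(1) ab(3)])
      (use c y dG hdG g B GA a b in \<open>simp_all add: p_def\<close>)
  then obtain z where z: "z \<in> bcells W 2 2" "vact W 2 2 [1, 2] z = vact W 2 0 [0, 0] G"
    "vact W 2 2 [0, 2] z = y" "hact W 2 2 [0, 1] z = a" "hact W 2 2 [1, 2] z = b"
    by blast
  \<comment> \<open>\<open>\<gamma>\<close> replaces \<open>y\<close>: it still runs from
    \<open>G'\<close> to \<open>G\<close>, but its spine is now constant, since \<open>a\<close> and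
    \<open>b\<close> are constant along \<open>[0, 1]\<close>. Only its long edge \<open>L\<close>
    may still vary, and it is a loop at \<open>A\<close>.\<close>
  define \<gamma> where "\<gamma> = vact W 2 2 [0, 1] z"
  have "\<gamma> \<in> bcells W 2 1" "vact W 2 1 [0] \<gamma> = vact W 2 1 [0] (vact W 2 2 [0, 2] z)"
    "vact W 2 1 [1] \<gamma> = vact W 2 1 [0] (vact W 2 2 [1, 2] z)"
    "hact W 2 1 [0, 1] \<gamma> = vact W 1 2 [0, 1] (hact W 2 2 [0, 1] z)"
    "hact W 2 1 [1, 2] \<gamma> = vact W 1 2 [0, 1] (hact W 2 2 [1, 2] z)"
    using z(1) by (simp_all add: \<gamma>_def W_simps)
  then have \<gamma>: "\<gamma> \<in> bcells W 2 1" "vact W 2 1 [0] \<gamma> = G'" "vact W 2 1 [1] \<gamma> = G"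
    "hact W 2 1 [0, 1] \<gamma> = vact W 1 0 [0, 0] g" "hact W 2 1 [1, 2] \<gamma> = vact W 1 0 [0, 0] B"
    using z y dG a b by simp_all
  define L where "L = hact W 2 1 [0, 2] \<gamma>"
  have "L \<in> bcells W 1 1" "vact W 1 1 [0] L = hact W 2 0 [0, 2] (vact W 2 1 [0] \<gamma>)"
    "vact W 1 1 [1] L = hact W 2 0 [0, 2] (vact W 2 1 [1] \<gamma>)"
    using \<gamma>(1) by (simp_all add: L_def W_simps)
  then have L: "L \<in> bcells W 1 1" "vact W 1 1 [0] L = A" "vact W 1 1 [1] L = A"
    "hact W 1 1 [0] L = vact W 0 0 [0, 0] x" "hact W 1 1 [1] L = vact W 0 0 [0, 0] u"
    using \<gamma> GA triangle_vertices[OF \<gamma>(1)] hdg hdB gB by (simp_all add: L_def)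
  have m: "cells (map_space W x u) 1 = {w \<in> bcells W 1 1. hact W 1 1 [0] w = vact W 0 0 [0, 0] x \<and>
      hact W 1 1 [1] w = vact W 0 0 [0, 0] u}" "act (map_space W x u) = vact W 1"
    by (auto simp: map_space_def cst_col(2)[unfolded One_nat_def])
  \<comment> \<open>\<open>\<rho>\<close> contracts \<open>L\<close>: its other two edges are
    constant at \<open>A\<close>. Lifting it over constant homotopies of the spine deforms
    \<open>\<gamma>\<close>, with its ends fixed, into the edge \<open>[0, 2]\<close> of
    \<open>v\<close>, whose long edge is constant as well.\<close>
  have "\<exists>\<rho>\<in>cells (map_space W x u) 2. act (map_space W x u) 2 [1, 2] \<rho> = vact W 1 0 [0, 0] A \<and>
      act (map_space W x u) 2 [0, 2] \<rho> = vact W 1 0 [0, 0] A \<and> act (map_space W x u) 2 [0, 1] \<rho> = L"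
    by (rule contractible_triangle[OF map_contractible]; use L dA hdA A in \<open>simp only: m mem_Collect_eq\<close>)
  then obtain \<rho> where \<rho>: "\<rho> \<in> bcells W 1 2" "hact W 1 2 [0] \<rho> = vact W 0 0 [0, 0, 0] x"
      "hact W 1 2 [1] \<rho> = vact W 0 0 [0, 0, 0] u" "vact W 1 2 [1, 2] \<rho> = vact W 1 0 [0, 0] A"
      "vact W 1 2 [0, 2] \<rho> = vact W 1 0 [0, 0] A" "vact W 1 2 [0, 1] \<rho> = L"
    by (auto simp: m map_space_cells cst_col)
  have "\<exists>w\<in>bcells W 2 2. vact W 2 2 [1, 2] w = vact W 2 0 [0, 0] G \<and> vact W 2 2 [0, 1] w = \<gamma> \<and>
    hact W 2 2 [0, 1] w = vact W 1 0 [0, 0, 0] g \<and> hact W 2 2 [1, 2] w = vact W 1 0 [0, 0, 0] B \<and>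
    hact W 2 2 [0, 2] w = \<rho>"
    by (rule fill_triangle_2_1[OF dg(2) dB(2) \<rho>(1)])
      (use \<rho> \<gamma> dG dg dB hdG hdg hdB g B GA gB in \<open>simp_all add: L_def\<close>)
  then obtain v where v: "v \<in> bcells W 2 2" "vact W 2 2 [1, 2] v = vact W 2 0 [0, 0] G"
    "vact W 2 2 [0, 1] v = \<gamma>" "hact W 2 2 [1, 2] v = vact W 1 0 [0, 0, 0] B" "hact W 2 2 [0, 2] v = \<rho>"
    by blast
  have "vact W 2 2 [0, 2] v \<in> bcells W 2 1"
    "vact W 2 1 [0] (vact W 2 2 [0, 2] v) = vact W 2 1 [0] (vact W 2 2 [0, 1] v)"
    "vact W 2 1 [1] (vact W 2 2 [0, 2] v) = vact W 2 1 [1] (vact W 2 2 [1, 2] v)"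
    "hact W 2 1 [1, 2] (vact W 2 2 [0, 2] v) = vact W 1 2 [0, 2] (hact W 2 2 [1, 2] v)"
    "hact W 2 1 [0, 2] (vact W 2 2 [0, 2] v) = vact W 1 2 [0, 2] (hact W 2 2 [0, 2] v)"
    using v(1) by (simp_all add: W_simps)
  then show ?thesis
    using v \<gamma> dG dB \<rho> by (intro bexI[of _ "vact W 2 2 [0, 2] v"]) simp_all
qed

text \<open>Path lifting starting at \<open>F\<close>, with the structure maps \<open>A\<close> and
  \<open>B\<close> held constant. Nothing is said about the triangle at the other end; identifying
  it with a given one is the purpose of \<open>triangle_unique\<close>.\<close>

lemma lift_edge:
  assumes F: "F \<in> bcells W 2 0" "hact W 2 0 [0, 2] F = A" "hact W 2 0 [1, 2] F = B"
    and e: "e \<in> bcells W 1 1" "hact W 1 1 [0] e = vact W 0 0 [0, 0] x"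
      "hact W 1 1 [1] e = vact W 0 0 [0, 0] (hact W 1 0 [0] B)" "vact W 1 1 [0] e = hact W 2 0 [0, 1] F"
  shows "\<exists>w\<in>bcells W 2 1. hact W 2 1 [0, 1] w = e \<and> hact W 2 1 [0, 2] w = vact W 1 0 [0, 0] A \<and>
    hact W 2 1 [1, 2] w = vact W 1 0 [0, 0] B \<and> vact W 2 1 [0] w = F"
proof -
  have B: "B \<in> bcells W 1 0" "hact W 1 0 [1] B = u"
    using h_cells[OF F(1) edge_ops(4)] triangle_vertices[OF F(1)] F A by simp_all
  have "\<exists>w\<in>bcells W 2 1. hact W 2 1 [0, 1] w = e \<and> hact W 2 1 [1, 2] w = vact W 1 0 [0, 0] B \<and>
    hact W 2 1 [0, 2] w = vact W 1 0 [0, 0] A \<and> vact W 2 1 [0] w = F"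
    by (rule lift_path_2[OF F(1) e(1) degenerate(1)[OF B(1)] degenerate(1)[OF A(1)]])
      (use h_degenerate(1)[OF A(1) edge_ops(1)] h_degenerate(1)[OF A(1) edge_ops(2)]
        h_degenerate(1)[OF B(1) edge_ops(1)] h_degenerate(1)[OF B(1) edge_ops(2)]
        degenerate(3)[OF A(1)] degenerate(3)[OF B(1)] e A B F in simp_all)
  then show ?thesis by blast
qed

end

end


section \<open>The filter quotient of a Segal space\<close>

context segal
begin

lemma over_0_iff: "A \<in> bcells (css_over W v) 0 0 \<longleftrightarrow> A \<in> bcells W 1 0 \<and> hact W 1 0 [1] A = vact W 0 0 [0] v"
  by (auto simp: css_over_def cst_col(1)[unfolded One_nat_def])

lemma over_h_cells:
  assumes w: "w \<in> bcells (css_over W v) n l" and \<theta>: "\<theta> \<in> ops m n"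
  shows "hact (css_over W v) n l \<theta> w \<in> bcells (css_over W v) m l"
proof -
  have "w \<in> cells (over (row W l) (cst (col W 0) l v)) n"
    using w by (simp add: css_over_def over_def row_def)
  then show ?thesis
    using over_cells[OF row_simplicial _ \<theta>] by (simp add: css_over_def over_def row_def)
qed

lemma over_v_cells:
  assumes v: "v \<in> bcells W 0 0" and w: "w \<in> bcells (css_over W v) n l" and \<phi>: "\<phi> \<in> ops k l"
  shows "vact (css_over W v) n l \<phi> w \<in> bcells (css_over W v) n k"
proof -
  have w': "w \<in> bcells W (Suc n) l" "hact W (Suc n) l [Suc n] w = cst (col W 0) l v"
    using w by (simp_all add: css_over_def)
  have last: "[Suc n] \<in> ops 0 (Suc n)" by (simp add: ops_def)
  have "length \<phi> - 1 = k" using \<phi> by (simp add: ops_def)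
  then have "hact W (Suc n) k [Suc n] (vact W (Suc n) l \<phi> w) = vact W 0 l \<phi> (hact W (Suc n) l [Suc n] w)"
    using vh[OF w'(1) last, of \<phi>] \<phi> by simp
  also have "\<dots> = cst (col W 0) k v"
    using act_cst[OF col_simplicial[of 0], of v \<phi> k l] v \<phi> w'(2) by (simp add: col_def)
  finally show ?thesis using v_cells[OF w'(1) \<phi>] by (simp add: css_over_def)
qed

end

locale segal_filter = segal W for W :: "'w bisset" +
  fixes \<Phi> :: "'w set set" and rep :: "'w set \<Rightarrow> 'w"
    and T :: "'w set \<Rightarrow> 'w set \<Rightarrow> nat \<Rightarrow> nat \<Rightarrow> 'w \<Rightarrow> 'w"
  assumes pcf: "product_closed_filter (css_homs W) (css_product W) \<Phi>"
    and filter_diagram: "css_filter_diagram W \<Phi> rep T"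

sublocale segal_filter \<subseteq> final_filter "css_homs W" "css_product W" \<Phi>
proof
  show "product_closed_filter (css_homs W) (css_product W) \<Phi>" by (rule pcf)
  fix x y z assume "x \<in> obj (css_homs W)"
  then have x: "x \<in> bcells W 0 0" by (simp add: css_homs_def)
  have "hact W 0 0 [0, 0] x \<in> cells (map_space W x x) 0"
    using x h_id[OF x] by (simp add: map_space_0 W_simps)
  then show "cells (maps (css_homs W) x x) 0 \<noteq> {}" by (auto simp: css_homs_def)
  assume "y \<in> obj (css_homs W)" "z \<in> obj (css_homs W)" and
    h: "cells (maps (css_homs W) x y) 0 \<noteq> {}" "cells (maps (css_homs W) y z) 0 \<noteq> {}"
  then have y: "y \<in> bcells W 0 0" and z: "z \<in> bcells W 0 0" by (simp_all add: css_homs_def)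
  obtain f g where "f \<in> cells (map_space W x y) 0" "g \<in> cells (map_space W y z) 0"
    using h by (auto simp: css_homs_def)
  then have fg: "f \<in> bcells W 1 0" "hact W 1 0 [0] f = x" "hact W 1 0 [1] f = y"
    "g \<in> bcells W 1 0" "hact W 1 0 [0] g = y" "hact W 1 0 [1] g = z"
    by (simp_all add: map_space_0[OF x y] map_space_0[OF y z])
  then obtain \<sigma> where \<sigma>: "\<sigma> \<in> bcells W 2 0" "hact W 2 0 [0, 1] \<sigma> = f" "hact W 2 0 [1, 2] \<sigma> = g"
    using compose[of f g] by auto
  then have "hact W 2 0 [0, 2] \<sigma> \<in> cells (map_space W x z) 0"
    using triangle_vertices[OF \<sigma>(1)] h_cells[OF \<sigma>(1) edge_ops(5)] fg by (simp add: map_space_0[OF x z])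
  then show "cells (maps (css_homs W) x z) 0 \<noteq> {}" by (auto simp: css_homs_def)
next
  fix a b r assume "a \<in> obj (css_homs W)" "b \<in> obj (css_homs W)" and prd: "css_product W a b r"
  then have ab: "a \<in> bcells W 0 0" "b \<in> bcells W 0 0" by (simp_all add: css_homs_def)
  obtain p q where "(p, q) \<in> bcells (css_pair_cones W a b) 0 0" "hact W 1 0 [0] p = r"
    using prd by (auto simp: css_product_def css_product_cone_def final_object_def css_homs_def)
  then have pq: "p \<in> bcells W 1 0" "q \<in> bcells W 1 0" "hact W 1 0 [1] p = a" "hact W 1 0 [1] q = b"
    "hact W 1 0 [0] p = hact W 1 0 [0] q" "hact W 1 0 [0] p = r"
    using v_id(1)[OF ab(1)] v_id(1)[OF ab(2)]
    by (simp_all add: css_pair_cones_def pair_cones_def cst_col row_def)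
  have r: "r \<in> bcells W 0 0" using h_cells[OF pq(1) edge_ops(1)] pq(6) by simp
  then show "cells (maps (css_homs W) r a) 0 \<noteq> {} \<and> cells (maps (css_homs W) r b) 0 \<noteq> {}"
    using map_space_0[OF r ab(1), of p] map_space_0[OF r ab(2), of q] pq by (auto simp: css_homs_def)
qed

context segal_filter
begin

abbreviation le :: "'w set \<Rightarrow> 'w set \<Rightarrow> bool" where "le \<equiv> sub_le (css_homs W)"

abbreviation top1 :: "'w set" where "top1 \<equiv> sub_top (css_homs W)"

abbreviation slice :: "'w set \<Rightarrow> 'w bisset" where "slice p \<equiv> css_over W (rep p)"

abbreviation cls :: "nat \<Rightarrow> nat \<Rightarrow> 'w set \<Rightarrow> 'w \<Rightarrow> ('w set \<times> 'w) set" where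
  "cls \<equiv> css_class W \<Phi> rep T"

abbreviation quot :: "('w set \<times> 'w) set bisset" where "quot \<equiv> css_filter_quotient W \<Phi> rep T"

lemma rep_subfinal: "p \<in> \<Phi> \<Longrightarrow> subfinal (css_homs W) (rep p)"
  using member_subfinal[of p "rep p"] filter_diagram by (simp add: css_filter_diagram_def)

lemma rep_cells: "p \<in> \<Phi> \<Longrightarrow> rep p \<in> bcells W 0 0"
  using rep_subfinal by (simp add: subfinal_def css_homs_def)

lemma slice_h: "\<lbrakk>w \<in> bcells (slice p) n l; \<theta> \<in> ops m n\<rbrakk> \<Longrightarrow> hact (slice p) n l \<theta> w \<in> bcells (slice p) m l"
  by (rule over_h_cells)

lemma slice_v: "\<lbrakk>p \<in> \<Phi>; w \<in> bcells (slice p) n l; \<phi> \<in> ops k l\<rbrakk>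
    \<Longrightarrow> vact (slice p) n l \<phi> w \<in> bcells (slice p) n k"
  by (rule over_v_cells[OF rep_cells])

lemma T_map: "\<lbrakk>p \<in> \<Phi>; q \<in> \<Phi>; le q p\<rbrakk> \<Longrightarrow> bisimp_map (slice p) (slice q) (T p q)"
  using filter_diagram by (simp add: css_filter_diagram_def css_times_functor_def)

context
  fixes p q n l x assumes p: "p \<in> \<Phi>" "q \<in> \<Phi>" "le q p" and x: "x \<in> bcells (slice p) n l"
begin

lemma T_cells: "T p q n l x \<in> bcells (slice q) n l"
proof -
  have "simp_map (col (slice p) n) (col (slice q) n) (T p q n)"
    using T_map[OF p] by (simp add: bisimp_map_def)
  then show ?thesis using x by (simp add: simp_map_def col_def)
qed

lemma T_v:
  assumes "\<phi> \<in> ops k l"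
  shows "T p q n k (vact (slice p) n l \<phi> x) = vact (slice q) n l \<phi> (T p q n l x)"
proof -
  have "simp_map (col (slice p) n) (col (slice q) n) (T p q n)"
    using T_map[OF p] by (simp add: bisimp_map_def)
  then show ?thesis using x assms by (simp add: simp_map_def col_def)
qed

lemma T_h:
  assumes "\<theta> \<in> ops m n"
  shows "T p q m l (hact (slice p) n l \<theta> x) = hact (slice q) n l \<theta> (T p q n l x)"
proof -
  have "simp_map (row (slice p) l) (row (slice q) l) (\<lambda>n. T p q n l)"
    using T_map[OF p] by (simp add: bisimp_map_def)
  then show ?thesis using x assms by (simp add: simp_map_def row_def)
qed

end

lemma T_diagram: "diagram (\<lambda>p. bcells (slice p) n l) (\<lambda>p q. T p q n l)"
  using filter_diagram by (simp add: diagram_def css_filter_diagram_def T_cells)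

lemma T_comp: "\<lbrakk>p \<in> \<Phi>; q \<in> \<Phi>; r \<in> \<Phi>; le q p; le r q; x \<in> bcells (slice p) n l\<rbrakk>
    \<Longrightarrow> T q r n l (T p q n l x) = T p r n l x"
  using diagram_comp[OF T_diagram] by blast

lemma quot_h:
  assumes p: "p \<in> \<Phi>" "x \<in> bcells (slice p) n l" and \<theta>: "\<theta> \<in> ops m n"
  shows "hact quot n l \<theta> (cls n l p x) = cls m l p (hact (slice p) n l \<theta> x)"
proof -
  have "hact quot n l \<theta> c = (\<Union>(q, y)\<in>c. cls m l q (hact (slice q) n l \<theta> y))" for c
    using \<theta> by (simp add: css_filter_quotient_def ops_def)
  then show ?thesis
    unfolding css_class_def
    using UN_class[OF T_diagram T_diagram p, of "\<lambda>q. hact (slice q) n l \<theta>" m l] slice_h T_h \<theta> by simp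
qed

lemma quot_v:
  assumes p: "p \<in> \<Phi>" "x \<in> bcells (slice p) n l" and \<phi>: "\<phi> \<in> ops k l"
  shows "vact quot n l \<phi> (cls n l p x) = cls n k p (vact (slice p) n l \<phi> x)"
proof -
  have "vact quot n l \<phi> c = (\<Union>(q, y)\<in>c. cls n k q (vact (slice q) n l \<phi> y))" for c
    using \<phi> by (simp add: css_filter_quotient_def ops_def)
  then show ?thesis
    unfolding css_class_def
    using UN_class[OF T_diagram T_diagram p, of "\<lambda>q. vact (slice q) n l \<phi>" n k] slice_v T_v \<phi> by simp
qed

lemma quot_cells: "bcells quot n l = {cls n l p x | p x. p \<in> \<Phi> \<and> x \<in> bcells (slice p) n l}"
  by (simp add: css_filter_quotient_def colim_set_def css_class_def)

lemma cls_push: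
  "\<lbrakk>p \<in> \<Phi>; q \<in> \<Phi>; le q p; x \<in> bcells (slice p) n l\<rbrakk> \<Longrightarrow> cls n l q (T p q n l x) = cls n l p x"
  unfolding css_class_def by (rule class_push[OF T_diagram])

lemma cls_eqD:
  assumes "p \<in> \<Phi>" "x \<in> bcells (slice p) n l" "y \<in> bcells (slice p) n l" "cls n l p x = cls n l p y"
  shows "\<exists>r\<in>\<Phi>. le r p \<and> T p r n l x = T p r n l y"
  using class_eq_iff[OF T_diagram assms(1,2,1,3)] assms(4) unfolding css_class_def by auto

lemma T_eq_mono:
  assumes "p \<in> \<Phi>" "r \<in> \<Phi>" "s \<in> \<Phi>" "le r p" "le s r" "x \<in> bcells (slice p) n l" "y \<in> bcells (slice p) n l"
    and "T p r n l x = T p r n l y"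
  shows "T p s n l x = T p s n l y"
  using T_comp[OF assms(1-6)] T_comp[OF assms(1-5,7)] assms(8) by simp

context
  fixes X Y assumes X: "X \<in> bcells (slice top1) 0 0" and Y: "Y \<in> bcells (slice top1) 0 0"
begin

abbreviation stage :: "'w set \<Rightarrow> 'w sset" where
  "stage p \<equiv> map_space (slice p) (css_times W T X p) (css_times W T Y p)"

lemma times_cells: "p \<in> \<Phi> \<Longrightarrow> css_times W T X p \<in> bcells (slice p) 0 0"
    "p \<in> \<Phi> \<Longrightarrow> css_times W T Y p \<in> bcells (slice p) 0 0"
  using T_cells[OF top_in _ le_top] X Y by (simp_all add: css_times_def)

lemma times_T: "\<lbrakk>p \<in> \<Phi>; q \<in> \<Phi>; le q p\<rbrakk> \<Longrightarrow> T p q 0 0 (css_times W T X p) = css_times W T X q"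
    "\<lbrakk>p \<in> \<Phi>; q \<in> \<Phi>; le q p\<rbrakk> \<Longrightarrow> T p q 0 0 (css_times W T Y p) = css_times W T Y q"
  using T_comp[OF top_in _ _ le_top] X Y by (simp_all add: css_times_def)

lemma cls_times: "p \<in> \<Phi> \<Longrightarrow> cls 0 0 p (css_times W T X p) = css_P W \<Phi> rep T 0 0 X"
    "p \<in> \<Phi> \<Longrightarrow> cls 0 0 p (css_times W T Y p) = css_P W \<Phi> rep T 0 0 Y"
  using cls_push[OF top_in _ le_top] X Y by (simp_all add: css_times_def css_P_def)

lemma edge_stage: "edge (stage p) F G \<longleftrightarrow> (\<exists>\<sigma>\<in>bcells (slice p) 1 1.
    hact (slice p) 1 1 [0] \<sigma> = vact (slice p) 0 0 [0, 0] (css_times W T X p) \<and>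
    hact (slice p) 1 1 [1] \<sigma> = vact (slice p) 0 0 [0, 0] (css_times W T Y p) \<and>
    vact (slice p) 1 1 [0] \<sigma> = F \<and> vact (slice p) 1 1 [1] \<sigma> = G)"
  by (auto simp: edge_def map_space_def cst_def col_def)

lemma edge_quot: "edge (css_filter_maps W \<Phi> rep T X Y) f g \<longleftrightarrow> (\<exists>e\<in>bcells quot 1 1.
    hact quot 1 1 [0] e = vact quot 0 0 [0, 0] (css_P W \<Phi> rep T 0 0 X) \<and>
    hact quot 1 1 [1] e = vact quot 0 0 [0, 0] (css_P W \<Phi> rep T 0 0 Y) \<and>
    vact quot 1 1 [0] e = f \<and> vact quot 1 1 [1] e = g)"
  by (auto simp: edge_def css_filter_maps_def map_space_def cst_def col_def)

lemma degenerate_op: "[0, 0] \<in> ops 1 0"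
  by (simp add: ops_simps)

text \<open>A path of morphisms in the quotient is represented in one slice, but its source and
  target are constant only as classes. The two equations are realised at \<open>r1\<close> and
  \<open>r2\<close>; below both, the representative is a path in a mapping space of the
  slice.\<close>

lemma edge_quot_iff: "edge (css_filter_maps W \<Phi> rep T X Y) f g \<longleftrightarrow>
    (\<exists>r\<in>\<Phi>. \<exists>F G. edge (stage r) F G \<and> f = cls 1 0 r F \<and> g = cls 1 0 r G)"
proof
  assume "edge (css_filter_maps W \<Phi> rep T X Y) f g"
  then obtain e where e: "e \<in> bcells quot 1 1"
    "hact quot 1 1 [0] e = vact quot 0 0 [0, 0] (css_P W \<Phi> rep T 0 0 X)"
    "hact quot 1 1 [1] e = vact quot 0 0 [0, 0] (css_P W \<Phi> rep T 0 0 Y)"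
    "vact quot 1 1 [0] e = f" "vact quot 1 1 [1] e = g"
    unfolding edge_quot by blast
  then obtain p \<sigma> where p: "p \<in> \<Phi>" and \<sigma>: "\<sigma> \<in> bcells (slice p) 1 1" "e = cls 1 1 p \<sigma>"
    by (auto simp: quot_cells)
  have c: "hact (slice p) 1 1 [0] \<sigma> \<in> bcells (slice p) 0 1" "hact (slice p) 1 1 [1] \<sigma> \<in> bcells (slice p) 0 1"
    "vact (slice p) 0 0 [0, 0] (css_times W T X p) \<in> bcells (slice p) 0 1"
    "vact (slice p) 0 0 [0, 0] (css_times W T Y p) \<in> bcells (slice p) 0 1"
    using slice_h[OF \<sigma>(1)] edge_ops slice_v[OF p _ degenerate_op] times_cells[OF p] by simp_all
  have "cls 0 1 p (hact (slice p) 1 1 [0] \<sigma>) = cls 0 1 p (vact (slice p) 0 0 [0, 0] (css_times W T X p))"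
    using e(2) \<sigma>(2) quot_h[OF p \<sigma>(1) edge_ops(1)] quot_v[OF p times_cells(1)[OF p] degenerate_op]
      cls_times(1)[OF p] by simp
  from cls_eqD[OF p c(1,3) this] obtain r1 where r1: "r1 \<in> \<Phi>" "le r1 p"
    "T p r1 0 1 (hact (slice p) 1 1 [0] \<sigma>) = T p r1 0 1 (vact (slice p) 0 0 [0, 0] (css_times W T X p))"
    by blast
  have "cls 0 1 p (hact (slice p) 1 1 [1] \<sigma>) = cls 0 1 p (vact (slice p) 0 0 [0, 0] (css_times W T Y p))"
    using e(3) \<sigma>(2) quot_h[OF p \<sigma>(1) edge_ops(2)] quot_v[OF p times_cells(2)[OF p] degenerate_op]
      cls_times(2)[OF p] by simp
  from cls_eqD[OF p c(2,4) this] obtain r2 where r2: "r2 \<in> \<Phi>" "le r2 p"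
    "T p r2 0 1 (hact (slice p) 1 1 [1] \<sigma>) = T p r2 0 1 (vact (slice p) 0 0 [0, 0] (css_times W T Y p))"
    by blast
  obtain r where r: "r \<in> \<Phi>" "le r r1" "le r r2" using lower_bound r1 r2 by blast
  have rp: "le r p" using le_trans[OF p r1(1) r(1) r1(2) r(2)] .
  define \<tau> where "\<tau> = T p r 1 1 \<sigma>"
  have s: "\<tau> \<in> bcells (slice r) 1 1" "e = cls 1 1 r \<tau>"
    using T_cells[OF p r(1) rp \<sigma>(1)] cls_push[OF p r(1) rp \<sigma>(1)] \<sigma>(2) by (simp_all add: \<tau>_def)
  have "hact (slice r) 1 1 [0] \<tau> = vact (slice r) 0 0 [0, 0] (css_times W T X r)"
    using T_eq_mono[OF p r1(1) r(1) r1(2) r(2) c(1,3) r1(3)] T_h[OF p r(1) rp \<sigma>(1) edge_ops(1)]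
      T_v[OF p r(1) rp times_cells(1)[OF p] degenerate_op] times_T(1)[OF p r(1) rp]
    by (simp add: \<tau>_def)
  moreover have "hact (slice r) 1 1 [1] \<tau> = vact (slice r) 0 0 [0, 0] (css_times W T Y r)"
    using T_eq_mono[OF p r2(1) r(1) r2(2) r(3) c(2,4) r2(3)] T_h[OF p r(1) rp \<sigma>(1) edge_ops(2)]
      T_v[OF p r(1) rp times_cells(2)[OF p] degenerate_op] times_T(2)[OF p r(1) rp]
    by (simp add: \<tau>_def)
  ultimately have "edge (stage r) (vact (slice r) 1 1 [0] \<tau>) (vact (slice r) 1 1 [1] \<tau>)"
    unfolding edge_stage using s(1) by blast
  moreover have "f = cls 1 0 r (vact (slice r) 1 1 [0] \<tau>)" "g = cls 1 0 r (vact (slice r) 1 1 [1] \<tau>)"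
    using e(4,5) s(2) quot_v[OF r(1) s(1) edge_ops(1)] quot_v[OF r(1) s(1) edge_ops(2)] by simp_all
  ultimately show "\<exists>r\<in>\<Phi>. \<exists>F G. edge (stage r) F G \<and> f = cls 1 0 r F \<and> g = cls 1 0 r G"
    using r(1) by blast
next
  assume "\<exists>r\<in>\<Phi>. \<exists>F G. edge (stage r) F G \<and> f = cls 1 0 r F \<and> g = cls 1 0 r G"
  then obtain r \<sigma> where r: "r \<in> \<Phi>" and \<sigma>: "\<sigma> \<in> bcells (slice r) 1 1"
    "hact (slice r) 1 1 [0] \<sigma> = vact (slice r) 0 0 [0, 0] (css_times W T X r)"
    "hact (slice r) 1 1 [1] \<sigma> = vact (slice r) 0 0 [0, 0] (css_times W T Y r)"
    "f = cls 1 0 r (vact (slice r) 1 1 [0] \<sigma>)" "g = cls 1 0 r (vact (slice r) 1 1 [1] \<sigma>)"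
    unfolding edge_stage by blast
  have "cls 1 1 r \<sigma> \<in> bcells quot 1 1" using r \<sigma>(1) by (auto simp: quot_cells)
  moreover have "hact quot 1 1 [0] (cls 1 1 r \<sigma>) = vact quot 0 0 [0, 0] (css_P W \<Phi> rep T 0 0 X)"
    using quot_h[OF r \<sigma>(1) edge_ops(1)] quot_v[OF r times_cells(1)[OF r] degenerate_op]
      cls_times(1)[OF r] \<sigma>(2) by simp
  moreover have "hact quot 1 1 [1] (cls 1 1 r \<sigma>) = vact quot 0 0 [0, 0] (css_P W \<Phi> rep T 0 0 Y)"
    using quot_h[OF r \<sigma>(1) edge_ops(2)] quot_v[OF r times_cells(2)[OF r] degenerate_op]
      cls_times(2)[OF r] \<sigma>(3) by simp
  moreover have "vact quot 1 1 [0] (cls 1 1 r \<sigma>) = f" "vact quot 1 1 [1] (cls 1 1 r \<sigma>) = g"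
    using quot_v[OF r \<sigma>(1) edge_ops(1)] quot_v[OF r \<sigma>(1) edge_ops(2)] \<sigma>(4,5) by simp_all
  ultimately show "edge (css_filter_maps W \<Phi> rep T X Y) f g"
    unfolding edge_quot by blast
qed

lemma stage_cells: "F \<in> cells (stage p) 0 \<Longrightarrow> F \<in> bcells (slice p) 1 0"
  by (simp add: map_space_def)

lemma edge_stage_cells:
  assumes p: "p \<in> \<Phi>" and "edge (stage p) F G"
  shows "F \<in> bcells (slice p) 1 0 \<and> G \<in> bcells (slice p) 1 0"
  using assms(2) slice_v[OF p _ edge_ops(1)] slice_v[OF p _ edge_ops(2)]
  unfolding edge_stage by blast

lemma edge_stage_T:
  assumes p: "p \<in> \<Phi>" "q \<in> \<Phi>" "le q p" and "edge (stage p) F G"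
  shows "edge (stage q) (T p q 1 0 F) (T p q 1 0 G)"
proof -
  obtain \<sigma> where \<sigma>: "\<sigma> \<in> bcells (slice p) 1 1"
    "hact (slice p) 1 1 [0] \<sigma> = vact (slice p) 0 0 [0, 0] (css_times W T X p)"
    "hact (slice p) 1 1 [1] \<sigma> = vact (slice p) 0 0 [0, 0] (css_times W T Y p)"
    "vact (slice p) 1 1 [0] \<sigma> = F" "vact (slice p) 1 1 [1] \<sigma> = G"
    using assms(4) unfolding edge_stage by blast
  show ?thesis
    unfolding edge_stage
    by (rule bexI[OF _ T_cells[OF p \<sigma>(1)]])
      (use T_h[OF p \<sigma>(1) edge_ops(1)] T_h[OF p \<sigma>(1) edge_ops(2)] T_v[OF p \<sigma>(1) edge_ops(1)]
        T_v[OF p \<sigma>(1) edge_ops(2)] T_v[OF p times_cells(1)[OF p(1)] degenerate_op]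
        T_v[OF p times_cells(2)[OF p(1)] degenerate_op] times_T[OF p] \<sigma> in simp)
qed

lemma stage_components:
  assumes V: "V \<in> \<Phi>" "F \<in> cells (stage V) 0" "G \<in> cells (stage V) 0"
  shows "same_component (css_filter_maps W \<Phi> rep T X Y) (cls 1 0 V F) (cls 1 0 V G) \<longleftrightarrow>
    (\<exists>U\<in>\<Phi>. same_component (stage (sub_meet (css_product W) V U))
       (T V (sub_meet (css_product W) V U) 1 0 F) (T V (sub_meet (css_product W) V U) 1 0 G))"
proof -
  note st = stage_cells[OF V(2)] stage_cells[OF V(3)]
  have "equivclp (edge (css_filter_maps W \<Phi> rep T X Y)) (cls 1 0 V F) (cls 1 0 V G) \<longleftrightarrow>
    (\<exists>r\<in>\<Phi>. le r V \<and> equivclp (edge (stage r)) (T V r 1 0 F) (T V r 1 0 G))"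
    unfolding css_class_def
  proof (rule colim_components[OF T_diagram V(1) st])
    show "F \<in> bcells (slice r) 1 0 \<and> G \<in> bcells (slice r) 1 0" if "r \<in> \<Phi>" "edge (stage r) F G" for r F G
      using edge_stage_cells that .
  qed (use edge_stage_T edge_quot_iff[unfolded css_class_def] in simp_all)
  also have "\<dots> \<longleftrightarrow> (\<exists>U\<in>\<Phi>. equivclp (edge (stage (sub_meet (css_product W) V U)))
       (T V (sub_meet (css_product W) V U) 1 0 F) (T V (sub_meet (css_product W) V U) 1 0 G))"
    by (rule ex_meet_iff[OF T_diagram V(1) st, of "\<lambda>r. edge (stage r)"]) (rule edge_stage_T)
  finally show ?thesis unfolding same_component_eq .
qed

lemma forget_eq: "css_forget W 0 0 A = hact W 1 0 [0] A" "css_forget W 1 0 F = hact W 2 0 [0, 1] F"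
  by (simp_all add: css_forget_def eval_nat_numeral)

lemma slice_act: "hact (slice p) 1 l [0] = hact W 2 l [0, 2]" "hact (slice p) 1 l [1] = hact W 2 l [1, 2]"
    "vact (slice p) n = vact W (Suc n)"
  by (simp_all add: css_over_def eval_nat_numeral)

lemma slice_1: "w \<in> bcells (slice p) 1 l \<longleftrightarrow> w \<in> bcells W 2 l \<and> hact W 2 l [2] w = cst (col W 0) l (rep p)"
  by (simp add: css_over_def eval_nat_numeral)

section \<open>Homotopies over a member of the filter and homotopies in the Segal space\<close>

context
  fixes p A B assumes p: "p \<in> \<Phi>" and A_eq: "A = css_times W T X p" and B_eq: "B = css_times W T Y p"
begin

lemma A_cells: "A \<in> bcells W 1 0" "hact W 1 0 [1] A = rep p"
    and B_cells: "B \<in> bcells W 1 0" "hact W 1 0 [1] B = rep p"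
  using times_cells[OF p] v_id(1)[OF rep_cells[OF p]] by (simp_all add: over_0_iff A_eq B_eq)

lemma stage_0: "F \<in> cells (stage p) 0 \<longleftrightarrow>
    F \<in> bcells W 2 0 \<and> hact W 2 0 [0, 2] F = A \<and> hact W 2 0 [1, 2] F = B"
proof -
  have "hact W 2 0 [2] F = hact W 1 0 [1] (hact W 2 0 [1, 2] F)" if "F \<in> bcells W 2 0"
    using that by (simp add: W_simps)
  moreover have "cst (col (slice p) 0) 0 Z = vact W 1 0 [0] Z" for Z
    by (simp add: cst_def col_def css_over_def)
  ultimately show ?thesis
    using A_cells B_cells v_id(1)[OF A_cells(1)] v_id(1)[OF B_cells(1)] v_id(1)[OF rep_cells[OF p]]
    by (auto simp: map_space_def slice_1[unfolded One_nat_def] slice_act[unfolded One_nat_def] cst_col A_eq B_eq)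
qed

text \<open>That the path stays over the constant path at \<open>rep p\<close> follows from its edge
  \<open>[1, 2]\<close> being constant at \<open>B\<close>, which ends at
  \<open>rep p\<close>.\<close>

lemma edge_stage_iff: "edge (stage p) F G \<longleftrightarrow> (\<exists>w\<in>bcells W 2 1.
    hact W 2 1 [0, 2] w = vact W 1 0 [0, 0] A \<and> hact W 2 1 [1, 2] w = vact W 1 0 [0, 0] B \<and>
    vact W 2 1 [0] w = F \<and> vact W 2 1 [1] w = G)"
proof -
  have "hact W 2 1 [2] w = cst (col W 0) 1 (rep p)"
    if "w \<in> bcells W 2 1" "hact W 2 1 [1, 2] w = vact W 1 0 [0, 0] B" for w
  proof -
    have "hact W 2 1 [2] w = hact W 1 1 [1] (hact W 2 1 [1, 2] w)"
      using that(1) by (simp add: W_simps)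
    then show ?thesis
      using that(2) h_degenerate(1)[OF B_cells(1) edge_ops(2)] B_cells(2) cst_col(2) by simp
  qed
  then show ?thesis
    unfolding edge_stage slice_act slice_1 Bex_def A_eq B_eq by (auto simp: eval_nat_numeral)
qed

lemma forget_edge:
  assumes "edge (stage p) F G"
  shows "edge (map_space W (hact W 1 0 [0] A) (hact W 1 0 [0] B)) (hact W 2 0 [0, 1] F) (hact W 2 0 [0, 1] G)"
proof -
  obtain w where w: "w \<in> bcells W 2 1" "hact W 2 1 [0, 2] w = vact W 1 0 [0, 0] A"
    "hact W 2 1 [1, 2] w = vact W 1 0 [0, 0] B" "vact W 2 1 [0] w = F" "vact W 2 1 [1] w = G"
    using assms unfolding edge_stage_iff by blast
  have "hact W 2 1 [0, 1] w \<in> bcells W 1 1"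
    "vact W 1 1 [0] (hact W 2 1 [0, 1] w) = hact W 2 0 [0, 1] (vact W 2 1 [0] w)"
    "vact W 1 1 [1] (hact W 2 1 [0, 1] w) = hact W 2 0 [0, 1] (vact W 2 1 [1] w)"
    using w(1) by (simp_all add: W_simps)
  moreover have "hact W 1 1 [0] (hact W 2 1 [0, 1] w) = vact W 0 0 [0, 0] (hact W 1 0 [0] A)"
    "hact W 1 1 [1] (hact W 2 1 [0, 1] w) = vact W 0 0 [0, 0] (hact W 1 0 [0] B)"
    using triangle_vertices[OF w(1)] w h_degenerate(1)[OF A_cells(1) edge_ops(1)]
      h_degenerate(1)[OF B_cells(1) edge_ops(1)] by simp_all
  ultimately show ?thesis
    unfolding edge_map_space using w(4,5) by (intro bexI[of _ "hact W 2 1 [0, 1] w"]) simp_all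
qed

text \<open>Path lifting leads from \<open>F\<close> to a triangle \<open>H\<close> with the same
  three edges as \<open>G\<close>, though possibly different from \<open>G\<close>. A second edge,
  from \<open>triangle_unique\<close>, joins \<open>H\<close> to \<open>G\<close>, so the lift of
  one edge is a zigzag of length two.\<close>

lemma lift_edge_components:
  assumes F: "F \<in> cells (stage p) 0" and G: "G \<in> cells (stage p) 0"
    and "edge (map_space W (hact W 1 0 [0] A) (hact W 1 0 [0] B)) (hact W 2 0 [0, 1] F) (hact W 2 0 [0, 1] G)"
  shows "equivclp (edge (stage p)) F G"
proof -
  note sub = rep_subfinal[OF p] and F' = F[unfolded stage_0] and G' = G[unfolded stage_0]
  obtain e where e: "e \<in> bcells W 1 1" "hact W 1 1 [0] e = vact W 0 0 [0, 0] (hact W 1 0 [0] A)"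
      "hact W 1 1 [1] e = vact W 0 0 [0, 0] (hact W 1 0 [0] B)" "vact W 1 1 [0] e = hact W 2 0 [0, 1] F"
      "vact W 1 1 [1] e = hact W 2 0 [0, 1] G"
    using assms(3) unfolding edge_map_space by blast
  obtain w where w: "w \<in> bcells W 2 1" "hact W 2 1 [0, 1] w = e" "hact W 2 1 [0, 2] w = vact W 1 0 [0, 0] A"
    "hact W 2 1 [1, 2] w = vact W 1 0 [0, 0] B" "vact W 2 1 [0] w = F"
    using lift_edge[OF sub A_cells(1) refl A_cells(2), of F B e] F' e by blast
  define H where "H = vact W 2 1 [1] w"
  have "H \<in> bcells W 2 0" "hact W 2 0 [0, 1] H = vact W 1 1 [1] (hact W 2 1 [0, 1] w)"
    "hact W 2 0 [0, 2] H = vact W 1 1 [1] (hact W 2 1 [0, 2] w)"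
    "hact W 2 0 [1, 2] H = vact W 1 1 [1] (hact W 2 1 [1, 2] w)"
    using w(1) by (simp_all add: H_def W_simps)
  then have H: "H \<in> bcells W 2 0" "hact W 2 0 [0, 1] H = hact W 2 0 [0, 1] G"
    "hact W 2 0 [0, 2] H = A" "hact W 2 0 [1, 2] H = B"
    using w e(5) degenerate(4)[OF A_cells(1)] degenerate(4)[OF B_cells(1)] by simp_all
  have "edge (stage p) F H"
    unfolding edge_stage_iff using w by (intro bexI[of _ w]) (simp_all add: H_def)
  moreover have "edge (stage p) H G"
    unfolding edge_stage_iff
    using triangle_unique[OF sub A_cells(1) refl A_cells(2), of G H "hact W 2 0 [0, 1] G" B] H G' by blast
  ultimately show ?thesis by (rule equivclp_trans[OF r_into_equivclp r_into_equivclp])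
qed

text \<open>Forgetting preserves edges. Conversely \<open>equivclp_lift\<close> applies to the
  restriction of a triangle to its edge \<open>[0, 1]\<close>, with \<open>lift_vertex\<close> for
  surjectivity and \<open>lift_edge_components\<close> for the lifting of edges.\<close>

lemma forget_components:
  assumes FG: "F \<in> cells (stage p) 0" "G \<in> cells (stage p) 0"
  shows "same_component (stage p) F G \<longleftrightarrow>
    same_component (map_space W (hact W 1 0 [0] A) (hact W 1 0 [0] B)) (hact W 2 0 [0, 1] F) (hact W 2 0 [0, 1] G)"
proof
  assume "same_component (stage p) F G"
  then show "same_component (map_space W (hact W 1 0 [0] A) (hact W 1 0 [0] B))
      (hact W 2 0 [0, 1] F) (hact W 2 0 [0, 1] G)"
    unfolding same_component_eq
    by (rule equivclp_map) (rule r_into_equivclp, rule forget_edge)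
next
  define x y where "x = hact W 1 0 [0] A" and "y = hact W 1 0 [0] B"
  have xy: "x \<in> bcells W 0 0" "y \<in> bcells W 0 0"
    using h_cells[OF A_cells(1) edge_ops(1)] h_cells[OF B_cells(1) edge_ops(1)] by (simp_all add: x_def y_def)
  assume "same_component (map_space W (hact W 1 0 [0] A) (hact W 1 0 [0] B))
      (hact W 2 0 [0, 1] F) (hact W 2 0 [0, 1] G)"
  then have "equivclp (edge (map_space W x y)) (hact W 2 0 [0, 1] F) (hact W 2 0 [0, 1] G)"
    unfolding same_component_eq x_def y_def .
  then show "same_component (stage p) F G"
    unfolding same_component_eq
  proof (rule equivclp_lift[OF _ FG, where S = "cells (map_space W x y) 0"])
    fix m m' assume "edge (map_space W x y) m m'"
    then obtain w where w: "w \<in> bcells W 1 1" "hact W 1 1 [0] w = vact W 0 0 [0, 0] x"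
      "hact W 1 1 [1] w = vact W 0 0 [0, 0] y" "vact W 1 1 [0] w = m" "vact W 1 1 [1] w = m'"
      unfolding edge_map_space by blast
    have "vact W 1 1 [0] w \<in> bcells W 1 0" "vact W 1 1 [1] w \<in> bcells W 1 0"
      "hact W 1 0 [0] (vact W 1 1 [0] w) = vact W 0 1 [0] (hact W 1 1 [0] w)"
      "hact W 1 0 [1] (vact W 1 1 [0] w) = vact W 0 1 [0] (hact W 1 1 [1] w)"
      "hact W 1 0 [0] (vact W 1 1 [1] w) = vact W 0 1 [1] (hact W 1 1 [0] w)"
      "hact W 1 0 [1] (vact W 1 1 [1] w) = vact W 0 1 [1] (hact W 1 1 [1] w)"
      using w(1) by (simp_all add: W_simps)
    then show "m \<in> cells (map_space W x y) 0 \<and> m' \<in> cells (map_space W x y) 0"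
      unfolding map_space_0[OF xy]
      using w degenerate(3,4)[OF xy(1)] degenerate(3,4)[OF xy(2)] by simp
  next
    fix F assume "F \<in> cells (stage p) 0"
    then have F: "F \<in> bcells W 2 0" "hact W 2 0 [0, 2] F = A" "hact W 2 0 [1, 2] F = B" by (simp_all add: stage_0)
    define m where "m = hact W 2 0 [0, 1] F"
    have m: "m \<in> bcells W 1 0" "hact W 1 0 [0] m = x" "hact W 1 0 [1] m = y"
      using h_cells[OF F(1) edge_ops(3)] triangle_vertices[OF F(1)] F by (simp_all add: m_def x_def y_def)
    have "edge (map_space W x y) m m"
      unfolding edge_map_space
      using degenerate[OF m(1)] h_degenerate(1)[OF m(1) edge_ops(1)] h_degenerate(1)[OF m(1) edge_ops(2)] m
      by (intro bexI[of _ "vact W 1 0 [0, 0] m"]) simp_all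
    then show "edge (map_space W x y) (hact W 2 0 [0, 1] F) (hact W 2 0 [0, 1] F)"
      unfolding m_def .
  next
    fix m assume "m \<in> cells (map_space W x y) 0"
    then have "m \<in> bcells W 1 0" "hact W 1 0 [0] m = hact W 1 0 [0] A" "hact W 1 0 [1] m = hact W 1 0 [0] B"
      unfolding map_space_0[OF xy] by (simp_all add: x_def y_def)
    from lift_vertex[OF rep_subfinal[OF p] A_cells(1) refl A_cells(2) B_cells this]
    show "\<exists>F\<in>cells (stage p) 0. hact W 2 0 [0, 1] F = m"
      by (auto simp: stage_0)
  next
    fix F G assume "F \<in> cells (stage p) 0" "G \<in> cells (stage p) 0"
      and "edge (map_space W x y) (hact W 2 0 [0, 1] F) (hact W 2 0 [0, 1] G)"
    then show "equivclp (edge (stage p)) F G"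
      unfolding x_def y_def by (rule lift_edge_components)
  qed
qed

end

lemma stage_T_cells:
  assumes p: "p \<in> \<Phi>" "q \<in> \<Phi>" "le q p" and F: "F \<in> cells (stage p) 0"
  shows "T p q 1 0 F \<in> cells (stage q) 0"
proof -
  have op: "[0] \<in> ops 0 0" by (simp add: ops_def)
  have c: "cst (col (slice r) 0) 0 Z = vact (slice r) 0 0 [0] Z" for r Z
    by (simp add: cst_def col_def)
  have F': "F \<in> bcells (slice p) 1 0"
    "hact (slice p) 1 0 [0] F = vact (slice p) 0 0 [0] (css_times W T X p)"
    "hact (slice p) 1 0 [1] F = vact (slice p) 0 0 [0] (css_times W T Y p)"
    using F by (simp_all add: map_space_def c)
  show ?thesis
    using T_h[OF p F'(1) edge_ops(1)] T_h[OF p F'(1) edge_ops(2)] T_cells[OF p F'(1)] F'(2,3)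
      T_v[OF p times_cells(1)[OF p(1)] op] T_v[OF p times_cells(2)[OF p(1)] op] times_T[OF p]
    by (simp add: map_space_def c)
qed

lemma segal_components:
  assumes V: "V \<in> \<Phi>" "F \<in> cells (stage V) 0" "G \<in> cells (stage V) 0"
  shows "same_component (css_filter_maps W \<Phi> rep T X Y) (cls 1 0 V F) (cls 1 0 V G) \<longleftrightarrow>
    (\<exists>U\<in>\<Phi>. same_component
       (map_space W (css_forget W 0 0 (css_times W T X (sub_meet (css_product W) V U)))
                    (css_forget W 0 0 (css_times W T Y (sub_meet (css_product W) V U))))
       (css_times_id W T V U F) (css_times_id W T V U G))"
  unfolding stage_components[OF V] css_times_id_def forget_eq
  using forget_components[OF _ refl refl] meet_in[OF V(1)] stage_T_cells[OF V(1) meet_in meet_le(1)] V by simp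

end

end


theorem theorem4p4:
  fixes C :: "'a sset" and \<Phi>\<^sub>C :: "'a set set"
    and rep\<^sub>C :: "'a set \<Rightarrow> 'a" and T\<^sub>C :: "'a set \<Rightarrow> 'a set \<Rightarrow> nat \<Rightarrow> 'a \<Rightarrow> 'a"
    and K :: "('o, 'm) enriched" and \<Phi>\<^sub>K :: "'o set set" and R :: "('o, 'm) filter_products"
    and W :: "'w bisset" and \<Phi>\<^sub>W :: "'w set set"
    and rep\<^sub>W :: "'w set \<Rightarrow> 'w" and T\<^sub>W :: "'w set \<Rightarrow> 'w set \<Rightarrow> nat \<Rightarrow> nat \<Rightarrow> 'w \<Rightarrow> 'w"
  shows
    "(quasi_category C \<and> qc_finitely_complete C \<and>
      product_closed_filter (qc_homs C) (qc_product C) \<Phi>\<^sub>C \<and>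
      qc_filter_diagram C \<Phi>\<^sub>C rep\<^sub>C T\<^sub>C
      \<longrightarrow>
      (\<forall>X\<in>cells (over C (rep\<^sub>C (sub_top (qc_homs C)))) 0.
       \<forall>Y\<in>cells (over C (rep\<^sub>C (sub_top (qc_homs C)))) 0.
       \<forall>f\<in>cells (qc_filter_maps C \<Phi>\<^sub>C rep\<^sub>C T\<^sub>C X Y) 0.
       \<forall>g\<in>cells (qc_filter_maps C \<Phi>\<^sub>C rep\<^sub>C T\<^sub>C X Y) 0.
       \<forall>V\<in>\<Phi>\<^sub>C.
       \<forall>F\<in>cells (hom_right (over C (rep\<^sub>C V)) (qc_times C T\<^sub>C X V) (qc_times C T\<^sub>C Y V)) 0.
       \<forall>G\<in>cells (hom_right (over C (rep\<^sub>C V)) (qc_times C T\<^sub>C X V) (qc_times C T\<^sub>C Y V)) 0.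
         f = qc_class C \<Phi>\<^sub>C rep\<^sub>C T\<^sub>C 1 V F \<and> g = qc_class C \<Phi>\<^sub>C rep\<^sub>C T\<^sub>C 1 V G \<longrightarrow>
         (same_component (qc_filter_maps C \<Phi>\<^sub>C rep\<^sub>C T\<^sub>C X Y) f g
          \<longleftrightarrow>
          (\<exists>U\<in>\<Phi>\<^sub>C.
             same_component
               (hom_right C (forget C 0 (qc_times C T\<^sub>C X (sub_meet (qc_product C) V U)))
                            (forget C 0 (qc_times C T\<^sub>C Y (sub_meet (qc_product C) V U))))
               (qc_times_id C T\<^sub>C V U F) (qc_times_id C T\<^sub>C V U G)))))
     \<and>
     (kan_enriched_category K \<and> kan_finitely_complete K \<and>
      product_closed_filter K (kan_product K) \<Phi>\<^sub>K \<and> kan_filter_products K \<Phi>\<^sub>K R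
      \<longrightarrow>
      (\<forall>X\<in>obj K. \<forall>Y\<in>obj K.
       \<forall>f\<in>cells (maps (kan_filter_quotient K \<Phi>\<^sub>K R) X Y) 0.
       \<forall>g\<in>cells (maps (kan_filter_quotient K \<Phi>\<^sub>K R) X Y) 0.
       \<forall>V\<in>\<Phi>\<^sub>K.
       \<forall>F\<in>cells (maps K (ftimes R X V) (ftimes R Y V)) 0.
       \<forall>G\<in>cells (maps K (ftimes R X V) (ftimes R Y V)) 0.
         f = kan_mor K \<Phi>\<^sub>K R X Y V F \<and> g = kan_mor K \<Phi>\<^sub>K R X Y V G \<longrightarrow>
         (same_component (maps (kan_filter_quotient K \<Phi>\<^sub>K R) X Y) f g
          \<longleftrightarrow>
          (\<exists>U\<in>\<Phi>\<^sub>K.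
             same_component (maps K (ftimes R (ftimes R X V) U) (ftimes R (ftimes R Y V) U))
               (kan_times_id K R (ftimes R X V) (ftimes R Y V) U F)
               (kan_times_id K R (ftimes R X V) (ftimes R Y V) U G)))))
     \<and>
     (complete_segal_space W \<and> css_finitely_complete W \<and>
      product_closed_filter (css_homs W) (css_product W) \<Phi>\<^sub>W \<and>
      css_filter_diagram W \<Phi>\<^sub>W rep\<^sub>W T\<^sub>W
      \<longrightarrow>
      (\<forall>X\<in>bcells (css_over W (rep\<^sub>W (sub_top (css_homs W)))) 0 0.
       \<forall>Y\<in>bcells (css_over W (rep\<^sub>W (sub_top (css_homs W)))) 0 0.
       \<forall>f\<in>cells (css_filter_maps W \<Phi>\<^sub>W rep\<^sub>W T\<^sub>W X Y) 0.
       \<forall>g\<in>cells (css_filter_maps W \<Phi>\<^sub>W rep\<^sub>W T\<^sub>W X Y) 0.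
       \<forall>V\<in>\<Phi>\<^sub>W.
       \<forall>F\<in>cells (map_space (css_over W (rep\<^sub>W V)) (css_times W T\<^sub>W X V) (css_times W T\<^sub>W Y V)) 0.
       \<forall>G\<in>cells (map_space (css_over W (rep\<^sub>W V)) (css_times W T\<^sub>W X V) (css_times W T\<^sub>W Y V)) 0.
         f = css_class W \<Phi>\<^sub>W rep\<^sub>W T\<^sub>W 1 0 V F \<and> g = css_class W \<Phi>\<^sub>W rep\<^sub>W T\<^sub>W 1 0 V G \<longrightarrow>
         (same_component (css_filter_maps W \<Phi>\<^sub>W rep\<^sub>W T\<^sub>W X Y) f g
          \<longleftrightarrow>
          (\<exists>U\<in>\<Phi>\<^sub>W.
             same_component
               (map_space W (css_forget W 0 0 (css_times W T\<^sub>W X (sub_meet (css_product W) V U)))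
                            (css_forget W 0 0 (css_times W T\<^sub>W Y (sub_meet (css_product W) V U))))
               (css_times_id W T\<^sub>W V U F) (css_times_id W T\<^sub>W V U G)))))"
proof (intro conjI impI ballI; elim conjE)
  fix X Y f g V F G
  assume "quasi_category C" "product_closed_filter (qc_homs C) (qc_product C) \<Phi>\<^sub>C"
    "qc_filter_diagram C \<Phi>\<^sub>C rep\<^sub>C T\<^sub>C"
  then interpret quasi_cat_filter C \<Phi>\<^sub>C rep\<^sub>C T\<^sub>C by unfold_locales
  assume X: "X \<in> cells (over C (rep\<^sub>C (sub_top (qc_homs C)))) 0"
    and Y: "Y \<in> cells (over C (rep\<^sub>C (sub_top (qc_homs C)))) 0"
    and V: "V \<in> \<Phi>\<^sub>C"
    and F: "F \<in> cells (hom_right (over C (rep\<^sub>C V)) (qc_times C T\<^sub>C X V) (qc_times C T\<^sub>C Y V)) 0"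
    and G: "G \<in> cells (hom_right (over C (rep\<^sub>C V)) (qc_times C T\<^sub>C X V) (qc_times C T\<^sub>C Y V)) 0"
    and fg: "f = qc_class C \<Phi>\<^sub>C rep\<^sub>C T\<^sub>C 1 V F" "g = qc_class C \<Phi>\<^sub>C rep\<^sub>C T\<^sub>C 1 V G"
  show "same_component (qc_filter_maps C \<Phi>\<^sub>C rep\<^sub>C T\<^sub>C X Y) f g \<longleftrightarrow>
    (\<exists>U\<in>\<Phi>\<^sub>C. same_component
       (hom_right C (forget C 0 (qc_times C T\<^sub>C X (sub_meet (qc_product C) V U)))
                    (forget C 0 (qc_times C T\<^sub>C Y (sub_meet (qc_product C) V U))))
       (qc_times_id C T\<^sub>C V U F) (qc_times_id C T\<^sub>C V U G))"
    unfolding fg by (rule quasi_category_components[OF X Y V F G])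
next
  fix X Y f g V F G
  assume "kan_enriched_category K" "product_closed_filter K (kan_product K) \<Phi>\<^sub>K"
    "kan_filter_products K \<Phi>\<^sub>K R"
  then interpret kan_cat_filter K \<Phi>\<^sub>K R by unfold_locales
  assume X: "X \<in> obj K" and Y: "Y \<in> obj K" and V: "V \<in> \<Phi>\<^sub>K"
    and F: "F \<in> cells (maps K (ftimes R X V) (ftimes R Y V)) 0"
    and G: "G \<in> cells (maps K (ftimes R X V) (ftimes R Y V)) 0"
    and fg: "f = kan_mor K \<Phi>\<^sub>K R X Y V F" "g = kan_mor K \<Phi>\<^sub>K R X Y V G"
  show "same_component (maps (kan_filter_quotient K \<Phi>\<^sub>K R) X Y) f g \<longleftrightarrow>
    (\<exists>U\<in>\<Phi>\<^sub>K. same_component (maps K (ftimes R (ftimes R X V) U) (ftimes R (ftimes R Y V) U))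
       (kan_times_id K R (ftimes R X V) (ftimes R Y V) U F)
       (kan_times_id K R (ftimes R X V) (ftimes R Y V) U G))"
    unfolding fg by (rule kan_components[OF X Y V F G])
next
  fix X Y f g V F G
  assume "complete_segal_space W" "product_closed_filter (css_homs W) (css_product W) \<Phi>\<^sub>W"
    "css_filter_diagram W \<Phi>\<^sub>W rep\<^sub>W T\<^sub>W"
  then interpret segal_filter W \<Phi>\<^sub>W rep\<^sub>W T\<^sub>W
    by unfold_locales (simp_all add: complete_segal_space_def)
  assume X: "X \<in> bcells (css_over W (rep\<^sub>W (sub_top (css_homs W)))) 0 0"
    and Y: "Y \<in> bcells (css_over W (rep\<^sub>W (sub_top (css_homs W)))) 0 0"
    and V: "V \<in> \<Phi>\<^sub>W"
    and F: "F \<in> cells (map_space (css_over W (rep\<^sub>W V)) (css_times W T\<^sub>W X V) (css_times W T\<^sub>W Y V)) 0"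
    and G: "G \<in> cells (map_space (css_over W (rep\<^sub>W V)) (css_times W T\<^sub>W X V) (css_times W T\<^sub>W Y V)) 0"
    and fg: "f = css_class W \<Phi>\<^sub>W rep\<^sub>W T\<^sub>W 1 0 V F" "g = css_class W \<Phi>\<^sub>W rep\<^sub>W T\<^sub>W 1 0 V G"
  show "same_component (css_filter_maps W \<Phi>\<^sub>W rep\<^sub>W T\<^sub>W X Y) f g \<longleftrightarrow>
    (\<exists>U\<in>\<Phi>\<^sub>W. same_component
       (map_space W (css_forget W 0 0 (css_times W T\<^sub>W X (sub_meet (css_product W) V U)))
                    (css_forget W 0 0 (css_times W T\<^sub>W Y (sub_meet (css_product W) V U))))
       (css_times_id W T\<^sub>W V U F) (css_times_id W T\<^sub>W V U G))"
    unfolding fg by (rule segal_components[OF X Y V F G])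
qed

end
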